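(* Let $R$ be a commutative ring and let $H$ be a Hopf algebra over $R$ which is flat as an $R$-module. The maps $\psi:\mathrm{Sub}_{gen}(H)\to\mathrm{Quot}_{gen}(H)$, $\psi(K)=H/K^+H$, and $\phi:\mathrm{Quot}_{gen}(H)\to\mathrm{Sub}_{gen}(H)$, $\phi(Q)=H^{co\,Q}$, are inverse bijections (between all of $\mathrm{Sub}_{gen}(H)$ and all of $\mathrm{Quot}_{gen}(H)$, without any flatness/coflatness conditions on their elements) if and only if for every $Q\in\mathrm{Quot}_{gen}(H)$ the extension $H/H^{co\,Q}$ is $Q$-Galois and for every $K\in\mathrm{Sub}_{gen}(H)$ the coextension $H\to H^K=H/K^+H$ is a $K$-Galois coextension.
   Context: Unadorned $\otimes$ is over $R$. $\mathrm{Sub}_{gen}(H)$ is the poset (under inclusion) of left coideal subalgebras of $H$, i.e. unital subalgebras $K$ with $\Delta(K)\subseteq H\otimes K$; $K^+=K\cap\ker\epsilon$. $\mathrm{Quot}_{gen}(H)$ is the set of quotients $H/I$ by right ideal coideals $I$ (a coideal is a submodule such that $H/I$ is a coalgebra and $H\to H/I$ a coalgebra map), ordered by $H/I\succcurlyeq H/J\Leftrightarrow I\subseteq J$. For $Q$ in it with projection $\pi:H\to Q$, $H^{co\,Q}=\{h\in H:h_{(1)}\otimes\pi(h_{(2)})=h\otimes\pi(1)\}$. $H/H^{co\,Q}$ is $Q$-Galois if $H\otimes_{H^{co\,Q}}H\to H\otimes Q$, $h\otimes h'\mapsto hh'_{(1)}\otimes\pi(h'_{(2)})$, is bijective. $H\to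 H^K$ is a $K$-Galois coextension if $K\otimes H\to H\,\square_{H/K^+H}H$, $k\otimes h\mapsto kh_{(1)}\otimes h_{(2)}$, is bijective, where for a quotient coalgebra $\pi:H\to D$, $H\,\square_DH$ is the equaliser of the two maps $H\otimes H\rightrightarrows H\otimes D\otimes H$, $h\otimes h'\mapsto h_{(1)}\otimes\pi(h_{(2)})\otimes h'$ and $h\otimes h'\mapsto h\otimes\pi(h'_{(1)})\otimes h'_{(2)}$. *)

theory Defs
  imports "HOL-Algebra.Module" "HOL-Algebra.Ideal_Product" "HOL-Algebra.Subrings"
    "HOL-Algebra.Free_Abelian_Groups"
begin

text \<open>Modules are records over the ring \<open>R\<close> in the sense of \<^theory>\<open>HOL-Algebra.Module\<close>; where only the
  module structure is meaningful, the \<open>mult\<close> and \<open>one\<close> fields are \<open>undefined\<close>.\<close>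

definition linear_map ::
  "('r, 'x) ring_scheme \<Rightarrow> ('r, 'm, 'y) module_scheme \<Rightarrow> ('r, 'n, 'z) module_scheme \<Rightarrow> ('m \<Rightarrow> 'n) \<Rightarrow> bool"
  where "linear_map R M N f \<longleftrightarrow>
    f \<in> carrier M \<rightarrow> carrier N \<and>
    (\<forall>x\<in>carrier M. \<forall>y\<in>carrier M. f (x \<oplus>\<^bsub>M\<^esub> y) = f x \<oplus>\<^bsub>N\<^esub> f y) \<and>
    (\<forall>r\<in>carrier R. \<forall>x\<in>carrier M. f (r \<odot>\<^bsub>M\<^esub> x) = r \<odot>\<^bsub>N\<^esub> f x)"

definition regular_module :: "('r, 'x) ring_scheme \<Rightarrow> ('r, 'r) module"
  where "regular_module R =
    \<lparr>carrier = carrier R, monoid.mult = monoid.mult R, monoid.one = monoid.one R,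
     ring.zero = ring.zero R, ring.add = ring.add R, module.smult = monoid.mult R\<rparr>"

definition quot_module :: "('r, 'm, 'y) module_scheme \<Rightarrow> 'm set \<Rightarrow> ('r, 'm set) module"
  where "quot_module M I =
    \<lparr>carrier = a_rcosets\<^bsub>M\<^esub> I, monoid.mult = undefined, monoid.one = undefined, ring.zero = I,
     ring.add = set_add M, module.smult = (\<lambda>r A. \<Union>x\<in>A. I +>\<^bsub>M\<^esub> (r \<odot>\<^bsub>M\<^esub> x))\<rparr>"


section \<open>Tensor products\<close>

text \<open>The tensor product of a right \<open>S\<close>-module \<open>M\<close> (action \<open>ra\<close>) and a left \<open>S\<close>-module \<open>N\<close>
  (action \<open>la\<close>), for a possibly noncommutative ring \<open>S\<close> (only its carrier matters): the free
  abelian group on \<open>M \<times> N\<close> modulo the usual relations. Its elements are cosets of formal sums.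
  It is made an \<open>R\<close>-module through the scalar multiplication of \<open>M\<close>.\<close>

type_synonym ('m, 'n) tens = "(('m \<times> 'n) \<Rightarrow>\<^sub>0 int) set"

definition tensor_rels ::
  "'s set \<Rightarrow> ('m \<Rightarrow> 's \<Rightarrow> 'm) \<Rightarrow> ('s \<Rightarrow> 'n \<Rightarrow> 'n) \<Rightarrow>
   ('m, 'y) ring_scheme \<Rightarrow> ('n, 'z) ring_scheme \<Rightarrow> (('m \<times> 'n) \<Rightarrow>\<^sub>0 int) set"
  where "tensor_rels S ra la M N = generate (free_Abelian_group (carrier M \<times> carrier N))
    ({frag_of (m \<oplus>\<^bsub>M\<^esub> m', n) - frag_of (m, n) - frag_of (m', n) | m m' n.
        m \<in> carrier M \<and> m' \<in> carrier M \<and> n \<in> carrier N} \<union>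
     {frag_of (m, n \<oplus>\<^bsub>N\<^esub> n') - frag_of (m, n) - frag_of (m, n') | m n n'.
        m \<in> carrier M \<and> n \<in> carrier N \<and> n' \<in> carrier N} \<union>
     {frag_of (ra m s, n) - frag_of (m, la s n) | m s n.
        m \<in> carrier M \<and> s \<in> S \<and> n \<in> carrier N})"

definition tens_over ::
  "'s set \<Rightarrow> ('m \<Rightarrow> 's \<Rightarrow> 'm) \<Rightarrow> ('s \<Rightarrow> 'n \<Rightarrow> 'n) \<Rightarrow>
   ('m, 'y) ring_scheme \<Rightarrow> ('n, 'z) ring_scheme \<Rightarrow> 'm \<Rightarrow> 'n \<Rightarrow> ('m, 'n) tens"
  where "tens_over S ra la M N m n =
    tensor_rels S ra la M N #>\<^bsub>free_Abelian_group (carrier M \<times> carrier N)\<^esub> frag_of (m, n)"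

definition tensor_over ::
  "'s set \<Rightarrow> ('m \<Rightarrow> 's \<Rightarrow> 'm) \<Rightarrow> ('s \<Rightarrow> 'n \<Rightarrow> 'n) \<Rightarrow>
   ('r, 'm, 'y) module_scheme \<Rightarrow> ('n, 'z) ring_scheme \<Rightarrow> ('r, ('m, 'n) tens) module"
  where "tensor_over S ra la M N =
    (let F = free_Abelian_group (carrier M \<times> carrier N);
         Z = tensor_rels S ra la M N
     in \<lparr>carrier = carrier (F Mod Z), monoid.mult = undefined, monoid.one = undefined,
         ring.zero = monoid.one (F Mod Z), ring.add = monoid.mult (F Mod Z),
         module.smult = (\<lambda>r A. \<Union>c\<in>A. Z #>\<^bsub>F\<^esub> frag_extend (\<lambda>(m, n). frag_of (r \<odot>\<^bsub>M\<^esub> m, n)) c)\<rparr>)"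

abbreviation tensor ::
  "('r, 'x) ring_scheme \<Rightarrow> ('r, 'm, 'y) module_scheme \<Rightarrow> ('r, 'n, 'z) module_scheme \<Rightarrow>
   ('r, ('m, 'n) tens) module"
  where "tensor R M N \<equiv> tensor_over (carrier R) (\<lambda>m r. r \<odot>\<^bsub>M\<^esub> m) (module.smult N) M N"

abbreviation tens ::
  "('r, 'x) ring_scheme \<Rightarrow> ('r, 'm, 'y) module_scheme \<Rightarrow> ('r, 'n, 'z) module_scheme \<Rightarrow>
   'm \<Rightarrow> 'n \<Rightarrow> ('m, 'n) tens"
  where "tens R M N \<equiv> tens_over (carrier R) (\<lambda>m r. r \<odot>\<^bsub>M\<^esub> m) (module.smult N) M N"

text \<open>The additive map \<open>m \<otimes> n \<mapsto> f m n\<close> into \<open>P\<close> induced by a balanced biadditive \<open>f\<close>: the image of a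
  coset under the extension of \<open>f\<close> to formal sums is then a singleton. In particular
  \<open>tensor_lift P f (\<Delta> h)\<close> is the Sweedler expression \<open>f h\<^sub>(\<^sub>1\<^sub>) h\<^sub>(\<^sub>2\<^sub>)\<close>.\<close>

definition tensor_lift ::
  "('p, 'w) ring_scheme \<Rightarrow> ('m \<Rightarrow> 'n \<Rightarrow> 'p) \<Rightarrow> ('m, 'n) tens \<Rightarrow> 'p"
  where "tensor_lift P f A = the_elem
    ((\<lambda>c. \<Oplus>\<^bsub>P\<^esub> p \<in> Poly_Mapping.keys c. [Poly_Mapping.lookup c p] \<cdot>\<^bsub>P\<^esub> case_prod f p) ` A)"

text \<open>HOL cannot quantify over all modules inside a formula, so the test modules have their elements
  in a given type \<open>'u\<close>. All \<open>'u\<close> into which \<open>carrier R\<close> embeds give the same notion, since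
  flatness can be tested on the inclusions of ideals into \<open>R\<close>.\<close>

definition flat :: "'u itself \<Rightarrow> ('r, 'x) ring_scheme \<Rightarrow> ('r, 'm, 'y) module_scheme \<Rightarrow> bool"
  where "flat _ R M \<longleftrightarrow>
    (\<forall>(N :: ('r, 'u) module) (N' :: ('r, 'u) module) f.
       module R N \<and> module R N' \<and> linear_map R N N' f \<and> inj_on f (carrier N) \<longrightarrow>
       inj_on (tensor_lift (tensor R M N') (\<lambda>m n. tens R M N' m (f n))) (carrier (tensor R M N)))"


section \<open>Coalgebras and Hopf algebras\<close>

locale coalgebra = module R C for R (structure) and C (structure) +
  fixes \<Delta> and \<epsilon>
  assumes comult_linear: "linear_map R C (tensor R C C) \<Delta>"
    and counit_linear: "linear_map R C (regular_module R) \<epsilon>"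
    and coassoc: "x \<in> carrier C \<Longrightarrow>
      tensor_lift (tensor R C (tensor R C C)) (\<lambda>a b. tens R C (tensor R C C) a (\<Delta> b)) (\<Delta> x) =
      tensor_lift (tensor R C (tensor R C C))
        (\<lambda>a b. tensor_lift (tensor R C (tensor R C C))
                 (\<lambda>c d. tens R C (tensor R C C) c (tens R C C d b)) (\<Delta> a)) (\<Delta> x)"
    and counit_left: "x \<in> carrier C \<Longrightarrow> tensor_lift C (\<lambda>a b. \<epsilon> a \<odot>\<^bsub>C\<^esub> b) (\<Delta> x) = x"
    and counit_right: "x \<in> carrier C \<Longrightarrow> tensor_lift C (\<lambda>a b. \<epsilon> b \<odot>\<^bsub>C\<^esub> a) (\<Delta> x) = x"

definition coalgebra_map ::
  "('r, 'x) ring_scheme \<Rightarrow>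
   ('r, 'c, 'y) module_scheme \<Rightarrow> ('c \<Rightarrow> ('c, 'c) tens) \<Rightarrow> ('c \<Rightarrow> 'r) \<Rightarrow>
   ('r, 'd, 'z) module_scheme \<Rightarrow> ('d \<Rightarrow> ('d, 'd) tens) \<Rightarrow> ('d \<Rightarrow> 'r) \<Rightarrow> ('c \<Rightarrow> 'd) \<Rightarrow> bool"
  where "coalgebra_map R C \<Delta> \<epsilon> D \<Delta>' \<epsilon>' f \<longleftrightarrow>
    linear_map R C D f \<and>
    (\<forall>x\<in>carrier C. \<Delta>' (f x) = tensor_lift (tensor R D D) (\<lambda>a b. tens R D D (f a) (f b)) (\<Delta> x)) \<and>
    (\<forall>x\<in>carrier C. \<epsilon>' (f x) = \<epsilon> x)"

text \<open>The locale \<^locale>\<open>algebra\<close> is not used because it requires a commutative algebra.\<close>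

locale hopf_algebra = coalgebra R H \<Delta> \<epsilon> + H: ring H
  for R (structure) and H (structure) and \<Delta> and \<epsilon> +
  fixes antipode
  assumes smult_mult_left: "\<lbrakk>r \<in> carrier R; x \<in> carrier H; y \<in> carrier H\<rbrakk> \<Longrightarrow>
        (r \<odot>\<^bsub>H\<^esub> x) \<otimes>\<^bsub>H\<^esub> y = r \<odot>\<^bsub>H\<^esub> (x \<otimes>\<^bsub>H\<^esub> y)"
    and smult_mult_right: "\<lbrakk>r \<in> carrier R; x \<in> carrier H; y \<in> carrier H\<rbrakk> \<Longrightarrow>
        x \<otimes>\<^bsub>H\<^esub> (r \<odot>\<^bsub>H\<^esub> y) = r \<odot>\<^bsub>H\<^esub> (x \<otimes>\<^bsub>H\<^esub> y)"
    and comult_mult: "\<lbrakk>x \<in> carrier H; y \<in> carrier H\<rbrakk> \<Longrightarrow>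
        \<Delta> (x \<otimes>\<^bsub>H\<^esub> y) = tensor_lift (tensor R H H)
          (\<lambda>a b. tensor_lift (tensor R H H)
                   (\<lambda>c d. tens R H H (a \<otimes>\<^bsub>H\<^esub> c) (b \<otimes>\<^bsub>H\<^esub> d)) (\<Delta> y)) (\<Delta> x)"
    and comult_one: "\<Delta> \<one>\<^bsub>H\<^esub> = tens R H H \<one>\<^bsub>H\<^esub> \<one>\<^bsub>H\<^esub>"
    and counit_mult: "\<lbrakk>x \<in> carrier H; y \<in> carrier H\<rbrakk> \<Longrightarrow> \<epsilon> (x \<otimes>\<^bsub>H\<^esub> y) = \<epsilon> x \<otimes>\<^bsub>R\<^esub> \<epsilon> y"
    and counit_one: "\<epsilon> \<one>\<^bsub>H\<^esub> = \<one>\<^bsub>R\<^esub>"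
    and antipode_linear: "linear_map R H H antipode"
    and antipode_left: "x \<in> carrier H \<Longrightarrow>
        tensor_lift H (\<lambda>a b. antipode a \<otimes>\<^bsub>H\<^esub> b) (\<Delta> x) = \<epsilon> x \<odot>\<^bsub>H\<^esub> \<one>\<^bsub>H\<^esub>"
    and antipode_right: "x \<in> carrier H \<Longrightarrow>
        tensor_lift H (\<lambda>a b. a \<otimes>\<^bsub>H\<^esub> antipode b) (\<Delta> x) = \<epsilon> x \<odot>\<^bsub>H\<^esub> \<one>\<^bsub>H\<^esub>"


section \<open>Left coideal subalgebras and quotients\<close>

text \<open>\<open>\<Delta>(K) \<subseteq> H \<otimes> K\<close>, where \<open>H \<otimes> K\<close> stands for its image in \<open>H \<otimes> H\<close>
  (the canonical map is injective when \<open>H\<close> is flat).\<close>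

definition Sub_gen ::
  "('r, 'x) ring_scheme \<Rightarrow> ('r, 'h, 'y) module_scheme \<Rightarrow> ('h \<Rightarrow> ('h, 'h) tens) \<Rightarrow> 'h set set"
  where "Sub_gen R H \<Delta> = {K. subring K H \<and> submodule K R H \<and>
    \<Delta> ` K \<subseteq> tensor_lift (tensor R H H) (\<lambda>h k. tens R H H h k) `
               carrier (tensor R H (H\<lparr>carrier := K\<rparr>))}"

definition right_ideal :: "'h set \<Rightarrow> ('h, 'y) ring_scheme \<Rightarrow> bool"
  where "right_ideal I H \<longleftrightarrow> additive_subgroup I H \<and> (\<forall>x\<in>I. \<forall>h\<in>carrier H. x \<otimes>\<^bsub>H\<^esub> h \<in> I)"

definition coideal ::
  "('r, 'x) ring_scheme \<Rightarrow> ('r, 'h, 'y) module_scheme \<Rightarrow> ('h \<Rightarrow> ('h, 'h) tens) \<Rightarrow> ('h \<Rightarrow> 'r) \<Rightarrow>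
   'h set \<Rightarrow> bool"
  where "coideal R H \<Delta> \<epsilon> I \<longleftrightarrow> submodule I R H \<and>
    (\<exists>\<Delta>' \<epsilon>'. coalgebra R (quot_module H I) \<Delta>' \<epsilon>' \<and>
       coalgebra_map R H \<Delta> \<epsilon> (quot_module H I) \<Delta>' \<epsilon>' (\<lambda>h. I +>\<^bsub>H\<^esub> h))"

definition Quot_gen ::
  "('r, 'x) ring_scheme \<Rightarrow> ('r, 'h, 'y) module_scheme \<Rightarrow> ('h \<Rightarrow> ('h, 'h) tens) \<Rightarrow> ('h \<Rightarrow> 'r) \<Rightarrow>
   ('r, 'h set) module set"
  where "Quot_gen R H \<Delta> \<epsilon> = {quot_module H I | I. right_ideal I H \<and> coideal R H \<Delta> \<epsilon> I}"

text \<open>The projection \<open>H \<rightarrow> Q\<close> for \<open>Q = H/I\<close>; note that \<open>I\<close> is the zero element of \<open>H/I\<close>.\<close>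

definition proj :: "('r, 'h, 'y) module_scheme \<Rightarrow> ('r, 'h set) module \<Rightarrow> 'h \<Rightarrow> 'h set"
  where "proj H Q h = \<zero>\<^bsub>Q\<^esub> +>\<^bsub>H\<^esub> h"

definition coinvariants ::
  "('r, 'x) ring_scheme \<Rightarrow> ('r, 'h, 'y) module_scheme \<Rightarrow> ('h \<Rightarrow> ('h, 'h) tens) \<Rightarrow>
   ('r, 'h set) module \<Rightarrow> 'h set"
  where "coinvariants R H \<Delta> Q = {h \<in> carrier H.
    tensor_lift (tensor R H Q) (\<lambda>a b. tens R H Q a (proj H Q b)) (\<Delta> h) =
    tens R H Q h (proj H Q \<one>\<^bsub>H\<^esub>)}"

text \<open>\<^const>\<open>ideal_prod\<close> \<open>H A B\<close> consists, for arbitrary nonempty sets, of the nonempty finite sums of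
  products; here this is \<open>K\<^sup>+H\<close>.\<close>

definition aug_quotient ::
  "('r, 'x) ring_scheme \<Rightarrow> ('r, 'h, 'y) module_scheme \<Rightarrow> ('h \<Rightarrow> 'r) \<Rightarrow> 'h set \<Rightarrow>
   ('r, 'h set) module"
  where "aug_quotient R H \<epsilon> K =
    quot_module H (ideal_prod H {k \<in> K. \<epsilon> k = \<zero>\<^bsub>R\<^esub>} (carrier H))"


section \<open>Galois extensions and coextensions\<close>

definition Galois_extension ::
  "('r, 'x) ring_scheme \<Rightarrow> ('r, 'h, 'y) module_scheme \<Rightarrow> ('h \<Rightarrow> ('h, 'h) tens) \<Rightarrow>
   ('r, 'h set) module \<Rightarrow> bool"
  where "Galois_extension R H \<Delta> Q \<longleftrightarrow>
    bij_betw
      (tensor_lift (tensor R H Q)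
        (\<lambda>h h'. tensor_lift (tensor R H Q)
                  (\<lambda>a b. tens R H Q (h \<otimes>\<^bsub>H\<^esub> a) (proj H Q b)) (\<Delta> h')))
      (carrier (tensor_over (coinvariants R H \<Delta> Q) (monoid.mult H) (monoid.mult H) H H))
      (carrier (tensor R H Q))"

definition cotensor ::
  "('r, 'x) ring_scheme \<Rightarrow> ('r, 'h, 'y) module_scheme \<Rightarrow> ('h \<Rightarrow> ('h, 'h) tens) \<Rightarrow>
   ('r, 'h set) module \<Rightarrow> ('h, 'h) tens set"
  where "cotensor R H \<Delta> D =
    (let T = tensor R D H; U = tensor R H T in
     {A \<in> carrier (tensor R H H).
       tensor_lift U
         (\<lambda>h h'. tensor_lift U (\<lambda>a b. tens R H T a (tens R D H (proj H D b) h')) (\<Delta> h)) A =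
       tensor_lift U
         (\<lambda>h h'. tensor_lift U (\<lambda>a b. tens R H T h (tens R D H (proj H D a) b)) (\<Delta> h')) A})"

definition Galois_coextension ::
  "('r, 'x) ring_scheme \<Rightarrow> ('r, 'h, 'y) module_scheme \<Rightarrow> ('h \<Rightarrow> ('h, 'h) tens) \<Rightarrow> ('h \<Rightarrow> 'r) \<Rightarrow>
   'h set \<Rightarrow> bool"
  where "Galois_coextension R H \<Delta> \<epsilon> K \<longleftrightarrow>
    bij_betw
      (tensor_lift (tensor R H H)
        (\<lambda>k h. tensor_lift (tensor R H H) (\<lambda>a b. tens R H H (k \<otimes>\<^bsub>H\<^esub> a) b) (\<Delta> h)))
      (carrier (tensor R (H\<lparr>carrier := K\<rparr>) H))
      (cotensor R H \<Delta> (aug_quotient R H \<epsilon> K))"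

definition inverse_bijections :: "('a \<Rightarrow> 'b) \<Rightarrow> ('b \<Rightarrow> 'a) \<Rightarrow> 'a set \<Rightarrow> 'b set \<Rightarrow> bool"
  where "inverse_bijections f g A B \<longleftrightarrow>
    f \<in> A \<rightarrow> B \<and> g \<in> B \<rightarrow> A \<and> (\<forall>a\<in>A. g (f a) = a) \<and> (\<forall>b\<in>B. f (g b) = b)"

end

theory Submission
  imports Defs
begin

text \<open>
  Let \<open>K\<close> be a left coideal subalgebra and \<open>Q = H/K\<^sup>+H\<close>. The canonical map
  \<open>H \<otimes>\<^sub>K H \<rightarrow> H \<otimes> Q\<close>, \<open>h \<otimes> x \<mapsto> hx\<^sub>1 \<otimes> \<pi>(x\<^sub>2)\<close>, is always bijective: \<open>h \<otimes> x \<mapsto> hS(x\<^sub>1) \<otimes> x\<^sub>2\<close>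
  induces its inverse (\<open>can_bij\<close>). Dually, let \<open>Q = H/I\<close> be any quotient and \<open>C\<close> its coinvariants.
  Then \<open>C \<otimes> H \<rightarrow> H \<box>\<^sub>Q H\<close> is always bijective (\<open>coinv_Galois_coextension\<close>): the automorphism
  \<open>h \<otimes> x \<mapsto> hx\<^sub>1 \<otimes> x\<^sub>2\<close> of \<open>H \<otimes> H\<close> turns the equation that defines \<open>H \<box>\<^sub>Q H\<close> into
  \<open>a\<^sub>1 \<otimes> \<pi>(a\<^sub>2) \<otimes> b = a \<otimes> \<pi>(1) \<otimes> b\<close>, and the solutions of this equation form \<open>C \<otimes> H\<close> because \<open>H\<close> is
  flat and \<open>C\<close> is the kernel of \<open>a \<mapsto> a\<^sub>1 \<otimes> \<pi>(a\<^sub>2) - a \<otimes> \<pi>(1)\<close>. If \<open>\<phi>\<close> and \<open>\<psi>\<close> are mutually inverse,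
  every \<open>Q\<close> is \<open>H/K\<^sup>+H\<close> for its own coinvariants \<open>K\<close>, and every \<open>K\<close> is the algebra of coinvariants
  of \<open>H/K\<^sup>+H\<close>; so these two facts give all the Galois conditions.

  The converse evaluates the Galois maps at single elements. For \<open>x \<in> I\<close> the element
  \<open>S(x\<^sub>1) \<otimes> x\<^sub>2\<close> of \<open>H \<otimes>\<^sub>C H\<close> goes to \<open>1 \<otimes> \<pi>(x) = 0\<close>. If \<open>H/C\<close> is \<open>Q\<close>-Galois it is therefore \<open>0\<close>, and
  \<open>a \<otimes> b \<mapsto> \<epsilon>(a)b + C\<^sup>+H\<close> yields \<open>x \<in> C\<^sup>+H\<close> (\<open>Galois_extension_imp_ideal\<close>). For \<open>x\<close> coinvariant
  under \<open>H/K\<^sup>+H\<close> the element \<open>x \<otimes> 1\<close> lies in the cotensor product. If \<open>H \<rightarrow> H/K\<^sup>+H\<close> is \<open>K\<close>-Galois it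
  comes from \<open>K \<otimes> H\<close>, and \<open>a \<otimes> b \<mapsto> aS(b)\<close> yields \<open>x \<in> K\<close> (\<open>coinv_subset_K\<close>).

  Both maps are well defined. On \<open>H/K\<^sup>+H\<close> the comultiplication of \<open>H\<close> descends because \<open>k\<^sub>2\<close> can be
  taken in \<open>K\<close> (\<open>Q_Quot_gen\<close>). That \<open>\<Delta>(C) \<subseteq> H \<otimes> C\<close> is again flatness: by coassociativity \<open>\<Delta>(c)\<close> is
  killed by \<open>id\<close> tensored with the map of which \<open>C\<close> is the kernel (\<open>coinv_coideal\<close>).

  Throughout, \<open>sw P f x\<close> is the Sweedler expression \<open>f(x\<^sub>1, x\<^sub>2)\<close> for a bilinear \<open>f\<close> with values in the
  module \<open>P\<close>; nested occurrences express longer ones. The Hopf algebra axioms become rules for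
  such expressions, whose side conditions all say that some term is multilinear.
\<close>

section \<open>Linear and bilinear maps\<close>

lemma linear_mapI:
  assumes "\<And>x. x \<in> carrier M \<Longrightarrow> f x \<in> carrier N"
    and "\<And>x y. x \<in> carrier M \<Longrightarrow> y \<in> carrier M \<Longrightarrow> f (x \<oplus>\<^bsub>M\<^esub> y) = f x \<oplus>\<^bsub>N\<^esub> f y"
    and "\<And>r x. r \<in> carrier R \<Longrightarrow> x \<in> carrier M \<Longrightarrow> f (r \<odot>\<^bsub>M\<^esub> x) = r \<odot>\<^bsub>N\<^esub> f x"
  shows "linear_map R M N f"
  using assms by (auto simp: linear_map_def)

lemma linear_map_closed: "linear_map R M N f \<Longrightarrow> x \<in> carrier M \<Longrightarrow> f x \<in> carrier N"
  and linear_map_add: "linear_map R M N f \<Longrightarrow> x \<in> carrier M \<Longrightarrow> y \<in> carrier M \<Longrightarrow>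
    f (x \<oplus>\<^bsub>M\<^esub> y) = f x \<oplus>\<^bsub>N\<^esub> f y"
  and linear_map_smult: "linear_map R M N f \<Longrightarrow> r \<in> carrier R \<Longrightarrow> x \<in> carrier M \<Longrightarrow>
    f (r \<odot>\<^bsub>M\<^esub> x) = r \<odot>\<^bsub>N\<^esub> f x"
  by (auto simp: linear_map_def)

lemma module_group: "module R M \<Longrightarrow> abelian_group M"
  by (auto simp: module_def)

lemma additive_map_zero:
  assumes "abelian_group M" "abelian_group N" "\<And>x. x \<in> carrier M \<Longrightarrow> f x \<in> carrier N"
    "\<And>x y. x \<in> carrier M \<Longrightarrow> y \<in> carrier M \<Longrightarrow> f (x \<oplus>\<^bsub>M\<^esub> y) = f x \<oplus>\<^bsub>N\<^esub> f y"
  shows "f \<zero>\<^bsub>M\<^esub> = \<zero>\<^bsub>N\<^esub>"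
    and "x \<in> carrier M \<Longrightarrow> f (\<ominus>\<^bsub>M\<^esub> x) = \<ominus>\<^bsub>N\<^esub> f x"
proof -
  interpret M: abelian_group M by fact
  interpret N: abelian_group N by fact
  have "f (\<zero>\<^bsub>M\<^esub> \<oplus>\<^bsub>M\<^esub> \<zero>\<^bsub>M\<^esub>) = f \<zero>\<^bsub>M\<^esub> \<oplus>\<^bsub>N\<^esub> f \<zero>\<^bsub>M\<^esub>"
    by (rule assms(4)) auto
  then show z: "f \<zero>\<^bsub>M\<^esub> = \<zero>\<^bsub>N\<^esub>"
    using assms(3) by (metis M.zero_closed M.l_zero N.add.r_cancel_one')
  assume x: "x \<in> carrier M"
  have "f (\<ominus>\<^bsub>M\<^esub> x) \<oplus>\<^bsub>N\<^esub> f x = \<zero>\<^bsub>N\<^esub>"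
    using x by (simp flip: assms(4) add: M.l_neg z)
  then show "f (\<ominus>\<^bsub>M\<^esub> x) = \<ominus>\<^bsub>N\<^esub> f x"
    using x assms(3) by (metis M.a_inv_closed N.minus_equality)
qed

lemma linear_map_zero:
  assumes "module R M" "module R N" "linear_map R M N f"
  shows "f \<zero>\<^bsub>M\<^esub> = \<zero>\<^bsub>N\<^esub>"
  using additive_map_zero(1)[OF module_group module_group, of R M R N f] assms
  by (auto simp: linear_map_def)

lemma linear_map_minus:
  assumes "module R M" "module R N" "linear_map R M N f" "x \<in> carrier M"
  shows "f (\<ominus>\<^bsub>M\<^esub> x) = \<ominus>\<^bsub>N\<^esub> f x"
  using additive_map_zero(2)[OF module_group module_group, of R M R N f x] assms
  by (auto simp: linear_map_def)

lemma linear_map_diff: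
  assumes "module R M" "module R N" "linear_map R M N f" "x \<in> carrier M" "y \<in> carrier M"
  shows "f (x \<ominus>\<^bsub>M\<^esub> y) = f x \<ominus>\<^bsub>N\<^esub> f y"
proof -
  interpret M: module R M by fact
  show ?thesis using assms
    by (simp add: a_minus_def linear_map_add linear_map_minus)
qed

lemma linear_map_id: "linear_map R M M (\<lambda>x. x)"
  by (auto simp: linear_map_def)

lemma linear_map_comp:
  "linear_map R N P g \<Longrightarrow> linear_map R M N f \<Longrightarrow> linear_map R M P (\<lambda>x. g (f x))"
  by (auto simp: linear_map_def Pi_iff)

lemma linear_map_cong:
  assumes "module R M" "linear_map R M N f" "\<And>x. x \<in> carrier M \<Longrightarrow> f x = g x"
  shows "linear_map R M N g"
proof -
  interpret M: module R M by fact
  show ?thesis using assms(2,3) by (auto simp: linear_map_def Pi_iff)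
qed

lemma linear_map_diffI:
  assumes "module R M" "module R N" "linear_map R M N f" "linear_map R M N g"
  shows "linear_map R M N (\<lambda>x. f x \<ominus>\<^bsub>N\<^esub> g x)"
proof -
  interpret M: module R M by fact
  interpret N: module R N by fact
  note fg = linear_map_closed[OF assms(3)] linear_map_closed[OF assms(4)]
  show ?thesis
  proof (rule linear_mapI)
    fix x y assume "x \<in> carrier M" "y \<in> carrier M"
    then show "f (x \<oplus>\<^bsub>M\<^esub> y) \<ominus>\<^bsub>N\<^esub> g (x \<oplus>\<^bsub>M\<^esub> y) = f x \<ominus>\<^bsub>N\<^esub> g x \<oplus>\<^bsub>N\<^esub> (f y \<ominus>\<^bsub>N\<^esub> g y)"
      using fg by (simp add: linear_map_add[OF assms(3)] linear_map_add[OF assms(4)] a_minus_def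
          N.minus_add N.a_ac)
  qed (use fg in \<open>auto simp: linear_map_smult[OF assms(3)] linear_map_smult[OF assms(4)] a_minus_def
          N.smult_r_distr N.smult_r_minus\<close>)
qed

definition bilinear_map ::
  "('r, 'x) ring_scheme \<Rightarrow> ('r, 'm, 'y) module_scheme \<Rightarrow> ('r, 'n, 'z) module_scheme \<Rightarrow>
   ('r, 'p, 'w) module_scheme \<Rightarrow> ('m \<Rightarrow> 'n \<Rightarrow> 'p) \<Rightarrow> bool"
  where "bilinear_map R M N P f \<longleftrightarrow>
    (\<forall>n\<in>carrier N. linear_map R M P (\<lambda>m. f m n)) \<and> (\<forall>m\<in>carrier M. linear_map R N P (f m))"

lemma bilinear_mapI:
  assumes "\<And>n. n \<in> carrier N \<Longrightarrow> linear_map R M P (\<lambda>m. f m n)"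
    and "\<And>m. m \<in> carrier M \<Longrightarrow> linear_map R N P (\<lambda>n. f m n)"
  shows "bilinear_map R M N P f"
  using assms by (auto simp: bilinear_map_def)

lemma bilinear_map_left: "bilinear_map R M N P f \<Longrightarrow> n \<in> carrier N \<Longrightarrow> linear_map R M P (\<lambda>m. f m n)"
  and bilinear_map_right: "bilinear_map R M N P f \<Longrightarrow> m \<in> carrier M \<Longrightarrow> linear_map R N P (\<lambda>n. f m n)"
  and bilinear_map_closed: "bilinear_map R M N P f \<Longrightarrow> m \<in> carrier M \<Longrightarrow> n \<in> carrier N \<Longrightarrow>
    f m n \<in> carrier P"
  by (auto simp: bilinear_map_def linear_map_def)


section \<open>Tensor products\<close>

text \<open>The additive extension of \<open>f\<close> to formal sums, of which \<^const>\<open>tensor_lift\<close> takes the common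
  value on a coset of relations.\<close>

definition formal_sum_value ::
  "('p, 'w) ring_scheme \<Rightarrow> ('m \<Rightarrow> 'n \<Rightarrow> 'p) \<Rightarrow> ('m \<times> 'n \<Rightarrow>\<^sub>0 int) \<Rightarrow> 'p"
  where "formal_sum_value P f c =
    (\<Oplus>\<^bsub>P\<^esub> p \<in> Poly_Mapping.keys c. [Poly_Mapping.lookup c p] \<cdot>\<^bsub>P\<^esub> case_prod f p)"

text \<open>The right action on \<open>M\<close> has to commute with the scalars of \<open>R\<close>, so that these act on
  \<open>M \<otimes>\<^sub>S N\<close> through the left factor. One development then covers both \<open>H \<otimes>\<^sub>K H\<close> and the tensor
  products over \<open>R\<close>.\<close>

locale balanced_pair = module R M + N: abelian_group N
  for R (structure) and M (structure) and N (structure) +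
  fixes S :: "'s set" and ra la
  assumes ra_closed: "m \<in> carrier M \<Longrightarrow> s \<in> S \<Longrightarrow> ra m s \<in> carrier M"
    and la_closed: "n \<in> carrier N \<Longrightarrow> s \<in> S \<Longrightarrow> la s n \<in> carrier N"
    and ra_smult: "r \<in> carrier R \<Longrightarrow> m \<in> carrier M \<Longrightarrow> s \<in> S \<Longrightarrow> ra (r \<odot>\<^bsub>M\<^esub> m) s = r \<odot>\<^bsub>M\<^esub> ra m s"
begin

definition "F = free_Abelian_group (carrier M \<times> carrier N)"
definition "Z = tensor_rels S ra la M N"
definition "T = tensor_over S ra la M N"
definition "cls c = Z #>\<^bsub>F\<^esub> c"

lemma tens_cls: "tens_over S ra la M N m n = cls (frag_of (m, n))"
  by (simp add: tens_over_def cls_def F_def Z_def)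

definition "gens =
    ({frag_of (m \<oplus>\<^bsub>M\<^esub> m', n) - frag_of (m, n) - frag_of (m', n) | m m' n.
        m \<in> carrier M \<and> m' \<in> carrier M \<and> n \<in> carrier N} \<union>
     {frag_of (m, n \<oplus>\<^bsub>N\<^esub> n') - frag_of (m, n) - frag_of (m, n') | m n n'.
        m \<in> carrier M \<and> n \<in> carrier N \<and> n' \<in> carrier N} \<union>
     {frag_of (ra m s, n) - frag_of (m, la s n) | m s n.
        m \<in> carrier M \<and> s \<in> S \<and> n \<in> carrier N})"

lemma Z_gens: "Z = generate F gens"
  by (simp add: Z_def F_def tensor_rels_def gens_def)

lemma F_closed: "0 \<in> carrier F" "c \<in> carrier F \<Longrightarrow> d \<in> carrier F \<Longrightarrow> c + d \<in> carrier F"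
  "c \<in> carrier F \<Longrightarrow> - c \<in> carrier F" "c \<in> carrier F \<Longrightarrow> d \<in> carrier F \<Longrightarrow> c - d \<in> carrier F"
  by (auto simp: F_def dest: subsetD[OF keys_add] subsetD[OF keys_diff])

lemma frag_F: "m \<in> carrier M \<Longrightarrow> n \<in> carrier N \<Longrightarrow> frag_of (m, n) \<in> carrier F"
  by (simp add: F_def)

lemma gens_F: "gens \<subseteq> carrier F"
  unfolding gens_def by (auto simp: ra_closed la_closed intro!: F_closed frag_F)

lemma comm_group_F: "comm_group F"
  by (simp add: F_def abelian_free_Abelian_group)

lemma group_F: "group F"
  by (simp add: F_def)

lemma subgroup_Z: "subgroup Z F"
  unfolding Z_gens by (rule group.generate_is_subgroup[OF group_F gens_F])

lemma normal_Z: "Z \<lhd> F"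
  by (rule comm_group.subgroup_imp_normal[OF comm_group_F subgroup_Z])

lemma carrier_T: "carrier T = cls ` carrier F"
  by (auto simp: T_def tensor_over_def Let_def FactGroup_def RCOSETS_def cls_def F_def Z_def)

lemma zero_T: "\<zero>\<^bsub>T\<^esub> = cls 0"
proof -
  have "\<zero>\<^bsub>T\<^esub> = Z"
    by (simp add: T_def tensor_over_def Let_def FactGroup_def F_def Z_def)
  also have "Z = cls 0"
    unfolding cls_def using group.coset_mult_one[OF group_F subgroup.subset[OF subgroup_Z]]
    by (simp add: F_def)
  finally show ?thesis .
qed

lemma cls_add: "c \<in> carrier F \<Longrightarrow> d \<in> carrier F \<Longrightarrow> cls (c + d) = cls c \<oplus>\<^bsub>T\<^esub> cls d"
  using normal.rcos_sum[OF normal_Z, of c d]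
  by (simp add: T_def tensor_over_def Let_def FactGroup_def cls_def F_def Z_def)

lemma cls_F: "c \<in> carrier F \<Longrightarrow> cls c \<in> carrier T"
  by (simp add: carrier_T)

lemma T_cases: assumes "A \<in> carrier T" obtains c where "c \<in> carrier F" "A = cls c"
  using assms by (auto simp: carrier_T)

lemma T_group: "abelian_group T"
proof (rule abelian_groupI)
  fix A B assume "A \<in> carrier T" "B \<in> carrier T"
  then obtain a b where ab: "a \<in> carrier F" "A = cls a" "b \<in> carrier F" "B = cls b" by (metis T_cases)
  show "A \<oplus>\<^bsub>T\<^esub> B \<in> carrier T"
    using ab cls_F F_closed(2) by (metis cls_add)
  show "A \<oplus>\<^bsub>T\<^esub> B = B \<oplus>\<^bsub>T\<^esub> A"
    using ab by (metis cls_add add.commute)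
  fix C assume "C \<in> carrier T"
  then obtain c where c: "c \<in> carrier F" "C = cls c" by (metis T_cases)
  show "A \<oplus>\<^bsub>T\<^esub> B \<oplus>\<^bsub>T\<^esub> C = A \<oplus>\<^bsub>T\<^esub> (B \<oplus>\<^bsub>T\<^esub> C)"
    using ab c by (simp add: F_closed add.assoc flip: cls_add)
next
  show "\<zero>\<^bsub>T\<^esub> \<in> carrier T" by (simp add: zero_T cls_F F_closed)
next
  fix A assume "A \<in> carrier T"
  then obtain c where c: "c \<in> carrier F" "A = cls c" by (metis T_cases)
  show "\<zero>\<^bsub>T\<^esub> \<oplus>\<^bsub>T\<^esub> A = A"
    using c by (metis zero_T cls_add F_closed(1) add_0)
  have "cls (- c) \<oplus>\<^bsub>T\<^esub> A = \<zero>\<^bsub>T\<^esub>"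
    using c by (metis zero_T cls_add F_closed(3) ab_left_minus)
  then show "\<exists>B\<in>carrier T. B \<oplus>\<^bsub>T\<^esub> A = \<zero>\<^bsub>T\<^esub>"
    using c cls_F F_closed by blast
qed

lemma cls_eqI: assumes "c \<in> carrier F" "d \<in> carrier F" "c - d \<in> Z" shows "cls c = cls d"
proof -
  have "c \<otimes>\<^bsub>F\<^esub> inv\<^bsub>F\<^esub> d = c - d"
    using assms by (simp add: F_def)
  then have "c \<in> Z #>\<^bsub>F\<^esub> d"
    using subgroup.rcos_module_rev[OF subgroup_Z group_F, of d c] assms by simp
  then have "Z #>\<^bsub>F\<^esub> d = Z #>\<^bsub>F\<^esub> c"
    by (rule group.repr_independence[OF group_F _ assms(2) subgroup_Z])
  then show ?thesis by (simp add: cls_def)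
qed

lemma cls_gensI: "c \<in> carrier F \<Longrightarrow> d \<in> carrier F \<Longrightarrow> c - d \<in> gens \<Longrightarrow> cls c = cls d"
  by (rule cls_eqI) (auto simp: Z_gens intro: generate.incl)

lemma Z_closed: "0 \<in> Z" "c \<in> Z \<Longrightarrow> d \<in> Z \<Longrightarrow> c + d \<in> Z" "c \<in> Z \<Longrightarrow> - c \<in> Z" "c \<in> Z \<Longrightarrow> c \<in> carrier F"
proof -
  show "0 \<in> Z" "c \<in> Z \<Longrightarrow> d \<in> Z \<Longrightarrow> c + d \<in> Z" "c \<in> Z \<Longrightarrow> c \<in> carrier F"
    using subgroup.one_closed[OF subgroup_Z] subgroup.m_closed[OF subgroup_Z, of c d]
      subsetD[OF subgroup.subset[OF subgroup_Z], of c] by (simp_all add: F_def)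
  show "c \<in> Z \<Longrightarrow> - c \<in> Z"
    using subgroup.m_inv_closed[OF subgroup_Z, of c] subgroup.subset[OF subgroup_Z]
    by (auto simp: F_def)
qed

lemma cls_elem: "c' \<in> cls c \<longleftrightarrow> (\<exists>z\<in>Z. c' = z + c)"
  by (auto simp: cls_def r_coset_def F_def)

lemma Z_induct [consumes 1, case_names zero gen add minus]:
  assumes "z \<in> Z" "P 0" "\<And>g. g \<in> gens \<Longrightarrow> P g"
    "\<And>c d. c \<in> carrier F \<Longrightarrow> d \<in> carrier F \<Longrightarrow> P c \<Longrightarrow> P d \<Longrightarrow> P (c + d)"
    "\<And>c. c \<in> carrier F \<Longrightarrow> P c \<Longrightarrow> P (- c)"
  shows "P z"
  using assms(1) unfolding Z_gens
proof induction
  case one then show ?case using assms(2) by (simp add: F_def)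
next
  case (inv h) then show ?case using assms(3,5)[of h] gens_F by (auto simp: F_def)
next
  case (eng a b)
  then show ?case using assms(4)[of a b] Z_closed(4) unfolding Z_gens by (simp add: F_def)
qed (use assms(3) in auto)

definition "scl r = frag_extend (\<lambda>(m, n). frag_of (r \<odot>\<^bsub>M\<^esub> m, n))"

lemma scl_frag: "scl r (frag_of (m, n)) = frag_of (r \<odot>\<^bsub>M\<^esub> m, n)"
  by (simp add: scl_def)

lemma scl_add: "scl r (c + d) = scl r c + scl r d" "scl r (c - d) = scl r c - scl r d"
   "scl r 0 = 0" "scl r (- c) = - scl r c"
  by (simp_all add: scl_def frag_extend_add frag_extend_diff frag_extend_minus)

lemma F_induct [consumes 1, case_names zero diff frag]:
  assumes "c \<in> carrier F" "P 0"
    "\<And>c d. c \<in> carrier F \<Longrightarrow> d \<in> carrier F \<Longrightarrow> P c \<Longrightarrow> P d \<Longrightarrow> P (c - d)"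
    "\<And>m n. m \<in> carrier M \<Longrightarrow> n \<in> carrier N \<Longrightarrow> P (frag_of (m, n))"
  shows "P c"
  using free_Abelian_group_induct[of c "carrier M \<times> carrier N" P] assms by (auto simp: F_def)

lemma scl_F: assumes "r \<in> carrier R" "c \<in> carrier F" shows "scl r c \<in> carrier F"
  using assms(2)
  by (induction rule: F_induct) (use assms(1) in \<open>auto simp: scl_add scl_frag F_closed frag_F\<close>)

lemma scl_Z: assumes "r \<in> carrier R" "z \<in> Z" shows "scl r z \<in> Z"
  using assms(2)
proof (induction rule: Z_induct)
  case (gen g)
  then have "scl r g \<in> gens"
    unfolding gens_def using assms(1)
    by (auto simp: scl_add scl_frag smult_r_distr ra_smult[symmetric]) blast+
  then show ?case unfolding Z_gens by (rule generate.incl)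
qed (auto simp: scl_add Z_closed)

text \<open>Multiplying the left factors by \<open>r\<close> maps relations to relations, so all representatives of a
  coset lead to the same coset.\<close>

lemma smult_cls: assumes "r \<in> carrier R" "c \<in> carrier F" shows "r \<odot>\<^bsub>T\<^esub> cls c = cls (scl r c)"
proof -
  have "r \<odot>\<^bsub>T\<^esub> cls c = (\<Union>c'\<in>cls c. cls (scl r c'))"
    by (simp add: T_def tensor_over_def Let_def cls_def scl_def F_def Z_def)
  moreover have "cls (scl r c') = cls (scl r c)" if c': "c' \<in> cls c" for c'
  proof -
    obtain z where z: "z \<in> Z" "c' = z + c" using c' by (auto simp: cls_elem)
    then show ?thesis
      using assms by (intro cls_eqI) (auto simp: scl_F Z_closed F_closed scl_add scl_Z)
  qed
  moreover have "c \<in> cls c" unfolding cls_elem using Z_closed(1) by force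
  ultimately show ?thesis by blast
qed

abbreviation "tns \<equiv> tens_over S ra la M N"

lemma tens_closed: "m \<in> carrier M \<Longrightarrow> n \<in> carrier N \<Longrightarrow> tns m n \<in> carrier T"
  by (simp add: tens_cls cls_F frag_F)

lemma tens_add_left:
  assumes "m \<in> carrier M" "m' \<in> carrier M" "n \<in> carrier N"
  shows "tns (m \<oplus>\<^bsub>M\<^esub> m') n = tns m n \<oplus>\<^bsub>T\<^esub> tns m' n"
proof -
  have "frag_of (m \<oplus>\<^bsub>M\<^esub> m', n) - frag_of (m, n) - frag_of (m', n) \<in> gens"
    unfolding gens_def using assms by blast
  then show ?thesis using assms unfolding tens_cls
    by (subst cls_add[symmetric]) (simp_all add: cls_gensI frag_F F_closed diff_diff_eq)
qed

lemma tens_add_right: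
  assumes "m \<in> carrier M" "n \<in> carrier N" "n' \<in> carrier N"
  shows "tns m (n \<oplus>\<^bsub>N\<^esub> n') = tns m n \<oplus>\<^bsub>T\<^esub> tns m n'"
proof -
  have "frag_of (m, n \<oplus>\<^bsub>N\<^esub> n') - frag_of (m, n) - frag_of (m, n') \<in> gens"
    unfolding gens_def using assms by blast
  then show ?thesis using assms unfolding tens_cls
    by (subst cls_add[symmetric]) (simp_all add: cls_gensI frag_F F_closed diff_diff_eq)
qed

lemma tens_balanced:
  assumes "m \<in> carrier M" "s \<in> S" "n \<in> carrier N"
  shows "tns (ra m s) n = tns m (la s n)"
proof -
  have "frag_of (ra m s, n) - frag_of (m, la s n) \<in> gens"
    unfolding gens_def using assms by blast
  then show ?thesis using assms unfolding tens_cls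
    by (simp add: cls_gensI frag_F ra_closed la_closed)
qed

lemma tens_smult_left:
  "r \<in> carrier R \<Longrightarrow> m \<in> carrier M \<Longrightarrow> n \<in> carrier N \<Longrightarrow> r \<odot>\<^bsub>T\<^esub> tns m n = tns (r \<odot>\<^bsub>M\<^esub> m) n"
  by (simp add: tens_cls smult_cls frag_F scl_frag)

lemma tens_zero_left: "n \<in> carrier N \<Longrightarrow> tns \<zero>\<^bsub>M\<^esub> n = \<zero>\<^bsub>T\<^esub>"
  by (rule additive_map_zero[OF _ T_group]) (auto simp: tens_closed tens_add_left M.abelian_group_axioms)

lemma tens_minus_left: "m \<in> carrier M \<Longrightarrow> n \<in> carrier N \<Longrightarrow> tns (\<ominus>\<^bsub>M\<^esub> m) n = \<ominus>\<^bsub>T\<^esub> tns m n"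
  by (rule additive_map_zero[where f = "\<lambda>m. tns m n", OF _ T_group])
    (auto simp: tens_closed tens_add_left M.abelian_group_axioms)

text \<open>Inverses of pure tensors are pure tensors, as a sign can be moved into the left factor; hence
  the pure tensors generate already under addition.\<close>

lemma tensor_induct [consumes 1, case_names tens add]:
  assumes "A \<in> carrier T"
    and tens: "\<And>m n. m \<in> carrier M \<Longrightarrow> n \<in> carrier N \<Longrightarrow> P (tns m n)"
    and add: "\<And>A B. A \<in> carrier T \<Longrightarrow> B \<in> carrier T \<Longrightarrow> P A \<Longrightarrow> P B \<Longrightarrow> P (A \<oplus>\<^bsub>T\<^esub> B)"
  shows "P A"
proof -
  interpret T: abelian_group T by (rule T_group)
  obtain c where c: "c \<in> carrier F" "A = cls c" using assms(1) by (rule T_cases)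
  have neg: "cls (- c) = \<ominus>\<^bsub>T\<^esub> cls c" if "c \<in> carrier F" for c
    using cls_add[of "- c" c] that
    by (intro T.minus_equality[symmetric]) (auto simp: F_closed cls_F zero_T)
  from c(1) have "P (cls c) \<and> P (cls (- c))"
  proof (induction rule: F_induct)
    case zero
    then show ?case using tens[of "\<zero>\<^bsub>M\<^esub>" "\<zero>\<^bsub>N\<^esub>"] by (simp add: tens_zero_left flip: zero_T)
  next
    case (diff c d)
    have "cls (c - d) = cls c \<oplus>\<^bsub>T\<^esub> cls (- d)" "cls (- (c - d)) = cls (- c) \<oplus>\<^bsub>T\<^esub> cls d"
      using diff(1,2) by (simp_all add: F_closed flip: cls_add)
    then show ?case using diff by (auto intro!: add cls_F F_closed)
  next
    case (frag m n)
    then show ?case using tens[of m n] tens[of "\<ominus>\<^bsub>M\<^esub> m" n]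
      by (simp add: neg tens_minus_left frag_F flip: tens_cls)
  qed
  then show ?thesis using c by simp
qed

lemma T_module: "module R T"
proof (rule moduleI)
  interpret T: abelian_group T by (rule T_group)
  show "cring R" by (rule R.cring_axioms) 
  show "abelian_group T" by (rule T_group)
  show cl: "r \<odot>\<^bsub>T\<^esub> A \<in> carrier T" if "r \<in> carrier R" "A \<in> carrier T" for r A
    using that by (elim T_cases) (simp add: smult_cls cls_F scl_F)
  show ad: "r \<odot>\<^bsub>T\<^esub> (A \<oplus>\<^bsub>T\<^esub> B) = r \<odot>\<^bsub>T\<^esub> A \<oplus>\<^bsub>T\<^esub> r \<odot>\<^bsub>T\<^esub> B"
    if "r \<in> carrier R" "A \<in> carrier T" "B \<in> carrier T" for r A B
    using that
    by (elim T_cases) (simp add: smult_cls scl_F scl_add F_closed flip: cls_add)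
  show "(r \<oplus>\<^bsub>R\<^esub> s) \<odot>\<^bsub>T\<^esub> A = r \<odot>\<^bsub>T\<^esub> A \<oplus>\<^bsub>T\<^esub> s \<odot>\<^bsub>T\<^esub> A"
    if r: "r \<in> carrier R" "s \<in> carrier R" and "A \<in> carrier T" for r s A
    using that(3)
  proof (induction rule: tensor_induct)
    case (tens m n)
    then show ?case using r by (simp add: tens_smult_left smult_l_distr tens_add_left)
  next
    case (add A B)
    then show ?case using r by (simp add: ad cl T.a_ac)
  qed
  show "(r \<otimes>\<^bsub>R\<^esub> s) \<odot>\<^bsub>T\<^esub> A = r \<odot>\<^bsub>T\<^esub> (s \<odot>\<^bsub>T\<^esub> A)"
    if r: "r \<in> carrier R" "s \<in> carrier R" and "A \<in> carrier T" for r s A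
    using that(3)
    by (induction rule: tensor_induct)
      (use r in \<open>simp_all add: tens_smult_left smult_assoc1 ad cl\<close>)
  show "\<one>\<^bsub>R\<^esub> \<odot>\<^bsub>T\<^esub> A = A" if "A \<in> carrier T" for A
    using that by (induction rule: tensor_induct) (simp_all add: tens_smult_left ad)
qed

definition balanced_map where "balanced_map P f \<longleftrightarrow>
  (\<forall>n\<in>carrier N. linear_map R M P (\<lambda>m. f m n)) \<and>
  (\<forall>m\<in>carrier M. \<forall>n\<in>carrier N. \<forall>n'\<in>carrier N. f m (n \<oplus>\<^bsub>N\<^esub> n') = f m n \<oplus>\<^bsub>P\<^esub> f m n') \<and>
  (\<forall>m\<in>carrier M. \<forall>s\<in>S. \<forall>n\<in>carrier N. f (ra m s) n = f m (la s n))"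

context
  fixes P :: "('a, 'p, 'w) module_scheme" and f
  assumes P: "module R P" and f: "balanced_map P f"
begin

interpretation P: module R P by (rule P)

abbreviation "ev \<equiv> formal_sum_value P f"

lemmas ev_def = formal_sum_value_def[of P f]

lemma f_closed: "p \<in> carrier M \<times> carrier N \<Longrightarrow> case_prod f p \<in> carrier P"
  using f by (auto simp: balanced_map_def linear_map_def)

text \<open>With a common finite index set the formal sums can be added termwise.\<close>

lemma ev_superset:
  assumes "finite B" "Poly_Mapping.keys c \<subseteq> B" "B \<subseteq> carrier M \<times> carrier N"
  shows "ev c = (\<Oplus>\<^bsub>P\<^esub> p \<in> B. [Poly_Mapping.lookup c p] \<cdot>\<^bsub>P\<^esub> case_prod f p)"
  unfolding ev_def
proof (rule P.add.finprod_mono_neutral_cong_left)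
  show "[Poly_Mapping.lookup c p] \<cdot>\<^bsub>P\<^esub> case_prod f p = \<zero>\<^bsub>P\<^esub>" if "p \<in> B - Poly_Mapping.keys c" for p
    using that by (simp add: in_keys_iff add_pow_def)
  show "(\<lambda>p. [Poly_Mapping.lookup c p] \<cdot>\<^bsub>P\<^esub> case_prod f p) \<in> B \<rightarrow> carrier P"
    using assms(3) f_closed by blast
qed (use assms in auto)

lemma ev_closed: assumes "c \<in> carrier F" shows "ev c \<in> carrier P"
  unfolding ev_def
proof (rule P.finsum_closed, rule Pi_I, rule P.add.int_pow_closed, rule f_closed)
  show "p \<in> carrier M \<times> carrier N" if "p \<in> Poly_Mapping.keys c" for p
    using that assms unfolding F_def carrier_free_Abelian_group_iff by (rule rev_subsetD)
qed

lemma ev_add: assumes "c \<in> carrier F" "d \<in> carrier F" shows "ev (c + d) = ev c \<oplus>\<^bsub>P\<^esub> ev d"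
proof -
  let ?B = "Poly_Mapping.keys c \<union> Poly_Mapping.keys d"
  have B: "finite ?B" "?B \<subseteq> carrier M \<times> carrier N" "Poly_Mapping.keys (c + d) \<subseteq> ?B"
    using assms keys_add[of c d] by (auto simp: F_def)
  have "ev (c + d) = (\<Oplus>\<^bsub>P\<^esub> p \<in> ?B. [Poly_Mapping.lookup c p] \<cdot>\<^bsub>P\<^esub> case_prod f p
      \<oplus>\<^bsub>P\<^esub> [Poly_Mapping.lookup d p] \<cdot>\<^bsub>P\<^esub> case_prod f p)"
    unfolding ev_superset[OF B(1,3,2)] using B(2) f_closed
    by (intro P.finsum_cong') (auto simp: lookup_add P.add.int_pow_mult simp del: case_prod_beta' split_paired_All)
  also have "\<dots> = ev c \<oplus>\<^bsub>P\<^esub> ev d"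
    using B f_closed ev_superset[OF B(1) _ B(2)]
    by (subst P.finsum_addf) auto
  finally show ?thesis .
qed

lemma ev_frag: "m \<in> carrier M \<Longrightarrow> n \<in> carrier N \<Longrightarrow> ev (frag_of (m, n)) = f m n"
  using f_closed[of "(m, n)"] unfolding ev_def by (simp add: P.add.int_pow_1)

lemma ev_zero: "ev 0 = \<zero>\<^bsub>P\<^esub>"
  unfolding ev_def by simp

lemma ev_minus: assumes "c \<in> carrier F" shows "ev (- c) = \<ominus>\<^bsub>P\<^esub> ev c"
  using ev_add[of "- c" c] assms
  by (intro P.minus_equality[symmetric]) (auto simp: F_closed ev_closed ev_zero)

lemma ev_diff: assumes "c \<in> carrier F" "d \<in> carrier F" shows "ev (c - d) = ev c \<ominus>\<^bsub>P\<^esub> ev d"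
  using ev_add[of c "- d"] assms by (simp add: F_closed ev_minus a_minus_def)

lemma ev_Z: assumes "z \<in> Z" shows "ev z = \<zero>\<^bsub>P\<^esub>"
  using assms
proof (induction rule: Z_induct)
  case zero show ?case by (rule ev_zero)
next
  case (gen g)
  have *: "a \<oplus>\<^bsub>P\<^esub> b \<ominus>\<^bsub>P\<^esub> a \<ominus>\<^bsub>P\<^esub> b = \<zero>\<^bsub>P\<^esub>" if "a \<in> carrier P" "b \<in> carrier P" for a b
  proof -
    have "a \<oplus>\<^bsub>P\<^esub> b \<ominus>\<^bsub>P\<^esub> a \<ominus>\<^bsub>P\<^esub> b = (a \<oplus>\<^bsub>P\<^esub> \<ominus>\<^bsub>P\<^esub> a) \<oplus>\<^bsub>P\<^esub> (b \<oplus>\<^bsub>P\<^esub> \<ominus>\<^bsub>P\<^esub> b)"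
      using that by (simp add: a_minus_def P.a_ac)
    then show ?thesis using that by (simp add: P.r_neg)
  qed
  have c: "f m n \<in> carrier P" if "m \<in> carrier M" "n \<in> carrier N" for m n
    using f_closed[of "(m, n)"] that by simp
  have bal: "\<And>m m' n. m \<in> carrier M \<Longrightarrow> m' \<in> carrier M \<Longrightarrow> n \<in> carrier N \<Longrightarrow>
      f (m \<oplus>\<^bsub>M\<^esub> m') n = f m n \<oplus>\<^bsub>P\<^esub> f m' n"
    "\<And>m n n'. m \<in> carrier M \<Longrightarrow> n \<in> carrier N \<Longrightarrow> n' \<in> carrier N \<Longrightarrow>
      f m (n \<oplus>\<^bsub>N\<^esub> n') = f m n \<oplus>\<^bsub>P\<^esub> f m n'"
    "\<And>m s n. m \<in> carrier M \<Longrightarrow> s \<in> S \<Longrightarrow> n \<in> carrier N \<Longrightarrow> f (ra m s) n = f m (la s n)"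
    using f by (auto simp: balanced_map_def linear_map_def)
  have d: "a \<ominus>\<^bsub>P\<^esub> a = \<zero>\<^bsub>P\<^esub>" if "a \<in> carrier P" for a
    using that by (simp add: a_minus_def P.r_neg)
  from gen show ?case
    unfolding gens_def
    by (elim UnE CollectE exE conjE)
      (simp_all add: ev_diff frag_F F_closed ev_frag bal c * d ra_closed la_closed)
next
  case (add c d)
  then show ?case by (simp add: ev_add)
next
  case (minus c)
  then show ?case by (simp add: ev_minus)
qed

text \<open>\<open>ev\<close> is additive and kills the relations, so it is constant on the coset.\<close>

lemma lift_cls: assumes "c \<in> carrier F" shows "tensor_lift P f (cls c) = ev c"
proof -
  have "ev ` cls c = {ev c}"
  proof -
    have "ev c' = ev c" if c': "c' \<in> cls c" for c'
    proof -
      obtain z where z: "z \<in> Z" "c' = z + c" using c' by (auto simp: cls_elem)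
      show ?thesis
        unfolding z(2) ev_add[OF Z_closed(4)[OF z(1)] assms] ev_Z[OF z(1)]
        using ev_closed[OF assms] by (rule P.l_zero)
    qed
    moreover have "c \<in> cls c"
      unfolding cls_elem by (rule bexI[OF _ Z_closed(1)]) simp
    ultimately show ?thesis by blast
  qed
  moreover have "ev = (\<lambda>c. \<Oplus>\<^bsub>P\<^esub> p \<in> Poly_Mapping.keys c.
      [Poly_Mapping.lookup c p] \<cdot>\<^bsub>P\<^esub> case_prod f p)"
    by (rule ext) (rule ev_def)
  then have "tensor_lift P f (cls c) = the_elem (ev ` cls c)"
    unfolding tensor_lift_def by (rule ssubst) (rule refl)
  ultimately show ?thesis by simp
qed

lemma lift_tens: "m \<in> carrier M \<Longrightarrow> n \<in> carrier N \<Longrightarrow> tensor_lift P f (tns m n) = f m n"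
  by (simp add: tens_cls lift_cls frag_F ev_frag)

lemma lift_linear: "linear_map R T P (tensor_lift P f)"
proof (rule linear_mapI)
  show cl: "tensor_lift P f A \<in> carrier P" if "A \<in> carrier T" for A
    using that by (elim T_cases) (simp add: lift_cls ev_closed)
  show ad: "tensor_lift P f (A \<oplus>\<^bsub>T\<^esub> B) = tensor_lift P f A \<oplus>\<^bsub>P\<^esub> tensor_lift P f B"
    if "A \<in> carrier T" "B \<in> carrier T" for A B
    using that by (elim T_cases) (simp add: lift_cls ev_add F_closed flip: cls_add)
  interpret T: module R T by (rule T_module)
  show "tensor_lift P f (r \<odot>\<^bsub>T\<^esub> A) = r \<odot>\<^bsub>P\<^esub> tensor_lift P f A"
    if r: "r \<in> carrier R" and "A \<in> carrier T" for r A
    using that(2)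
  proof (induction rule: tensor_induct)
    case (tens m n)
    then have "f (r \<odot>\<^bsub>M\<^esub> m) n = r \<odot>\<^bsub>P\<^esub> f m n"
      using f r by (auto simp: balanced_map_def linear_map_def)
    then show ?case using tens r by (simp add: tens_smult_left lift_tens)
  next
    case (add A B)
    then show ?case using r by (simp add: T.smult_r_distr ad cl P.smult_r_distr)
  qed
qed

end

lemma linear_map_ext:
  assumes "linear_map R T P g" "linear_map R T P g'"
    and "\<And>m n. m \<in> carrier M \<Longrightarrow> n \<in> carrier N \<Longrightarrow> g (tns m n) = g' (tns m n)"
    and "A \<in> carrier T"
  shows "g A = g' A"
  using assms(4)
  by (induction rule: tensor_induct)
    (use assms(3) in \<open>auto simp: linear_map_add[OF assms(1)] linear_map_add[OF assms(2)]\<close>)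

end


section \<open>Tensor products over the base ring\<close>

lemma balanced_pair_base:
  assumes "module R M" "module R N"
  shows "balanced_pair R M N (carrier R) (\<lambda>m r. r \<odot>\<^bsub>M\<^esub> m) (module.smult N)"
proof -
  interpret M: module R M by fact
  interpret N: module R N by fact
  show ?thesis
  proof
    show "s \<odot>\<^bsub>M\<^esub> (r \<odot>\<^bsub>M\<^esub> m) = r \<odot>\<^bsub>M\<^esub> (s \<odot>\<^bsub>M\<^esub> m)"
      if "r \<in> carrier R" "m \<in> carrier M" "s \<in> carrier R" for r m s
      using that by (metis M.smult_assoc1 M.R.m_comm)
  qed auto
qed

lemma balanced_map_base:
  assumes "module R M" "module R N" "bilinear_map R M N P f"
  shows "balanced_pair.balanced_map R M N (carrier R) (\<lambda>m r. r \<odot>\<^bsub>M\<^esub> m) (module.smult N) P f"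
  using assms(3)
  unfolding balanced_pair.balanced_map_def[OF balanced_pair_base[OF assms(1,2)]]
  by (auto simp: bilinear_map_def linear_map_def)

lemma tensor_module:
  assumes "module R M" "module R N"
  shows "module R (tensor R M N)"
  using balanced_pair.T_module[OF balanced_pair_base[OF assms]]
  by (simp only: balanced_pair.T_def[OF balanced_pair_base[OF assms]])

lemma tens_bilinear:
  assumes "module R M" "module R N"
  shows "bilinear_map R M N (tensor R M N) (tens R M N)"
proof -
  interpret B: balanced_pair R M N "carrier R" "\<lambda>m r. r \<odot>\<^bsub>M\<^esub> m" "module.smult N"
    by (rule balanced_pair_base[OF assms])
  note T = B.T_def[symmetric]
  show ?thesis unfolding T
  proof (rule bilinear_mapI; rule linear_mapI)
    show "r \<in> carrier R \<Longrightarrow> n \<in> carrier N \<Longrightarrow> m \<in> carrier M \<Longrightarrow>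
        tens R M N m (r \<odot>\<^bsub>N\<^esub> n) = r \<odot>\<^bsub>B.T\<^esub> tens R M N m n" for r m n
      by (simp add: B.tens_smult_left flip: B.tens_balanced)
  qed (auto simp: B.tens_closed B.tens_add_left B.tens_add_right B.tens_smult_left)
qed

lemma tens_closed:
  "module R M \<Longrightarrow> module R N \<Longrightarrow> m \<in> carrier M \<Longrightarrow> n \<in> carrier N \<Longrightarrow>
    tens R M N m n \<in> carrier (tensor R M N)"
  by (rule bilinear_map_closed[OF tens_bilinear])

lemma lift_linear:
  assumes "module R M" "module R N" "module R P" "bilinear_map R M N P f"
  shows "linear_map R (tensor R M N) P (tensor_lift P f)"
  using balanced_pair.lift_linear[OF balanced_pair_base[OF assms(1,2)] assms(3)
      balanced_map_base[OF assms(1,2,4)]]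
  by (simp only: balanced_pair.T_def[OF balanced_pair_base[OF assms(1,2)]])

lemma lift_closed:
  "module R M \<Longrightarrow> module R N \<Longrightarrow> module R P \<Longrightarrow> bilinear_map R M N P f \<Longrightarrow>
    A \<in> carrier (tensor R M N) \<Longrightarrow> tensor_lift P f A \<in> carrier P"
  by (rule linear_map_closed[OF lift_linear])

lemma lift_tens:
  assumes "module R M" "module R N" "module R P" "bilinear_map R M N P f"
    "m \<in> carrier M" "n \<in> carrier N"
  shows "tensor_lift P f (tens R M N m n) = f m n"
  by (rule balanced_pair.lift_tens[OF balanced_pair_base[OF assms(1,2)] assms(3)
      balanced_map_base[OF assms(1,2,4)] assms(5,6)])

lemma tensor_induct [consumes 3, case_names tens add]:
  assumes M: "module R M" "module R N"
    and "A \<in> carrier (tensor R M N)"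
    and "\<And>m n. m \<in> carrier M \<Longrightarrow> n \<in> carrier N \<Longrightarrow> P (tens R M N m n)"
    and "\<And>A B. A \<in> carrier (tensor R M N) \<Longrightarrow> B \<in> carrier (tensor R M N) \<Longrightarrow> P A \<Longrightarrow> P B \<Longrightarrow>
      P (A \<oplus>\<^bsub>tensor R M N\<^esub> B)"
  shows "P A"
  by (rule balanced_pair.tensor_induct[OF balanced_pair_base[OF M],
        unfolded balanced_pair.T_def[OF balanced_pair_base[OF M]]])
    (rule assms(3), erule (1) assms(4), erule (3) assms(5))

lemma tensor_ext:
  assumes "module R M" "module R N"
    and "linear_map R (tensor R M N) P g" "linear_map R (tensor R M N) P g'"
    and "\<And>m n. m \<in> carrier M \<Longrightarrow> n \<in> carrier N \<Longrightarrow> g (tens R M N m n) = g' (tens R M N m n)"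
    and "A \<in> carrier (tensor R M N)"
  shows "g A = g' A"
  using assms(1,2,6)
  by (induction rule: tensor_induct)
    (use assms(5) in \<open>auto simp: linear_map_add[OF assms(3)] linear_map_add[OF assms(4)]\<close>)

lemma bilinear_map_cong:
  assumes "module R M" "module R N" "bilinear_map R M N P f"
    and "\<And>a b. a \<in> carrier M \<Longrightarrow> b \<in> carrier N \<Longrightarrow> f a b = g a b"
  shows "bilinear_map R M N P g"
proof (rule bilinear_mapI)
  show "linear_map R M P (\<lambda>m. g m n)" if "n \<in> carrier N" for n
    by (rule linear_map_cong[OF assms(1) bilinear_map_left[OF assms(3) that]]) (rule assms(4)[OF _ that])
  show "linear_map R N P (\<lambda>n. g m n)" if "m \<in> carrier M" for m
    by (rule linear_map_cong[OF assms(2) bilinear_map_right[OF assms(3) that]]) (rule assms(4)[OF that])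
qed

lemma lift_cong:
  assumes "module R M" "module R N" "module R P" "bilinear_map R M N P f"
    and "A \<in> carrier (tensor R M N)"
    and "\<And>a b. a \<in> carrier M \<Longrightarrow> b \<in> carrier N \<Longrightarrow> f a b = g a b"
  shows "tensor_lift P f A = tensor_lift P g A"
proof (rule tensor_ext[OF assms(1,2) _ _ _ assms(5)])
  have g: "bilinear_map R M N P g" by (rule bilinear_map_cong[OF assms(1,2,4,6)])
  show "linear_map R (tensor R M N) P (tensor_lift P f)" "linear_map R (tensor R M N) P (tensor_lift P g)"
    by (rule lift_linear[OF assms(1-4)], rule lift_linear[OF assms(1-3) g])
  show "tensor_lift P f (tens R M N m n) = tensor_lift P g (tens R M N m n)"
    if "m \<in> carrier M" "n \<in> carrier N" for m n
    using assms(6) that lift_tens[OF assms(1-4)] lift_tens[OF assms(1-3) g] by simp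
qed

lemma bilinear_map_comp:
  "linear_map R P P' g \<Longrightarrow> bilinear_map R M N P f \<Longrightarrow> bilinear_map R M N P' (\<lambda>a b. g (f a b))"
  by (rule bilinear_mapI) (auto intro: linear_map_comp bilinear_map_left bilinear_map_right)

lemma linear_lift:
  assumes "module R M" "module R N" "module R P" "module R P'"
    and "linear_map R P P' g" "bilinear_map R M N P f" "A \<in> carrier (tensor R M N)"
  shows "g (tensor_lift P f A) = tensor_lift P' (\<lambda>a b. g (f a b)) A"
proof (rule tensor_ext[OF assms(1,2) _ _ _ assms(7)])
  note gf = bilinear_map_comp[OF assms(5,6)]
  show "linear_map R (tensor R M N) P' (\<lambda>A. g (tensor_lift P f A))"
    by (rule linear_map_comp[OF assms(5) lift_linear[OF assms(1,2,3,6)]])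
  show "linear_map R (tensor R M N) P' (tensor_lift P' (\<lambda>a b. g (f a b)))"
    by (rule lift_linear[OF assms(1,2,4) gf])
  show "g (tensor_lift P f (tens R M N m n)) = tensor_lift P' (\<lambda>a b. g (f a b)) (tens R M N m n)"
    if "m \<in> carrier M" "n \<in> carrier N" for m n
    using that by (simp add: lift_tens[OF assms(1,2,3,6)] lift_tens[OF assms(1,2,4) gf])
qed

text \<open>With this rule Sweedler sums can be nested, as inner sums stay linear in the outer components.\<close>

lemma lift_param_linear:
  assumes "module R L" "module R M" "module R N" "module R P"
    and "A \<in> carrier (tensor R M N)"
    and "\<And>x. x \<in> carrier L \<Longrightarrow> bilinear_map R M N P (\<lambda>a b. f x a b)"
    and "\<And>a b. a \<in> carrier M \<Longrightarrow> b \<in> carrier N \<Longrightarrow> linear_map R L P (\<lambda>x. f x a b)"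
  shows "linear_map R L P (\<lambda>x. tensor_lift P (\<lambda>a b. f x a b) A)"
proof -
  interpret L: module R L by fact
  interpret P: module R P by fact
  note lt = lift_tens[OF assms(2-4,6)] and ll = lift_linear[OF assms(2-4,6)]
  note la = linear_map_add[OF ll] and lc = linear_map_closed[OF ll]
  note fl = linear_map_closed[OF assms(7)]
  show ?thesis
  proof (rule linear_mapI)
    show "tensor_lift P (f x) A \<in> carrier P" if "x \<in> carrier L" for x
      by (rule lc[OF that assms(5)])
    show "tensor_lift P (f (x \<oplus>\<^bsub>L\<^esub> y)) A = tensor_lift P (f x) A \<oplus>\<^bsub>P\<^esub> tensor_lift P (f y) A"
      if x: "x \<in> carrier L" "y \<in> carrier L" for x y
      using assms(2,3,5)
    proof (induction rule: tensor_induct)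
      case (tens m n)
      then show ?case using x by (simp add: lt linear_map_add[OF assms(7)])
    next
      case (add A B)
      then show ?case using x by (simp add: la lc P.a_ac)
    qed
    show "tensor_lift P (f (r \<odot>\<^bsub>L\<^esub> x)) A = r \<odot>\<^bsub>P\<^esub> tensor_lift P (f x) A"
      if x: "r \<in> carrier R" "x \<in> carrier L" for r x
      using assms(2,3,5)
    proof (induction rule: tensor_induct)
      case (tens m n)
      then show ?case using x by (simp add: lt linear_map_smult[OF assms(7)])
    next
      case (add A B)
      then show ?case using x by (simp add: la lc P.smult_r_distr)
    qed
  qed
qed

lemma lift_swap:
  assumes M: "module R M" "module R N" and M': "module R M'" "module R N'" and P: "module R P"
    and A: "A \<in> carrier (tensor R M N)" and B: "B \<in> carrier (tensor R M' N')"
    and f: "\<And>c d. c \<in> carrier M' \<Longrightarrow> d \<in> carrier N' \<Longrightarrow> bilinear_map R M N P (\<lambda>a b. f a b c d)"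
      "\<And>a b. a \<in> carrier M \<Longrightarrow> b \<in> carrier N \<Longrightarrow> bilinear_map R M' N' P (\<lambda>c d. f a b c d)"
  shows "tensor_lift P (\<lambda>a b. tensor_lift P (\<lambda>c d. f a b c d) B) A =
    tensor_lift P (\<lambda>c d. tensor_lift P (\<lambda>a b. f a b c d) A) B"
proof (rule tensor_ext[OF M _ _ _ A])
  have G: "bilinear_map R M N P (\<lambda>a b. tensor_lift P (\<lambda>c d. f a b c d) B)"
  proof (rule bilinear_mapI)
    show "linear_map R M P (\<lambda>a. tensor_lift P (\<lambda>c d. f a b c d) B)" if "b \<in> carrier N" for b
      by (rule lift_param_linear[OF M(1) M' P B])
        (use that f bilinear_map_left[OF f(1)] in auto)
    show "linear_map R N P (\<lambda>b. tensor_lift P (\<lambda>c d. f a b c d) B)" if "a \<in> carrier M" for a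
      by (rule lift_param_linear[OF M(2) M' P B])
        (use that f bilinear_map_right[OF f(1)] in auto)
  qed
  show "linear_map R (tensor R M N) P
      (tensor_lift P (\<lambda>a b. tensor_lift P (\<lambda>c d. f a b c d) B))"
    by (rule lift_linear[OF M P G])
  have lin: "linear_map R (tensor R M N) P (\<lambda>A. tensor_lift P (\<lambda>a b. f a b c d) A)"
    if "c \<in> carrier M'" "d \<in> carrier N'" for c d
    by (rule lift_linear[OF M P f(1)[OF that]])
  show "linear_map R (tensor R M N) P (\<lambda>A. tensor_lift P (\<lambda>c d. tensor_lift P (\<lambda>a b. f a b c d) A) B)"
  proof (rule lift_param_linear[OF tensor_module[OF M] M' P B])
    fix A assume A: "A \<in> carrier (tensor R M N)"
    show "bilinear_map R M' N' P (\<lambda>c d. tensor_lift P (\<lambda>a b. f a b c d) A)"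
    proof (rule bilinear_mapI)
      show "linear_map R M' P (\<lambda>c. tensor_lift P (\<lambda>a b. f a b c d) A)" if "d \<in> carrier N'" for d
        by (rule lift_param_linear[OF M'(1) M P A])
          (use that f bilinear_map_left[OF f(2)] in auto)
      show "linear_map R N' P (\<lambda>d. tensor_lift P (\<lambda>a b. f a b c d) A)" if "c \<in> carrier M'" for c
        by (rule lift_param_linear[OF M'(2) M P A])
          (use that f bilinear_map_right[OF f(2)] in auto)
    qed
  qed (rule lin)
  fix m n assume mn: "m \<in> carrier M" "n \<in> carrier N"
  show "tensor_lift P (\<lambda>a b. tensor_lift P (\<lambda>c d. f a b c d) B) (tens R M N m n) =
      tensor_lift P (\<lambda>c d. tensor_lift P (\<lambda>a b. f a b c d) (tens R M N m n)) B"
    unfolding lift_tens[OF M P G mn]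
    by (rule lift_cong[OF M' P f(2)[OF mn] B]) (simp add: lift_tens[OF M P f(1)] mn)
qed

text \<open>\<open>id \<otimes> g\<close>\<close>

abbreviation tensor_id_map ::
  "('r, 'x) ring_scheme \<Rightarrow> ('r, 'm, 'y) module_scheme \<Rightarrow> ('r, 'n, 'z) module_scheme \<Rightarrow>
    ('k \<Rightarrow> 'n) \<Rightarrow> ('m, 'k) tens \<Rightarrow> ('m, 'n) tens"
  where "tensor_id_map R M N g \<equiv> tensor_lift (tensor R M N) (\<lambda>m n. tens R M N m (g n))"

lemma linear_tens_left:
  "module R M \<Longrightarrow> module R N \<Longrightarrow> n \<in> carrier N \<Longrightarrow> linear_map R L M g \<Longrightarrow>
    linear_map R L (tensor R M N) (\<lambda>x. tens R M N (g x) n)"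
  by (rule linear_map_comp[OF bilinear_map_left[OF tens_bilinear]])

lemma linear_tens_right:
  "module R M \<Longrightarrow> module R N \<Longrightarrow> m \<in> carrier M \<Longrightarrow> linear_map R L N g \<Longrightarrow>
    linear_map R L (tensor R M N) (\<lambda>x. tens R M N m (g x))"
  by (rule linear_map_comp[OF bilinear_map_right[OF tens_bilinear]])

lemma bilinear_tens_map:
  assumes "module R M" "module R N" "linear_map R M' M f" "linear_map R N' N g"
  shows "bilinear_map R M' N' (tensor R M N) (\<lambda>a b. tens R M N (f a) (g b))"
  by (rule bilinear_mapI)
    (auto intro!: linear_tens_left linear_tens_right assms linear_map_closed[OF assms(3)]
      linear_map_closed[OF assms(4)])

lemma tensor_id_map_linear:
  "module R M \<Longrightarrow> module R N' \<Longrightarrow> module R N \<Longrightarrow> linear_map R N' N g \<Longrightarrow>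
    linear_map R (tensor R M N') (tensor R M N) (tensor_id_map R M N g)"
  by (intro lift_linear tensor_module bilinear_tens_map linear_map_id)

lemma tensor_id_map_tens:
  "module R M \<Longrightarrow> module R N' \<Longrightarrow> module R N \<Longrightarrow> linear_map R N' N g \<Longrightarrow> m \<in> carrier M \<Longrightarrow> n \<in> carrier N' \<Longrightarrow>
    tensor_id_map R M N g (tens R M N' m n) = tens R M N m (g n)"
  by (intro lift_tens tensor_module bilinear_tens_map linear_map_id)

lemma tensor_id_map_comp:
  assumes "module R M" "module R N1" "module R N2" "module R N3"
    and "linear_map R N1 N2 f" "linear_map R N2 N3 g" "linear_map R N1 N3 h"
    and "\<And>x. x \<in> carrier N1 \<Longrightarrow> g (f x) = h x" and "A \<in> carrier (tensor R M N1)"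
  shows "tensor_id_map R M N3 g (tensor_id_map R M N2 f A) = tensor_id_map R M N3 h A"
proof (rule tensor_ext[OF assms(1,2) _ _ _ assms(9)])
  show "linear_map R (tensor R M N1) (tensor R M N3) (\<lambda>A. tensor_id_map R M N3 g (tensor_id_map R M N2 f A))"
    "linear_map R (tensor R M N1) (tensor R M N3) (tensor_id_map R M N3 h)"
    by (intro linear_map_comp[OF tensor_id_map_linear tensor_id_map_linear] tensor_id_map_linear assms)+
  fix m n assume "m \<in> carrier M" "n \<in> carrier N1"
  then show "tensor_id_map R M N3 g (tensor_id_map R M N2 f (tens R M N1 m n)) =
      tensor_id_map R M N3 h (tens R M N1 m n)"
    using assms linear_map_closed[OF assms(5)] by (simp add: tensor_id_map_tens)
qed

lemma tensor_id_map_id: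
  assumes "module R M" "module R N" "A \<in> carrier (tensor R M N)"
  shows "tensor_id_map R M N (\<lambda>x. x) A = A"
  by (rule tensor_ext[OF assms(1,2) _ _ _ assms(3), of "tensor R M N"])
    (simp_all add: tensor_id_map_linear assms linear_map_id tensor_id_map_tens)

definition tensor_flip ::
  "('r, 'x) ring_scheme \<Rightarrow> ('r, 'm, 'y) module_scheme \<Rightarrow> ('r, 'n, 'z) module_scheme \<Rightarrow>
    ('m, 'n) tens \<Rightarrow> ('n, 'm) tens"
  where "tensor_flip R M N = tensor_lift (tensor R N M) (\<lambda>m n. tens R N M n m)"

lemma bilinear_tens_flip:
  assumes "module R M" "module R N"
  shows "bilinear_map R M N (tensor R N M) (\<lambda>m n. tens R N M n m)"
  by (rule bilinear_mapI) (intro linear_tens_left linear_tens_right assms linear_map_id; assumption)+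

lemma tensor_flip_linear:
  assumes "module R M" "module R N"
  shows "linear_map R (tensor R M N) (tensor R N M) (tensor_flip R M N)"
  unfolding tensor_flip_def
  by (rule lift_linear[OF assms tensor_module[OF assms(2,1)] bilinear_tens_flip[OF assms]])

lemma tensor_flip_tens:
  assumes "module R M" "module R N" "m \<in> carrier M" "n \<in> carrier N"
  shows "tensor_flip R M N (tens R M N m n) = tens R N M n m"
  unfolding tensor_flip_def
  by (rule lift_tens[OF assms(1,2) tensor_module[OF assms(2,1)] bilinear_tens_flip[OF assms(1,2)] assms(3,4)])

lemma tensor_flip_flip:
  assumes "module R M" "module R N" "A \<in> carrier (tensor R M N)"
  shows "tensor_flip R N M (tensor_flip R M N A) = A"
  by (rule tensor_ext[OF assms(1,2) _ _ _ assms(3), of "tensor R M N"])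
    (simp_all add: linear_map_comp[OF tensor_flip_linear tensor_flip_linear] linear_map_id assms
      tensor_flip_tens)


text \<open>Maps on a triple tensor product, bracketed to the right.\<close>

definition trilinear_map where
  "trilinear_map R L M N P f \<longleftrightarrow>
    (\<forall>y\<in>carrier M. \<forall>z\<in>carrier N. linear_map R L P (\<lambda>x. f x y z)) \<and>
    (\<forall>x\<in>carrier L. bilinear_map R M N P (\<lambda>y z. f x y z))"

lemma trilinear_mapI:
  assumes "\<And>y z. y \<in> carrier M \<Longrightarrow> z \<in> carrier N \<Longrightarrow> linear_map R L P (\<lambda>x. f x y z)"
    and "\<And>x z. x \<in> carrier L \<Longrightarrow> z \<in> carrier N \<Longrightarrow> linear_map R M P (\<lambda>y. f x y z)"
    and "\<And>x y. x \<in> carrier L \<Longrightarrow> y \<in> carrier M \<Longrightarrow> linear_map R N P (\<lambda>z. f x y z)"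
  shows "trilinear_map R L M N P f"
  using assms by (auto simp: trilinear_map_def bilinear_map_def)

definition tensor_lift3 ::
  "('p, 'w) ring_scheme \<Rightarrow> ('l \<Rightarrow> 'm \<Rightarrow> 'n \<Rightarrow> 'p) \<Rightarrow> ('l, ('m, 'n) tens) tens \<Rightarrow> 'p"
  where "tensor_lift3 P f = tensor_lift P (\<lambda>x B. tensor_lift P (\<lambda>y z. f x y z) B)"

context
  fixes R :: "('r, 'x) ring_scheme" and L :: "('r, 'l, 'u) module_scheme"
    and M :: "('r, 'm, 'y) module_scheme" and N :: "('r, 'n, 'z) module_scheme"
    and P :: "('r, 'p, 'w) module_scheme"
  assumes L: "module R L" and M: "module R M" and N: "module R N" and P: "module R P"
begin

lemma bilinear_of_trilinear:
  assumes "trilinear_map R L M N P f"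
  shows "bilinear_map R L (tensor R M N) P (\<lambda>x B. tensor_lift P (\<lambda>y z. f x y z) B)"
proof (rule bilinear_mapI)
  show "linear_map R L P (\<lambda>x. tensor_lift P (\<lambda>y z. f x y z) B)" if "B \<in> carrier (tensor R M N)" for B
    using assms by (intro lift_param_linear[OF L M N P that]) (auto simp: trilinear_map_def)
  show "linear_map R (tensor R M N) P (\<lambda>B. tensor_lift P (\<lambda>y z. f x y z) B)" if "x \<in> carrier L" for x
    using assms that by (intro lift_linear[OF M N P]) (auto simp: trilinear_map_def)
qed

lemma tensor_lift3_linear:
  "trilinear_map R L M N P f \<Longrightarrow> linear_map R (tensor R L (tensor R M N)) P (tensor_lift3 P f)"
  unfolding tensor_lift3_def
  by (rule lift_linear[OF L tensor_module[OF M N] P bilinear_of_trilinear])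

lemma tensor_lift3_tens:
  assumes "trilinear_map R L M N P f" "x \<in> carrier L"
  shows "B \<in> carrier (tensor R M N) \<Longrightarrow>
      tensor_lift3 P f (tens R L (tensor R M N) x B) = tensor_lift P (\<lambda>y z. f x y z) B"
    and "y \<in> carrier M \<Longrightarrow> z \<in> carrier N \<Longrightarrow>
      tensor_lift3 P f (tens R L (tensor R M N) x (tens R M N y z)) = f x y z"
proof -
  show *: "tensor_lift3 P f (tens R L (tensor R M N) x B) = tensor_lift P (\<lambda>y z. f x y z) B"
    if "B \<in> carrier (tensor R M N)" for B
    unfolding tensor_lift3_def
    by (rule lift_tens[OF L tensor_module[OF M N] P bilinear_of_trilinear[OF assms(1)] assms(2) that])
  show "tensor_lift3 P f (tens R L (tensor R M N) x (tens R M N y z)) = f x y z"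
    if "y \<in> carrier M" "z \<in> carrier N"
    using lift_tens[OF M N P, of "f x" y z] assms that
    by (simp add: * tens_closed[OF M N] trilinear_map_def)
qed

lemma tensor3_ext:
  assumes g: "linear_map R (tensor R L (tensor R M N)) P g" "linear_map R (tensor R L (tensor R M N)) P g'"
    and eq: "\<And>x y z. x \<in> carrier L \<Longrightarrow> y \<in> carrier M \<Longrightarrow> z \<in> carrier N \<Longrightarrow>
      g (tens R L (tensor R M N) x (tens R M N y z)) = g' (tens R L (tensor R M N) x (tens R M N y z))"
    and A: "A \<in> carrier (tensor R L (tensor R M N))"
  shows "g A = g' A"
proof (rule tensor_ext[OF L tensor_module[OF M N] g _ A])
  fix x B assume x: "x \<in> carrier L" and B: "B \<in> carrier (tensor R M N)"
  have l: "linear_map R (tensor R M N) (tensor R L (tensor R M N)) (\<lambda>B. tens R L (tensor R M N) x B)"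
    by (rule linear_tens_right[OF L tensor_module[OF M N] x linear_map_id])
  show "g (tens R L (tensor R M N) x B) = g' (tens R L (tensor R M N) x B)"
    by (rule tensor_ext[OF M N linear_map_comp[OF g(1) l] linear_map_comp[OF g(2) l] eq[OF x] B])
qed

end


section \<open>Quotient modules\<close>

lemma (in abelian_group) diff_eq_zero_iff:
  assumes "a \<in> carrier G" "b \<in> carrier G" shows "a \<ominus> b = \<zero> \<longleftrightarrow> a = b"
proof
  assume "a \<ominus> b = \<zero>"
  then have "a \<ominus> b \<oplus> b = b" using assms by simp
  then show "a = b" using assms by (simp add: a_minus_def a_assoc l_neg)
qed (use assms in \<open>simp add: a_minus_def r_neg\<close>)

lemma (in abelian_group) diff_zero: "a \<in> carrier G \<Longrightarrow> a \<ominus> \<zero> = a"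
  using minus_equality[of "\<zero>" "\<zero>"] by (simp add: a_minus_def)

lemma (in module) image_submodule:
  assumes "module R N" "linear_map R M N f"
  shows "submodule (f ` carrier M) R N"
proof -
  interpret N: module R N by fact
  note f = linear_map_closed[OF assms(2)] linear_map_zero[OF module_axioms assms]
    linear_map_minus[OF module_axioms assms] linear_map_add[OF assms(2)] linear_map_smult[OF assms(2)]
  show ?thesis
  proof (rule N.submoduleI)
    show "\<zero>\<^bsub>N\<^esub> \<in> f ` carrier M" using f(2) by (metis M.zero_closed image_eqI)
  qed (use f(1) in \<open>auto simp flip: f(3-5)\<close>)
qed

locale quotient_module = module R M for R (structure) and M (structure) +
  fixes I
  assumes submod: "submodule I R M"
begin

abbreviation "Q \<equiv> quot_module M I"
abbreviation "\<pi> x \<equiv> I +>\<^bsub>M\<^esub> x"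

lemma I_carrier: "I \<subseteq> carrier M" and I_zero: "\<zero>\<^bsub>M\<^esub> \<in> I"
  using submoduleE[OF submod] submodule.axioms(1)[OF submod] subgroup.one_closed by force+

lemma abelian_subgroup_I: "abelian_subgroup I M"
  by (intro abelian_subgroupI3 additive_subgroupI submodule.axioms(1)[OF submod] M.abelian_group_axioms)

lemma pi_eq_iff:
  assumes "x \<in> carrier M" "y \<in> carrier M" shows "\<pi> x = \<pi> y \<longleftrightarrow> x \<ominus>\<^bsub>M\<^esub> y \<in> I"
proof -
  have "x \<in> \<pi> y \<longleftrightarrow> x \<ominus>\<^bsub>M\<^esub> y \<in> I"
    unfolding a_minus_def
    by (rule abelian_subgroup.a_rcos_module[OF abelian_subgroup_I assms(2,1)])
  moreover have "x \<in> \<pi> y \<longleftrightarrow> \<pi> x = \<pi> y"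
    using abelian_subgroup.a_repr_independence'[OF abelian_subgroup_I _ assms(2), of x]
      abelian_subgroup.a_rcos_self[OF abelian_subgroup_I assms(1)] by auto
  ultimately show ?thesis by simp
qed

lemma zero_Q: "\<zero>\<^bsub>Q\<^esub> = I"
  by (simp add: quot_module_def)

lemma pi_zero: "\<pi> \<zero>\<^bsub>M\<^esub> = I"
  by (rule M.a_coset_add_zero[OF I_carrier])

lemma pi_eq_zero_iff: "x \<in> carrier M \<Longrightarrow> \<pi> x = \<zero>\<^bsub>Q\<^esub> \<longleftrightarrow> x \<in> I"
  using pi_eq_iff[of x "\<zero>\<^bsub>M\<^esub>"] M.diff_zero[of x] by (simp only: zero_Q pi_zero M.zero_closed)

lemma carrier_Q: "carrier Q = \<pi> ` carrier M"
  by (auto simp: quot_module_def A_RCOSETS_def')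

lemma add_Q: "x \<in> carrier M \<Longrightarrow> y \<in> carrier M \<Longrightarrow> \<pi> x \<oplus>\<^bsub>Q\<^esub> \<pi> y = \<pi> (x \<oplus>\<^bsub>M\<^esub> y)"
  using abelian_subgroup.a_rcos_sum[OF abelian_subgroup_I] by (simp add: quot_module_def)

lemma smult_Q: assumes "r \<in> carrier R" "x \<in> carrier M" shows "r \<odot>\<^bsub>Q\<^esub> \<pi> x = \<pi> (r \<odot>\<^bsub>M\<^esub> x)"
proof -
  have c: "\<pi> (r \<odot>\<^bsub>M\<^esub> y) = \<pi> (r \<odot>\<^bsub>M\<^esub> x)" if y: "y \<in> \<pi> x" for y
  proof -
    obtain i where i: "i \<in> I" "y = i \<oplus>\<^bsub>M\<^esub> x" using y by (auto simp: a_r_coset_def')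
    have ic: "i \<in> carrier M" using i I_carrier by auto
    have "r \<odot>\<^bsub>M\<^esub> y \<ominus>\<^bsub>M\<^esub> r \<odot>\<^bsub>M\<^esub> x = r \<odot>\<^bsub>M\<^esub> i"
      using ic assms by (simp add: i smult_r_distr a_minus_def M.a_assoc M.r_neg)
    then show ?thesis
      using ic assms i submodule.smult_closed[OF submod] by (subst pi_eq_iff) auto
  qed
  have x: "x \<in> \<pi> x" by (rule abelian_subgroup.a_rcos_self[OF abelian_subgroup_I assms(2)])
  have "r \<odot>\<^bsub>Q\<^esub> \<pi> x = (\<Union>y\<in>\<pi> x. \<pi> (r \<odot>\<^bsub>M\<^esub> y))"
    by (simp add: quot_module_def)
  also have "\<dots> = (\<Union>y\<in>\<pi> x. \<pi> (r \<odot>\<^bsub>M\<^esub> x))"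
    by (rule SUP_cong[OF refl c])
  also have "\<dots> = \<pi> (r \<odot>\<^bsub>M\<^esub> x)"
    by (rule SUP_const) (rule ex_in_conv[THEN iffD1, OF exI, OF x])
  finally show ?thesis .
qed

lemma Q_cases: assumes "q \<in> carrier Q" obtains x where "x \<in> carrier M" "q = \<pi> x"
  using assms by (auto simp: carrier_Q)

lemma pi_closed: "x \<in> carrier M \<Longrightarrow> \<pi> x \<in> carrier Q"
  by (simp add: carrier_Q)

lemma Q_module: "module R Q"
proof (rule moduleI)
  show "cring R" by (rule R.cring_axioms)
  have z: "\<zero>\<^bsub>Q\<^esub> = \<pi> \<zero>\<^bsub>M\<^esub>"
    using pi_eq_zero_iff[of "\<zero>\<^bsub>M\<^esub>"] I_zero by simp
  show "abelian_group Q"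
  proof (rule abelian_groupI)
    fix q assume "q \<in> carrier Q"
    then obtain x where x: "x \<in> carrier M" "q = \<pi> x" by (rule Q_cases)
    have "\<pi> (\<ominus>\<^bsub>M\<^esub> x) \<oplus>\<^bsub>Q\<^esub> q = \<zero>\<^bsub>Q\<^esub>" using x by (simp add: add_Q z M.l_neg)
    then show "\<exists>p\<in>carrier Q. p \<oplus>\<^bsub>Q\<^esub> q = \<zero>\<^bsub>Q\<^esub>" using x pi_closed by blast
  qed (auto elim!: Q_cases simp: add_Q z pi_closed M.a_ac)
qed (auto elim!: Q_cases simp: add_Q smult_Q pi_closed smult_l_distr smult_r_distr smult_assoc1)

lemma pi_linear: "linear_map R M Q \<pi>"
  by (rule linear_mapI) (simp_all add: pi_closed add_Q smult_Q)

text \<open>The map \<open>Q \<rightarrow> P\<close> induced by \<open>g\<close>; if \<open>g\<close> vanishes on \<open>I\<close> the chosen representative is irrelevant.\<close>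

definition "factor g q = g (SOME x. x \<in> carrier M \<and> q = \<pi> x)"

context
  fixes P g
  assumes P: "module R P" and g: "linear_map R M P g" and gI: "\<And>x. x \<in> I \<Longrightarrow> g x = \<zero>\<^bsub>P\<^esub>"
begin

lemma factor_pi: assumes "x \<in> carrier M" shows "factor g (\<pi> x) = g x"
proof -
  interpret P: module R P by (rule P)
  define y where "y = (SOME y. y \<in> carrier M \<and> \<pi> x = \<pi> y)"
  have y: "y \<in> carrier M" "\<pi> x = \<pi> y"
    unfolding y_def using someI[of "\<lambda>y. y \<in> carrier M \<and> \<pi> x = \<pi> y" x] assms by auto
  then have "x \<ominus>\<^bsub>M\<^esub> y \<in> I" using assms pi_eq_iff by auto
  from gI[OF this] have "g x \<ominus>\<^bsub>P\<^esub> g y = \<zero>\<^bsub>P\<^esub>"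
    using linear_map_diff[OF module_axioms P g] assms y by simp
  then show ?thesis
    using linear_map_closed[OF g] assms y(1)
    unfolding factor_def y_def[symmetric] by (simp add: P.diff_eq_zero_iff)
qed

lemma factor_linear: "linear_map R Q P (factor g)"
  by (rule linear_mapI; elim Q_cases)
    (simp_all add: factor_pi add_Q smult_Q linear_map_closed[OF g] linear_map_add[OF g] linear_map_smult[OF g])

end

end


section \<open>Flat modules\<close>

text \<open>The definition of flatness quantifies over test modules on one fixed type. Moving a module along
  an injection into that type makes flatness applicable to modules on other types.\<close>

definition transport_module :: "('a \<Rightarrow> 'u) \<Rightarrow> ('r, 'a, 'y) module_scheme \<Rightarrow> ('r, 'u) module"
  where "transport_module e N = \<lparr>carrier = e ` carrier N, monoid.mult = undefined, monoid.one = undefined,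
    ring.zero = e \<zero>\<^bsub>N\<^esub>, ring.add = (\<lambda>x y. e (inv_into UNIV e x \<oplus>\<^bsub>N\<^esub> inv_into UNIV e y)),
    module.smult = (\<lambda>r x. e (r \<odot>\<^bsub>N\<^esub> inv_into UNIV e x))\<rparr>"

lemma transport_module:
  assumes "inj e" "module R N"
  shows "module R (transport_module e N)"
    and "linear_map R N (transport_module e N) e" "linear_map R (transport_module e N) N (inv_into UNIV e)"
proof -
  interpret N: module R N by fact
  have i: "inv_into UNIV e (e x) = x" for x using assms(1) by simp
  show "module R (transport_module e N)"
  proof (rule moduleI)
    show "cring R" by (rule N.R.cring_axioms)
    show "abelian_group (transport_module e N)"
    proof (rule abelian_groupI)
      fix x assume "x \<in> carrier (transport_module e N)"
      then obtain y where "y \<in> carrier N" "x = e y" by (auto simp: transport_module_def)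
      then show "\<exists>y\<in>carrier (transport_module e N). y \<oplus>\<^bsub>transport_module e N\<^esub> x = \<zero>\<^bsub>transport_module e N\<^esub>"
        by (intro bexI[of _ "e (\<ominus>\<^bsub>N\<^esub> y)"]) (auto simp: transport_module_def i N.l_neg)
    qed (auto simp: transport_module_def i N.a_ac)
  qed (auto simp: transport_module_def i N.smult_l_distr N.smult_r_distr N.smult_assoc1)
  show "linear_map R N (transport_module e N) e" "linear_map R (transport_module e N) N (inv_into UNIV e)"
    by (rule linear_mapI; auto simp: transport_module_def i)+
qed

text \<open>Conjugating with the injections \<open>e\<close> reduces the claim to the transported modules.\<close>

lemma flat_transport:
  fixes e :: "'a \<Rightarrow> 'u" and N :: "('r, 'a, 'z) module_scheme" and N' :: "('r, 'a, 'w) module_scheme"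
  assumes flat: "flat TYPE('u) R M" and e: "inj e"
    and mods: "module R M" "module R N" "module R N'"
    and f: "linear_map R N N' f" "inj_on f (carrier N)"
  shows "inj_on (tensor_id_map R M N' f) (carrier (tensor R M N))"
proof (rule inj_onI)
  let ?N = "transport_module e N" and ?N' = "transport_module e N'"
  let ?f = "\<lambda>x. e (f (inv_into UNIV e x))"
  note t = transport_module[OF e mods(2)] and t' = transport_module[OF e mods(3)]
  have f': "linear_map R ?N ?N' ?f"
    by (rule linear_map_comp[OF t'(2) linear_map_comp[OF f(1) t(3)]])
  have "inj_on ?f (carrier ?N)"
    using f(2) e by (auto simp: inj_on_def transport_module_def)
  then have inj: "inj_on (tensor_id_map R M ?N' ?f) (carrier (tensor R M ?N))"
    using flat f' t(1) t'(1) by (auto simp: flat_def)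
  fix A B assume A: "A \<in> carrier (tensor R M N)" and B: "B \<in> carrier (tensor R M N)"
    and eq: "tensor_id_map R M N' f A = tensor_id_map R M N' f B"
  have comm: "tensor_id_map R M ?N' ?f (tensor_id_map R M ?N e X) =
      tensor_id_map R M ?N' e (tensor_id_map R M N' f X)" if "X \<in> carrier (tensor R M N)" for X
  proof -
    have h: "linear_map R N ?N' (\<lambda>x. e (f x))" by (rule linear_map_comp[OF t'(2) f(1)])
    show ?thesis
      using tensor_id_map_comp[OF mods(1,2) t(1) t'(1) t(2) f' h _ that]
        tensor_id_map_comp[OF mods(1,2,3) t'(1) f(1) t'(2) h _ that] e by simp
  qed
  have retract: "tensor_id_map R M N (inv_into UNIV e) (tensor_id_map R M ?N e X) = X" if "X \<in> carrier (tensor R M N)" for X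
    using tensor_id_map_comp[OF mods(1,2) t(1) mods(2) t(2,3) linear_map_id _ that]
      tensor_id_map_id[OF mods(1,2) that] e by simp
  note cl = linear_map_closed[OF tensor_id_map_linear[OF mods(1,2) t(1,2)]]
  have "tensor_id_map R M ?N e A = tensor_id_map R M ?N e B"
    by (rule inj_onD[OF inj _ cl[OF A] cl[OF B]]) (simp only: comm[OF A] comm[OF B] eq)
  from arg_cong[OF this, of "tensor_id_map R M N (inv_into UNIV e)"] show "A = B"
    by (simp only: retract[OF A] retract[OF B])
qed

text \<open>Let \<open>Im\<close> be the image of \<open>f\<close>. Flatness makes \<open>M \<otimes> Im \<rightarrow> M \<otimes> N'\<close> injective, so \<open>A\<close> already
  dies in \<open>M \<otimes> Im\<close>. By right exactness, \<open>M \<otimes> Im\<close> is \<open>M \<otimes> N\<close> modulo the image \<open>J\<close> of \<open>M \<otimes> K\<close>: the map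
  \<open>g\<close> back to this quotient chooses preimages under \<open>f\<close>, and different choices differ by
  elements of the kernel \<open>K\<close>.\<close>

lemma flat_exact:
  fixes e :: "'b \<Rightarrow> 'u" and N :: "('r, 'a, 'z) module_scheme" and N' :: "('r, 'b, 'w) module_scheme"
    and K :: "('r, 'a, 'v) module_scheme"
  assumes flat: "flat TYPE('u) R M" and e: "inj e"
    and mods: "module R M" "module R N" "module R N'" "module R K"
    and f: "linear_map R N N' f"
    and K: "carrier K = {x \<in> carrier N. f x = \<zero>\<^bsub>N'\<^esub>}" "linear_map R K N (\<lambda>x. x)"
    and A: "A \<in> carrier (tensor R M N)" "tensor_id_map R M N' f A = \<zero>\<^bsub>tensor R M N'\<^esub>"
  shows "A \<in> tensor_id_map R M N (\<lambda>x. x) ` carrier (tensor R M K)"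
proof -
  interpret M: module R M by fact
  interpret N: module R N by fact
  interpret N': module R N' by fact
  interpret MN: module R "tensor R M N" by (rule tensor_module[OF mods(1,2)])
  interpret MK: module R "tensor R M K" by (rule tensor_module[OF mods(1,4)])
  define Im where "Im = N'\<lparr>carrier := f ` carrier N\<rparr>"
  have cIm: "carrier Im = f ` carrier N" by (simp add: Im_def)
  have Im: "module R Im"
    unfolding Im_def
    by (rule submodule.submodule_is_module[OF N.image_submodule[OF mods(3) f] mods(3)])
  have incl: "linear_map R Im N' (\<lambda>x. x)" and fIm: "linear_map R N Im f"
    using f by (auto simp: linear_map_def Im_def)
  let ?B = "tensor_id_map R M Im f A"
  have "?B = \<zero>\<^bsub>tensor R M Im\<^esub>"
  proof (rule inj_onD[OF flat_transport[OF flat e mods(1) Im mods(3) incl]])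
    show "inj_on (\<lambda>x. x) (carrier Im)" by simp
    have "tensor_id_map R M N' (\<lambda>x. x) ?B = tensor_id_map R M N' f A"
      by (rule tensor_id_map_comp[OF mods(1,2) Im mods(3) fIm incl f _ A(1)]) simp
    also have "\<dots> = tensor_id_map R M N' (\<lambda>x. x) \<zero>\<^bsub>tensor R M Im\<^esub>"
      using linear_map_zero[OF tensor_module[OF mods(1) Im] tensor_module[OF mods(1,3)]
          tensor_id_map_linear[OF mods(1) Im mods(3) incl]] A(2) by simp
    finally show "tensor_id_map R M N' (\<lambda>x. x) ?B = tensor_id_map R M N' (\<lambda>x. x) \<zero>\<^bsub>tensor R M Im\<^esub>" .
    show "?B \<in> carrier (tensor R M Im)"
      by (rule linear_map_closed[OF tensor_id_map_linear[OF mods(1,2) Im fIm] A(1)])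
    show "\<zero>\<^bsub>tensor R M Im\<^esub> \<in> carrier (tensor R M Im)"
      using module_group[OF tensor_module[OF mods(1) Im]] abelian_group_def abelian_monoid.zero_closed by metis
  qed
  define J where "J = tensor_id_map R M N (\<lambda>x. x) ` carrier (tensor R M K)"
  interpret J: quotient_module R "tensor R M N" J
    unfolding J_def
    by (intro quotient_module.intro quotient_module_axioms.intro MN.module_axioms)
      (rule MK.image_submodule[OF MN.module_axioms tensor_id_map_linear[OF mods(1,4,2) K(2)]])
  note QJ = J.Q_module
  interpret QJ: module R J.Q by (rule QJ)
  define s where "s y = (SOME x. x \<in> carrier N \<and> f x = y)" for y
  have s: "s y \<in> carrier N" "f (s y) = y" if "y \<in> carrier Im" for y
  proof -
    have "\<exists>x. x \<in> carrier N \<and> f x = y" using that by (auto simp: cIm)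
    from someI_ex[OF this] show "s y \<in> carrier N" "f (s y) = y" by (auto simp: s_def)
  qed
  define g where "g m y = J.\<pi> (tens R M N m (s y))" for m y
  note tl = tens_closed[OF mods(1,2)]
  have g: "g m (f x) = J.\<pi> (tens R M N m x)" if "m \<in> carrier M" "x \<in> carrier N" for m x
  proof -
    have fx: "f x \<in> carrier Im" using that by (simp add: cIm)
    have k: "s (f x) \<ominus>\<^bsub>N\<^esub> x \<in> carrier K"
      using linear_map_diff[OF mods(2,3) f s(1)[OF fx] that(2)] s[OF fx] that
        linear_map_closed[OF f that(2)] by (simp add: K N'.diff_eq_zero_iff)
    have "tens R M N m (s (f x)) \<ominus>\<^bsub>tensor R M N\<^esub> tens R M N m x = tens R M N m (s (f x) \<ominus>\<^bsub>N\<^esub> x)"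
      using linear_map_diff[OF mods(2) MN.module_axioms linear_tens_right[OF mods(1,2) that(1) linear_map_id]
          s(1)[OF fx] that(2)] by simp
    also have "\<dots> = tensor_id_map R M N (\<lambda>x. x) (tens R M K m (s (f x) \<ominus>\<^bsub>N\<^esub> x))"
      by (rule tensor_id_map_tens[OF mods(1,4,2) K(2) that(1) k, symmetric])
    also have "\<dots> \<in> J"
      unfolding J_def by (rule imageI[OF tens_closed[OF mods(1,4) that(1) k]])
    finally show ?thesis
      unfolding g_def using J.pi_eq_iff tl that s(1)[OF fx] by simp
  qed
  have g_bil: "bilinear_map R M Im J.Q g"
  proof (rule bilinear_mapI)
    fix y assume "y \<in> carrier Im"
    then show "linear_map R M J.Q (\<lambda>m. g m y)"
      unfolding g_def
      by (intro linear_map_comp[OF J.pi_linear] linear_tens_left mods linear_map_id s)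
  next
    fix m assume m: "m \<in> carrier M"
    have gm: "linear_map R N J.Q (\<lambda>x. g m (f x))"
      by (rule linear_map_cong[OF mods(2) linear_map_comp[OF J.pi_linear linear_tens_right[OF mods(1,2) m linear_map_id]]])
        (simp add: g m)
    show "linear_map R Im J.Q (\<lambda>y. g m y)"
    proof (rule linear_mapI)
      fix x y assume "x \<in> carrier Im" "y \<in> carrier Im"
      then show "g m (x \<oplus>\<^bsub>Im\<^esub> y) = g m x \<oplus>\<^bsub>J.Q\<^esub> g m y"
        unfolding cIm
        by (auto simp flip: linear_map_add[OF fIm] linear_map_add[OF gm])
    next
      fix r x assume "r \<in> carrier R" "x \<in> carrier Im"
      then show "g m (r \<odot>\<^bsub>Im\<^esub> x) = r \<odot>\<^bsub>J.Q\<^esub> g m x"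
        unfolding cIm
        by (auto simp flip: linear_map_smult[OF fIm] linear_map_smult[OF gm])
    qed (use linear_map_closed[OF gm] in \<open>auto simp: cIm\<close>)
  qed
  note L = lift_linear[OF mods(1) Im QJ g_bil]
  have "J.\<pi> A = tensor_lift J.Q g ?B"
  proof (rule tensor_ext[OF mods(1,2) J.pi_linear linear_map_comp[OF L tensor_id_map_linear[OF mods(1,2) Im fIm]] _ A(1)])
    fix m n assume mn: "m \<in> carrier M" "n \<in> carrier N"
    then have "f n \<in> carrier Im" by (simp add: cIm)
    then show "J.\<pi> (tens R M N m n) = tensor_lift J.Q g (tensor_id_map R M Im f (tens R M N m n))"
      using mn by (simp add: tensor_id_map_tens[OF mods(1,2) Im fIm] lift_tens[OF mods(1) Im QJ g_bil] g)
  qed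
  also have "\<dots> = \<zero>\<^bsub>J.Q\<^esub>"
    using linear_map_zero[OF tensor_module[OF mods(1) Im] QJ L] \<open>?B = \<zero>\<^bsub>tensor R M Im\<^esub>\<close> by simp
  finally show ?thesis
    using J.pi_eq_zero_iff[OF A(1)] by (simp add: J_def)
qed

section \<open>Sweedler calculus in a Hopf algebra\<close>

text \<open>These rules decompose a goal that asserts that a term is linear or multilinear in a variable, or
  that it lies in a carrier, along the structure of the term.\<close>

named_theorems lin

declare linear_map_id [lin] tensor_module [lin] tens_closed [lin]
  linear_tens_left [lin] linear_tens_right [lin] bilinear_mapI [lin]
  trilinear_mapI [lin]

context hopf_algebra
begin

lemma H_module [lin]: "module R H" ..

abbreviation mult_H (infixl "\<bullet>" 70) where "x \<bullet> y \<equiv> x \<otimes>\<^bsub>H\<^esub> y"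

lemma H_closed [lin]: "x \<in> carrier H \<Longrightarrow> y \<in> carrier H \<Longrightarrow> x \<bullet> y \<in> carrier H" "\<one>\<^bsub>H\<^esub> \<in> carrier H"
  by auto

lemma antipode_closed [lin]: "x \<in> carrier H \<Longrightarrow> antipode x \<in> carrier H"
  by (rule linear_map_closed[OF antipode_linear])

lemma counit_closed [lin]: "x \<in> carrier H \<Longrightarrow> \<epsilon> x \<in> carrier R"
  using linear_map_closed[OF counit_linear] by (simp add: regular_module_def)

lemma comult_closed [lin]: "x \<in> carrier H \<Longrightarrow> \<Delta> x \<in> carrier (tensor R H H)"
  by (rule linear_map_closed[OF comult_linear])

abbreviation (input) "S \<equiv> antipode"

abbreviation sw where "sw P f x \<equiv> tensor_lift P f (\<Delta> x)"

lemma linear_mult_left [lin]: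
  assumes "linear_map R L H g" "c \<in> carrier H" shows "linear_map R L H (\<lambda>x. g x \<bullet> c)"
proof (rule linear_map_comp[OF _ assms(1)])
  show "linear_map R H H (\<lambda>x. x \<bullet> c)"
    by (rule linear_mapI) (auto simp: assms H.l_distr smult_mult_left)
qed

lemma linear_mult_right [lin]:
  assumes "linear_map R L H g" "c \<in> carrier H" shows "linear_map R L H (\<lambda>x. c \<bullet> g x)"
proof (rule linear_map_comp[OF _ assms(1)])
  show "linear_map R H H (\<lambda>x. c \<bullet> x)"
    by (rule linear_mapI) (auto simp: assms H.r_distr smult_mult_right)
qed

lemma linear_antipode [lin]: "linear_map R L H g \<Longrightarrow> linear_map R L H (\<lambda>x. antipode (g x))"
  by (rule linear_map_comp[OF antipode_linear])

lemma counit_add: "x \<in> carrier H \<Longrightarrow> y \<in> carrier H \<Longrightarrow> \<epsilon> (x \<oplus>\<^bsub>H\<^esub> y) = \<epsilon> x \<oplus>\<^bsub>R\<^esub> \<epsilon> y"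
  and counit_smult: "r \<in> carrier R \<Longrightarrow> x \<in> carrier H \<Longrightarrow> \<epsilon> (r \<odot>\<^bsub>H\<^esub> x) = r \<otimes>\<^bsub>R\<^esub> \<epsilon> x"
  using linear_map_add[OF counit_linear] linear_map_smult[OF counit_linear]
  by (auto simp: regular_module_def)

lemma linear_scalar:
  assumes "module R P" "linear_map R L (regular_module R) g" "c \<in> carrier P"
  shows "linear_map R L P (\<lambda>x. g x \<odot>\<^bsub>P\<^esub> c)"
proof (rule linear_map_comp[OF _ assms(2)])
  interpret P: module R P by fact
  show "linear_map R (regular_module R) P (\<lambda>r. r \<odot>\<^bsub>P\<^esub> c)"
    by (rule linear_mapI) (auto simp: regular_module_def assms(3) P.smult_l_distr P.smult_assoc1)
qed

lemma linear_counit [lin]: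
  "module R P \<Longrightarrow> linear_map R L H g \<Longrightarrow> c \<in> carrier P \<Longrightarrow> linear_map R L P (\<lambda>x. \<epsilon> (g x) \<odot>\<^bsub>P\<^esub> c)"
  by (rule linear_scalar[OF _ linear_map_comp[OF counit_linear]])

lemma linear_smult [lin]:
  assumes "module R P" "linear_map R L P g" "r \<in> carrier R"
  shows "linear_map R L P (\<lambda>x. r \<odot>\<^bsub>P\<^esub> g x)"
proof (rule linear_map_comp[OF _ assms(2)])
  interpret P: module R P by fact
  show "linear_map R P P (\<lambda>x. r \<odot>\<^bsub>P\<^esub> x)"
    using assms(3) by (intro linear_mapI) (auto simp: P.smult_r_distr R.m_comm simp flip: P.smult_assoc1)
qed

lemma sw_closed [lin]: "module R P \<Longrightarrow> bilinear_map R H H P f \<Longrightarrow> x \<in> carrier H \<Longrightarrow> sw P f x \<in> carrier P"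
  by (rule lift_closed[OF H_module H_module _ _ comult_closed])

lemma linear_sw_arg [lin]:
  "module R P \<Longrightarrow> bilinear_map R H H P f \<Longrightarrow> linear_map R L H g \<Longrightarrow> linear_map R L P (\<lambda>x. sw P f (g x))"
  by (rule linear_map_comp[OF lift_linear[OF H_module H_module] linear_map_comp[OF comult_linear]])

lemma linear_sw_param [lin]:
  "module R L \<Longrightarrow> module R P \<Longrightarrow> y \<in> carrier H \<Longrightarrow>
    (\<And>x. x \<in> carrier L \<Longrightarrow> bilinear_map R H H P (\<lambda>a b. f x a b)) \<Longrightarrow>
    (\<And>a b. a \<in> carrier H \<Longrightarrow> b \<in> carrier H \<Longrightarrow> linear_map R L P (\<lambda>x. f x a b)) \<Longrightarrow>
    linear_map R L P (\<lambda>x. sw P (\<lambda>a b. f x a b) y)"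
  by (rule lift_param_linear[OF _ H_module H_module _ comult_closed])

lemma sw_cong:
  assumes "module R P" "bilinear_map R H H P f" "x \<in> carrier H"
    and "\<And>a b. a \<in> carrier H \<Longrightarrow> b \<in> carrier H \<Longrightarrow> f a b = g a b"
  shows "sw P f x = sw P g x"
  by (rule lift_cong[OF H_module H_module assms(1,2) comult_closed[OF assms(3)] assms(4)])

lemma linear_sw:
  assumes "module R P" "module R P'" "linear_map R P P' g" "bilinear_map R H H P f" "x \<in> carrier H"
  shows "g (sw P f x) = sw P' (\<lambda>a b. g (f a b)) x"
  by (rule linear_lift[OF H_module H_module assms(1-4) comult_closed[OF assms(5)]])

lemma sw_swap:
  assumes "module R P" "x \<in> carrier H" "y \<in> carrier H"
    and "\<And>c d. c \<in> carrier H \<Longrightarrow> d \<in> carrier H \<Longrightarrow> bilinear_map R H H P (\<lambda>a b. f a b c d)"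
    and "\<And>a b. a \<in> carrier H \<Longrightarrow> b \<in> carrier H \<Longrightarrow> bilinear_map R H H P (\<lambda>c d. f a b c d)"
  shows "sw P (\<lambda>a b. sw P (\<lambda>c d. f a b c d) y) x = sw P (\<lambda>c d. sw P (\<lambda>a b. f a b c d) x) y"
  by (rule lift_swap[OF H_module H_module H_module H_module assms(1) comult_closed comult_closed])
    (rule assms; assumption)+

text \<open>\<open>f(x\<^sub>1, x\<^sub>2, x\<^sub>3)\<close> can be bracketed in either way.\<close>

lemma sw_coassoc:
  assumes P: "module R P" and x: "x \<in> carrier H"
    and f1: "\<And>b c. b \<in> carrier H \<Longrightarrow> c \<in> carrier H \<Longrightarrow> linear_map R H P (\<lambda>a. f a b c)"
    and f2: "\<And>a c. a \<in> carrier H \<Longrightarrow> c \<in> carrier H \<Longrightarrow> linear_map R H P (\<lambda>b. f a b c)"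
    and f3: "\<And>a b. a \<in> carrier H \<Longrightarrow> b \<in> carrier H \<Longrightarrow> linear_map R H P (\<lambda>c. f a b c)"
  shows "sw P (\<lambda>a b. sw P (\<lambda>c d. f a c d) b) x = sw P (\<lambda>a b. sw P (\<lambda>c d. f c d b) a) x"
proof -
  let ?HH = "tensor R H H" and ?HHH = "tensor R H (tensor R H H)"
  note [lin] = P f1 f2 f3
  define G where "G = tensor_lift3 P f"
  have f_tri: "trilinear_map R H H H P f"
    by (assumption | rule lin)+
  have HH: "module R ?HH" and HHH: "module R ?HHH" by (rule lin)+
  have G: "linear_map R ?HHH P G"
    unfolding G_def by (rule tensor_lift3_linear[OF H_module H_module H_module P f_tri])
  have G_tens: "G (tens R H ?HH a B) = tensor_lift P (\<lambda>b c. f a b c) B"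
    if "a \<in> carrier H" "B \<in> carrier ?HH" for a B
    unfolding G_def by (rule tensor_lift3_tens(1)[OF H_module H_module H_module P f_tri that])
  have G_tens2: "G (tens R H ?HH a (tens R H H b c)) = f a b c"
    if "a \<in> carrier H" "b \<in> carrier H" "c \<in> carrier H" for a b c
    unfolding G_def by (rule tensor_lift3_tens(2)[OF H_module H_module H_module P f_tri that])
  have l: "linear_map R H ?HHH (\<lambda>b. tens R H ?HH a (\<Delta> b))" if "a \<in> carrier H" for a
    by (rule linear_tens_right[OF H_module HH that comult_linear])
  have "sw P (\<lambda>a b. sw P (\<lambda>c d. f a c d) b) x = sw P (\<lambda>a b. G (tens R H ?HH a (\<Delta> b))) x"
    by (rule sw_cong[OF P _ x]) ((assumption | rule lin)+, simp add: G_tens comult_closed)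
  also have "\<dots> = G (sw ?HHH (\<lambda>a b. tens R H ?HH a (\<Delta> b)) x)"
    by (rule linear_sw[OF HHH P G _ x, symmetric]) ((assumption | rule lin l comult_closed)+)
  also have "sw ?HHH (\<lambda>a b. tens R H ?HH a (\<Delta> b)) x =
      sw ?HHH (\<lambda>a b. sw ?HHH (\<lambda>c d. tens R H ?HH c (tens R H H d b)) a) x"
    by (rule coassoc[OF x])
  also have "G \<dots> = sw P (\<lambda>a b. G (sw ?HHH (\<lambda>c d. tens R H ?HH c (tens R H H d b)) a)) x"
    by (rule linear_sw[OF HHH P G _ x]) ((assumption | rule lin)+)
  also have "\<dots> = sw P (\<lambda>a b. sw P (\<lambda>c d. f c d b) a) x"
  proof (rule sw_cong[OF P _ x])
    show "bilinear_map R H H P (\<lambda>a b. G (sw ?HHH (\<lambda>c d. tens R H ?HH c (tens R H H d b)) a))"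
      by (rule bilinear_map_comp[OF G]) ((assumption | rule lin)+)
    fix a b assume ab: "a \<in> carrier H" "b \<in> carrier H"
    have "G (sw ?HHH (\<lambda>c d. tens R H ?HH c (tens R H H d b)) a) =
        sw P (\<lambda>c d. G (tens R H ?HH c (tens R H H d b))) a"
      using ab by (intro linear_sw[OF HHH P G]) ((assumption | rule lin)+)
    also have "\<dots> = sw P (\<lambda>c d. f c d b) a"
      by (rule sw_cong[OF P bilinear_map_comp[OF G]]) ((assumption | rule lin ab)+, simp add: G_tens2 ab)
    finally show "G (sw ?HHH (\<lambda>c d. tens R H ?HH c (tens R H H d b)) a) = sw P (\<lambda>c d. f c d b) a" .
  qed
  finally show ?thesis .
qed

lemma sw_counit_left:
  assumes P: "module R P" and g: "linear_map R H P g" and x: "x \<in> carrier H"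
  shows "sw P (\<lambda>a b. \<epsilon> a \<odot>\<^bsub>P\<^esub> g b) x = g x"
proof -
  note [lin] = P g linear_map_comp[OF g] linear_map_closed[OF g]
  have "g x = g (sw H (\<lambda>a b. \<epsilon> a \<odot>\<^bsub>H\<^esub> b) x)"
    by (simp only: counit_left[OF x])
  also have "\<dots> = sw P (\<lambda>a b. g (\<epsilon> a \<odot>\<^bsub>H\<^esub> b)) x"
    by (rule linear_sw[OF H_module P g _ x]) ((assumption | rule lin)+)
  also have "\<dots> = sw P (\<lambda>a b. \<epsilon> a \<odot>\<^bsub>P\<^esub> g b) x"
    by (rule sw_cong[OF P _ x]) ((assumption | rule lin)+, simp add: linear_map_smult[OF g] counit_closed)
  finally show ?thesis by simp
qed

lemma sw_counit_right:
  assumes P: "module R P" and g: "linear_map R H P g" and x: "x \<in> carrier H"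
  shows "sw P (\<lambda>a b. \<epsilon> b \<odot>\<^bsub>P\<^esub> g a) x = g x"
proof -
  note [lin] = P g linear_map_comp[OF g] linear_map_closed[OF g]
  have "g x = g (sw H (\<lambda>a b. \<epsilon> b \<odot>\<^bsub>H\<^esub> a) x)"
    by (simp only: counit_right[OF x])
  also have "\<dots> = sw P (\<lambda>a b. g (\<epsilon> b \<odot>\<^bsub>H\<^esub> a)) x"
    by (rule linear_sw[OF H_module P g _ x]) ((assumption | rule lin)+)
  also have "\<dots> = sw P (\<lambda>a b. \<epsilon> b \<odot>\<^bsub>P\<^esub> g a) x"
    by (rule sw_cong[OF P _ x]) ((assumption | rule lin)+, simp add: linear_map_smult[OF g] counit_closed)
  finally show ?thesis by simp
qed

lemma sw_antipode_left:
  assumes P: "module R P" and g: "linear_map R H P g" and x: "x \<in> carrier H"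
  shows "sw P (\<lambda>a b. g (S a \<bullet> b)) x = \<epsilon> x \<odot>\<^bsub>P\<^esub> g \<one>\<^bsub>H\<^esub>"
proof -
  have "sw P (\<lambda>a b. g (S a \<bullet> b)) x = g (sw H (\<lambda>a b. S a \<bullet> b) x)"
    by (rule linear_sw[OF H_module P g _ x, symmetric]) ((assumption | rule lin)+)
  also have "\<dots> = \<epsilon> x \<odot>\<^bsub>P\<^esub> g \<one>\<^bsub>H\<^esub>"
    using x by (simp add: antipode_left linear_map_smult[OF g] counit_closed)
  finally show ?thesis .
qed

lemma sw_antipode_right:
  assumes P: "module R P" and g: "linear_map R H P g" and x: "x \<in> carrier H"
  shows "sw P (\<lambda>a b. g (a \<bullet> S b)) x = \<epsilon> x \<odot>\<^bsub>P\<^esub> g \<one>\<^bsub>H\<^esub>"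
proof -
  have "sw P (\<lambda>a b. g (a \<bullet> S b)) x = g (sw H (\<lambda>a b. a \<bullet> S b) x)"
    by (rule linear_sw[OF H_module P g _ x, symmetric]) ((assumption | rule lin)+)
  also have "\<dots> = \<epsilon> x \<odot>\<^bsub>P\<^esub> g \<one>\<^bsub>H\<^esub>"
    using x by (simp add: antipode_right linear_map_smult[OF g] counit_closed)
  finally show ?thesis .
qed

lemma sw_mult:
  assumes P: "module R P" and f: "bilinear_map R H H P f" and x: "x \<in> carrier H" "y \<in> carrier H"
  shows "sw P f (x \<bullet> y) = sw P (\<lambda>a b. sw P (\<lambda>c d. f (a \<bullet> c) (b \<bullet> d)) y) x"
proof -
  let ?HH = "tensor R H H"
  note [lin] = P x
  have HH: "module R ?HH" by (rule lin)+
  note L = lift_linear[OF H_module H_module P f]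
  have "sw P f (x \<bullet> y) = tensor_lift P f (sw ?HH (\<lambda>a b. sw ?HH (\<lambda>c d. tens R H H (a \<bullet> c) (b \<bullet> d)) y) x)"
    by (simp only: comult_mult[OF x])
  also have "\<dots> = sw P (\<lambda>a b. tensor_lift P f (sw ?HH (\<lambda>c d. tens R H H (a \<bullet> c) (b \<bullet> d)) y)) x"
    by (rule linear_sw[OF HH P L _ x(1)]) ((assumption | rule lin)+)
  also have "\<dots> = sw P (\<lambda>a b. sw P (\<lambda>c d. f (a \<bullet> c) (b \<bullet> d)) y) x"
  proof (rule sw_cong[OF P bilinear_map_comp[OF L] x(1)])
    show "bilinear_map R H H ?HH (\<lambda>a b. sw ?HH (\<lambda>c d. tens R H H (a \<bullet> c) (b \<bullet> d)) y)"
      by ((assumption | rule lin)+)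
    fix a b assume ab: "a \<in> carrier H" "b \<in> carrier H"
    have "tensor_lift P f (sw ?HH (\<lambda>c d. tens R H H (a \<bullet> c) (b \<bullet> d)) y) =
        sw P (\<lambda>c d. tensor_lift P f (tens R H H (a \<bullet> c) (b \<bullet> d))) y"
      using ab by (intro linear_sw[OF HH P L _ x(2)]) ((assumption | rule lin)+)
    also have "\<dots> = sw P (\<lambda>c d. f (a \<bullet> c) (b \<bullet> d)) y"
    proof (rule sw_cong[OF P bilinear_map_comp[OF L] x(2)])
      show "bilinear_map R H H ?HH (\<lambda>c d. tens R H H (a \<bullet> c) (b \<bullet> d))"
        using ab by - (assumption | rule lin)+
    qed (simp add: lift_tens[OF H_module H_module P f] ab)
    finally show "tensor_lift P f (sw ?HH (\<lambda>c d. tens R H H (a \<bullet> c) (b \<bullet> d)) y) =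
        sw P (\<lambda>c d. f (a \<bullet> c) (b \<bullet> d)) y" .
  qed
  finally show ?thesis .
qed

lemma sw_one:
  assumes P: "module R P" and f: "bilinear_map R H H P f"
  shows "sw P f \<one>\<^bsub>H\<^esub> = f \<one>\<^bsub>H\<^esub> \<one>\<^bsub>H\<^esub>"
  by (simp add: comult_one lift_tens[OF H_module H_module P f])

lemma antipode_one: "antipode \<one>\<^bsub>H\<^esub> = \<one>\<^bsub>H\<^esub>"
proof -
  have "sw H (\<lambda>a b. S a \<bullet> b) \<one>\<^bsub>H\<^esub> = antipode \<one>\<^bsub>H\<^esub> \<bullet> \<one>\<^bsub>H\<^esub>"
    by (rule sw_one) ((assumption | rule lin)+)
  then show ?thesis
    using antipode_left[of "\<one>\<^bsub>H\<^esub>"] by (simp add: counit_one antipode_closed)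
qed

lemma regular_module_module [lin]: "module R (regular_module R)"
proof (rule moduleI)
  have am: "abelian_group R" by (rule R.is_abelian_group)
  show "abelian_group (regular_module R)"
    by (rule abelian_groupI) (auto simp: regular_module_def R.a_ac intro: R.a_inv_closed R.l_neg)
qed (auto simp: regular_module_def R.l_distr R.r_distr R.m_assoc R.cring_axioms)

text \<open>\<open>\<epsilon>(S(x)) = \<epsilon>(S(x\<^sub>1))\<epsilon>(x\<^sub>2) = \<epsilon>(S(x\<^sub>1)x\<^sub>2) = \<epsilon>(x)\<close>.\<close>

lemma counit_antipode: assumes x: "x \<in> carrier H" shows "\<epsilon> (S x) = \<epsilon> x"
proof -
  let ?R = "regular_module R"
  have s: "r \<odot>\<^bsub>?R\<^esub> s = r \<otimes>\<^bsub>R\<^esub> s" for r s by (simp add: regular_module_def)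
  note [lin] = linear_map_comp[OF counit_linear] linear_map_closed[OF counit_linear]
  have eS: "linear_map R H ?R (\<lambda>x. \<epsilon> (S x))"
    by ((assumption | rule lin)+)
  have "\<epsilon> (S x) = sw ?R (\<lambda>a b. \<epsilon> b \<odot>\<^bsub>?R\<^esub> \<epsilon> (S a)) x"
    by (rule sw_counit_right[OF regular_module_module eS x, symmetric])
  also have "\<dots> = sw ?R (\<lambda>a b. \<epsilon> (S a \<bullet> b)) x"
    by (rule sw_cong[OF regular_module_module _ x])
      ((assumption | rule lin)+, simp add: s counit_mult antipode_closed counit_closed R.m_comm)
  also have "\<dots> = \<epsilon> x \<odot>\<^bsub>?R\<^esub> \<epsilon> \<one>\<^bsub>H\<^esub>"
    by (rule sw_antipode_left[OF regular_module_module counit_linear x])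
  finally show ?thesis using x by (simp add: s counit_one counit_closed)
qed

text \<open>\<open>S(x\<^sub>1)x\<^sub>2 \<otimes> x\<^sub>3 = 1 \<otimes> x\<close>, and below \<open>x\<^sub>1S(x\<^sub>2) \<otimes> x\<^sub>3 = 1 \<otimes> x\<close>. Most computations reduce to these
  two cancellations, applied with a suitable \<open>t\<close>.\<close>

lemma sw_cancel_left:
  assumes P: "module R P" and t: "bilinear_map R H H P t" and x: "x \<in> carrier H"
  shows "sw P (\<lambda>a b. sw P (\<lambda>c d. t (S a \<bullet> c) d) b) x = t \<one>\<^bsub>H\<^esub> x"
proof -
  note [lin] = P x linear_map_comp[OF bilinear_map_left[OF t]] linear_map_comp[OF bilinear_map_right[OF t]]
    bilinear_map_closed[OF t]
  have "sw P (\<lambda>a b. sw P (\<lambda>c d. t (S a \<bullet> c) d) b) x =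
      sw P (\<lambda>a b. sw P (\<lambda>c d. t (S c \<bullet> d) b) a) x"
    by (rule sw_coassoc) (assumption | rule lin)+
  also have "\<dots> = sw P (\<lambda>a b. \<epsilon> a \<odot>\<^bsub>P\<^esub> t \<one>\<^bsub>H\<^esub> b) x"
    by (rule sw_cong) ((assumption | rule lin)+, rule sw_antipode_left[OF P bilinear_map_left[OF t]])
  also have "\<dots> = t \<one>\<^bsub>H\<^esub> x"
    by (rule sw_counit_left) (assumption | rule lin)+
  finally show ?thesis .
qed

lemma sw_cancel_right:
  assumes P: "module R P" and t: "bilinear_map R H H P t" and x: "x \<in> carrier H"
  shows "sw P (\<lambda>a b. sw P (\<lambda>c d. t (a \<bullet> S c) d) b) x = t \<one>\<^bsub>H\<^esub> x"
proof -
  note [lin] = P x linear_map_comp[OF bilinear_map_left[OF t]] linear_map_comp[OF bilinear_map_right[OF t]]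
    bilinear_map_closed[OF t]
  have "sw P (\<lambda>a b. sw P (\<lambda>c d. t (a \<bullet> S c) d) b) x =
      sw P (\<lambda>a b. sw P (\<lambda>c d. t (c \<bullet> S d) b) a) x"
    by (rule sw_coassoc) (assumption | rule lin)+
  also have "\<dots> = sw P (\<lambda>a b. \<epsilon> a \<odot>\<^bsub>P\<^esub> t \<one>\<^bsub>H\<^esub> b) x"
    by (rule sw_cong) ((assumption | rule lin)+, rule sw_antipode_right[OF P bilinear_map_left[OF t]])
  also have "\<dots> = t \<one>\<^bsub>H\<^esub> x"
    by (rule sw_counit_left) (assumption | rule lin)+
  finally show ?thesis .
qed

abbreviation "HH \<equiv> tensor R H H"

text \<open>The automorphism of \<open>H \<otimes> H\<close> behind both Galois maps.\<close>

definition "shear = tensor_lift HH (\<lambda>h x. sw HH (\<lambda>a b. tens R H H (h \<bullet> a) b) x)"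
definition "unshear = tensor_lift HH (\<lambda>h x. sw HH (\<lambda>a b. tens R H H (h \<bullet> S a) b) x)"

lemma bilinear_shear:
  "bilinear_map R H H HH (\<lambda>h x. sw HH (\<lambda>a b. tens R H H (h \<bullet> a) b) x)"
  "bilinear_map R H H HH (\<lambda>h x. sw HH (\<lambda>a b. tens R H H (h \<bullet> S a) b) x)"
  by (assumption | rule lin)+

lemma HH_module: "module R HH"
  by (rule lin)+

lemma shear_linear: "linear_map R HH HH shear" and unshear_linear: "linear_map R HH HH unshear"
  unfolding shear_def unshear_def
  by (rule lift_linear[OF H_module H_module HH_module] bilinear_shear)+

lemma shear_tens: "h \<in> carrier H \<Longrightarrow> x \<in> carrier H \<Longrightarrow>
    shear (tens R H H h x) = sw HH (\<lambda>a b. tens R H H (h \<bullet> a) b) x"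
  and unshear_tens: "h \<in> carrier H \<Longrightarrow> x \<in> carrier H \<Longrightarrow>
    unshear (tens R H H h x) = sw HH (\<lambda>a b. tens R H H (h \<bullet> S a) b) x"
  unfolding shear_def unshear_def
  by (rule lift_tens[OF H_module H_module HH_module bilinear_shear(1)], assumption+)
    (rule lift_tens[OF H_module H_module HH_module bilinear_shear(2)], assumption+)

lemma unshear_shear: assumes "A \<in> carrier HH" shows "unshear (shear A) = A"
proof (rule tensor_ext[OF H_module H_module _ linear_map_id _ assms])
  show "linear_map R HH HH (\<lambda>A. unshear (shear A))"
    by (rule linear_map_comp[OF unshear_linear shear_linear])
  fix h x assume [lin]: "h \<in> carrier H" "x \<in> carrier H"
  have "unshear (shear (tens R H H h x)) = unshear (sw HH (\<lambda>a b. tens R H H (h \<bullet> a) b) x)"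
    by (simp add: shear_tens lin)
  also have "\<dots> = sw HH (\<lambda>a b. unshear (tens R H H (h \<bullet> a) b)) x"
    by (rule linear_sw[OF HH_module HH_module unshear_linear]) (assumption | rule lin)+
  also have "\<dots> = sw HH (\<lambda>a b. sw HH (\<lambda>c d. tens R H H (h \<bullet> (a \<bullet> S c)) d) b) x"
    by (rule sw_cong[OF HH_module bilinear_map_comp[OF unshear_linear]])
      ((assumption | rule lin)+, rule trans[OF unshear_tens], (assumption | rule lin)+,
       rule sw_cong, (assumption | rule lin)+, simp add: H.m_assoc lin)
  also have "\<dots> = tens R H H (h \<bullet> \<one>\<^bsub>H\<^esub>) x"
    by (rule sw_cancel_right[where t = "\<lambda>u d. tens R H H (h \<bullet> u) d"]) (assumption | rule lin)+
  finally show "unshear (shear (tens R H H h x)) = tens R H H h x" by (simp add: lin)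
qed

lemma shear_unshear: assumes "A \<in> carrier HH" shows "shear (unshear A) = A"
proof (rule tensor_ext[OF H_module H_module _ linear_map_id _ assms])
  show "linear_map R HH HH (\<lambda>A. shear (unshear A))"
    by (rule linear_map_comp[OF shear_linear unshear_linear])
  fix h x assume [lin]: "h \<in> carrier H" "x \<in> carrier H"
  have "shear (unshear (tens R H H h x)) = shear (sw HH (\<lambda>a b. tens R H H (h \<bullet> S a) b) x)"
    by (simp add: unshear_tens lin)
  also have "\<dots> = sw HH (\<lambda>a b. shear (tens R H H (h \<bullet> S a) b)) x"
    by (rule linear_sw[OF HH_module HH_module shear_linear]) (assumption | rule lin)+
  also have "\<dots> = sw HH (\<lambda>a b. sw HH (\<lambda>c d. tens R H H (h \<bullet> (S a \<bullet> c)) d) b) x"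
    by (rule sw_cong[OF HH_module bilinear_map_comp[OF shear_linear]])
      ((assumption | rule lin)+, rule trans[OF shear_tens], (assumption | rule lin)+,
       rule sw_cong, (assumption | rule lin)+, simp add: H.m_assoc lin)
  also have "\<dots> = tens R H H (h \<bullet> \<one>\<^bsub>H\<^esub>) x"
    by (rule sw_cancel_left[where t = "\<lambda>u d. tens R H H (h \<bullet> u) d"]) (assumption | rule lin)+
  finally show "shear (unshear (tens R H H h x)) = tens R H H h x" by (simp add: lin)
qed

end


section \<open>Quotients by right ideals and their coinvariants\<close>

locale right_ideal_quotient = hopf_algebra R H \<Delta> \<epsilon> antipode
  for R :: "('r, 'x) ring_scheme" (structure) and H :: "('r, 'h, 'y) module_scheme" (structure)
    and \<Delta> and \<epsilon> and antipode +
  fixes I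
  assumes I_submodule: "submodule I R H"
    and I_mult: "x \<in> I \<Longrightarrow> h \<in> carrier H \<Longrightarrow> x \<bullet> h \<in> I"
begin

sublocale quotient_module R H I
  by (rule quotient_module.intro[OF H_module quotient_module_axioms.intro[OF I_submodule]])

declare Q_module [lin] pi_closed [lin]

lemma linear_pi [lin]: "linear_map R L H g \<Longrightarrow> linear_map R L Q (\<lambda>x. \<pi> (g x))"
  by (rule linear_map_comp[OF pi_linear])

lemma proj_eq: "proj H Q x = \<pi> x"
  by (simp add: proj_def zero_Q)

text \<open>\<open>Q\<close> is a right \<open>H\<close>-module because \<open>I\<close> is a right ideal.\<close>

definition "act q h = factor (\<lambda>x. \<pi> (x \<bullet> h)) q"

lemma act_hyps:
  assumes [lin]: "h \<in> carrier H"
  shows "linear_map R H Q (\<lambda>x. \<pi> (x \<bullet> h))" "x \<in> I \<Longrightarrow> \<pi> (x \<bullet> h) = \<zero>\<^bsub>Q\<^esub>"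
proof -
  show "linear_map R H Q (\<lambda>x. \<pi> (x \<bullet> h))" by (assumption | rule lin)+
  assume "x \<in> I"
  then show "\<pi> (x \<bullet> h) = \<zero>\<^bsub>Q\<^esub>"
    using I_mult[OF _ assms] I_carrier assms by (subst pi_eq_zero_iff) auto
qed

lemma act_pi: "x \<in> carrier H \<Longrightarrow> h \<in> carrier H \<Longrightarrow> act (\<pi> x) h = \<pi> (x \<bullet> h)"
  unfolding act_def by (rule factor_pi[OF Q_module act_hyps])

lemma linear_act_left [lin]:
  assumes "linear_map R L Q g" "h \<in> carrier H" shows "linear_map R L Q (\<lambda>x. act (g x) h)"
  unfolding act_def by (rule linear_map_comp[OF factor_linear[OF Q_module act_hyps[OF assms(2)]] assms(1)])

lemma linear_act_right [lin]:
  assumes "linear_map R L H g" "q \<in> carrier Q" shows "linear_map R L Q (\<lambda>x. act q (g x))"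
proof (rule linear_map_comp[OF _ assms(1)])
  obtain x where [lin]: "x \<in> carrier H" and q: "q = \<pi> x" using assms(2) by (rule Q_cases)
  show "linear_map R H Q (\<lambda>h. act q h)"
    by (rule linear_map_cong[where f = "\<lambda>h. \<pi> (x \<bullet> h)"])
      ((assumption | rule lin)+, simp add: q act_pi lin)
qed

lemma act_closed [lin]: "q \<in> carrier Q \<Longrightarrow> h \<in> carrier H \<Longrightarrow> act q h \<in> carrier Q"
  by (rule linear_map_closed[OF linear_act_left[OF linear_map_id]])

lemma act_act: "q \<in> carrier Q \<Longrightarrow> h \<in> carrier H \<Longrightarrow> g \<in> carrier H \<Longrightarrow> act (act q h) g = act q (h \<bullet> g)"
  by (elim Q_cases) (simp add: act_pi H.m_assoc)

lemma act_one: "q \<in> carrier Q \<Longrightarrow> act q \<one>\<^bsub>H\<^esub> = q"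
  by (elim Q_cases) (simp add: act_pi)

abbreviation "HQ \<equiv> tensor R H Q"

definition "coact h = sw HQ (\<lambda>a b. tens R H Q a (\<pi> b)) h"

lemma linear_coact [lin]: "linear_map R L H g \<Longrightarrow> linear_map R L HQ (\<lambda>x. coact (g x))"
  unfolding coact_def by (assumption | rule lin)+

lemma coact_closed [lin]: "h \<in> carrier H \<Longrightarrow> coact h \<in> carrier HQ"
  by (rule linear_map_closed[OF linear_coact[OF linear_map_id]])

abbreviation "coinv \<equiv> coinvariants R H \<Delta> Q"

lemma coinv_iff: "h \<in> coinv \<longleftrightarrow> h \<in> carrier H \<and> coact h = tens R H Q h (\<pi> \<one>\<^bsub>H\<^esub>)"
  by (simp add: coinvariants_def proj_eq coact_def)

lemma coinv_closed: "h \<in> coinv \<Longrightarrow> h \<in> carrier H"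
  by (simp add: coinv_iff)

text \<open>This linear map has the coinvariants as its kernel, which is the form in which flatness applies
  to them.\<close>

definition "defect h = coact h \<ominus>\<^bsub>HQ\<^esub> tens R H Q h (\<pi> \<one>\<^bsub>H\<^esub>)"

lemma HQ_module: "module R HQ"
  by (rule lin)+

lemma linear_defect: "linear_map R H HQ defect"
  unfolding defect_def by (rule linear_map_diffI) (assumption | rule lin)+

lemma coinv_kernel: "coinv = {h \<in> carrier H. defect h = \<zero>\<^bsub>HQ\<^esub>}"
proof -
  interpret HQ: module R HQ by (rule HQ_module)
  have d: "defect h = \<zero>\<^bsub>HQ\<^esub> \<longleftrightarrow> coact h = tens R H Q h (\<pi> \<one>\<^bsub>H\<^esub>)" if [lin]: "h \<in> carrier H" for h
    unfolding defect_def by (rule HQ.diff_eq_zero_iff) (assumption | rule lin)+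
  have "h \<in> coinv \<longleftrightarrow> h \<in> carrier H \<and> defect h = \<zero>\<^bsub>HQ\<^esub>" for h
    by (simp only: coinv_iff d cong: conj_cong)
  then show ?thesis by blast
qed

lemma coinv_submodule: "submodule coinv R H"
proof (rule submoduleI)
  interpret HQ: module R HQ by (rule HQ_module)
  note d = linear_map_zero[OF H_module HQ_module linear_defect] linear_map_minus[OF H_module HQ_module linear_defect]
    linear_map_add[OF linear_defect] linear_map_smult[OF linear_defect]
  have m: "\<ominus>\<^bsub>HQ\<^esub> \<zero>\<^bsub>HQ\<^esub> = \<zero>\<^bsub>HQ\<^esub>" using HQ.minus_equality[of "\<zero>\<^bsub>HQ\<^esub>" "\<zero>\<^bsub>HQ\<^esub>"] by simp
  show "coinv \<subseteq> carrier H" by (auto simp: coinv_kernel)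
  show "\<zero>\<^bsub>H\<^esub> \<in> coinv" by (simp add: coinv_kernel d)
  show "\<ominus>\<^bsub>H\<^esub> a \<in> coinv" if "a \<in> coinv" for a using that by (simp add: coinv_kernel d m)
  show "a \<oplus>\<^bsub>H\<^esub> b \<in> coinv" if "a \<in> coinv" "b \<in> coinv" for a b using that by (simp add: coinv_kernel d)
  show "a \<odot>\<^bsub>H\<^esub> b \<in> coinv" if "a \<in> carrier R" "b \<in> coinv" for a b using that by (simp add: coinv_kernel d)
qed

text \<open>In an expression that is bilinear in \<open>k\<^sub>1\<close> and \<open>\<pi>(k\<^sub>2)\<close>, these may be replaced by \<open>k\<close> and \<open>\<pi>(1)\<close> when
  \<open>k\<close> is coinvariant. This is how coinvariance is used below.\<close>

lemma sw_coinv: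
  assumes P: "module R P" and f: "bilinear_map R H Q P f" and k: "k \<in> coinv"
  shows "sw P (\<lambda>a b. f a (\<pi> b)) k = f k (\<pi> \<one>\<^bsub>H\<^esub>)"
proof -
  note [lin] = coinv_closed[OF k] P linear_map_comp[OF bilinear_map_left[OF f]]
    linear_map_comp[OF bilinear_map_right[OF f]]
  note f_lin = lift_linear[OF H_module Q_module P f] and f_tens = lift_tens[OF H_module Q_module P f]
  have "sw P (\<lambda>a b. f a (\<pi> b)) k = sw P (\<lambda>a b. tensor_lift P f (tens R H Q a (\<pi> b))) k"
    by (rule sw_cong) ((assumption | rule lin)+, simp add: f_tens lin)
  also have "\<dots> = tensor_lift P f (coact k)"
    unfolding coact_def by (rule linear_sw[OF HQ_module P f_lin, symmetric]) (assumption | rule lin)+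
  also have "\<dots> = f k (\<pi> \<one>\<^bsub>H\<^esub>)"
    using k by (simp add: coinv_iff f_tens lin)
  finally show ?thesis .
qed

text \<open>\<open>h\<^sub>1h'\<^sub>1 \<otimes> \<pi>(h\<^sub>2)\<cdot>h'\<^sub>2 = hh'\<^sub>1 \<otimes> \<pi>(1)\<cdot>h'\<^sub>2 = hh'\<^sub>1 \<otimes> \<pi>(h'\<^sub>2) = hh' \<otimes> \<pi>(1)\<close>.\<close>

lemma coinv_mult: assumes h: "h \<in> coinv" and h': "h' \<in> coinv" shows "h \<bullet> h' \<in> coinv"
proof -
  note [lin] = coinv_closed[OF h] coinv_closed[OF h']
  let ?t = "tens R H Q"
  let ?F = "\<lambda>a q. sw HQ (\<lambda>c d. ?t (a \<bullet> c) (act q d)) h'"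
  have "coact (h \<bullet> h') = sw HQ (\<lambda>a b. sw HQ (\<lambda>c d. ?t (a \<bullet> c) (\<pi> (b \<bullet> d))) h') h"
    unfolding coact_def by (rule sw_mult) (assumption | rule lin)+
  also have "\<dots> = sw HQ (\<lambda>a b. ?F a (\<pi> b)) h"
    by (rule sw_cong, (assumption | rule lin)+, rule sw_cong, (assumption | rule lin)+, simp add: act_pi)
  also have "\<dots> = ?F h (\<pi> \<one>\<^bsub>H\<^esub>)"
    by (rule sw_coinv[where f = ?F, OF HQ_module _ h]) (assumption | rule lin)+
  also have "\<dots> = sw HQ (\<lambda>c d. ?t (h \<bullet> c) (\<pi> d)) h'"
    by (rule sw_cong) ((assumption | rule lin)+, simp add: act_pi lin)
  also have "\<dots> = ?t (h \<bullet> h') (\<pi> \<one>\<^bsub>H\<^esub>)"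
    by (rule sw_coinv[where f = "\<lambda>a q. ?t (h \<bullet> a) q", OF HQ_module _ h']) (assumption | rule lin)+
  finally show ?thesis unfolding coinv_iff by (simp add: lin)
qed

lemma one_coinv: "\<one>\<^bsub>H\<^esub> \<in> coinv"
proof -
  have "coact \<one>\<^bsub>H\<^esub> = tens R H Q \<one>\<^bsub>H\<^esub> (\<pi> \<one>\<^bsub>H\<^esub>)"
    unfolding coact_def by (rule sw_one) (assumption | rule lin)+
  then show ?thesis by (simp add: coinv_iff)
qed

lemma coinv_subring: "subring coinv H"
  using submoduleE[OF coinv_submodule] one_coinv coinv_mult
  by (intro H.subringI) auto

definition "KM = H\<lparr>carrier := coinv\<rparr>"

lemma carrier_KM: "carrier KM = coinv"
  by (simp add: KM_def)

lemma KM_module [lin]: "module R KM"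
  unfolding KM_def by (rule submodule.submodule_is_module[OF coinv_submodule H_module])

lemma KM_incl: "linear_map R KM H (\<lambda>x. x)"
  by (auto simp: linear_map_def KM_def coinv_closed)

text \<open>By \<open>flat_exact\<close> it suffices that \<open>id \<otimes> defect\<close> kills \<open>\<Delta>(k)\<close>. By coassociativity
  \<open>k\<^sub>1 \<otimes> k\<^sub>2 \<otimes> \<pi>(k\<^sub>3)\<close> is the image of \<open>k\<^sub>1 \<otimes> \<pi>(k\<^sub>2) = k \<otimes> \<pi>(1)\<close> under \<open>\<Delta> \<otimes> id\<close>, hence equal to
  \<open>k\<^sub>1 \<otimes> k\<^sub>2 \<otimes> \<pi>(1)\<close>.\<close>

lemma coinv_coideal:
  fixes e :: "('h, 'h set) tens \<Rightarrow> 'u"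
  assumes flat: "flat TYPE('u) R H" and e: "inj e" and k: "k \<in> coinv"
  shows "\<Delta> k \<in> tensor_id_map R H H (\<lambda>x. x) ` carrier (tensor R H KM)"
proof (rule flat_exact[OF flat e H_module H_module HQ_module KM_module linear_defect _ KM_incl])
  show "carrier KM = {x \<in> carrier H. defect x = \<zero>\<^bsub>HQ\<^esub>}" unfolding carrier_KM by (rule coinv_kernel)
  note [lin] = coinv_closed[OF k] HQ_module linear_defect linear_map_closed[OF linear_defect]
  show "\<Delta> k \<in> carrier HH" by (rule lin)+
  let ?W = "tensor R H HQ" and ?t = "tens R H HQ" and ?s = "tens R H Q"
  have W: "module R ?W" by (rule lin)+
  interpret W: module R ?W by (rule W)
  have "sw ?W (\<lambda>a b. ?t a (coact b)) k = sw ?W (\<lambda>a b. sw ?W (\<lambda>c d. ?t a (?s c (\<pi> d))) b) k"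
    unfolding coact_def
    by (rule sw_cong) ((assumption | rule lin)+, rule linear_sw, (assumption | rule lin)+)
  also have "\<dots> = sw ?W (\<lambda>a b. sw ?W (\<lambda>c d. ?t c (?s d (\<pi> b))) a) k"
    by (rule sw_coassoc) (assumption | rule lin)+
  also have "\<dots> = sw ?W (\<lambda>a b. ?t a (?s b (\<pi> \<one>\<^bsub>H\<^esub>))) k"
    by (rule sw_coinv[where f = "\<lambda>a q. sw ?W (\<lambda>c d. ?t c (?s d q)) a", OF W _ k]) (assumption | rule lin)+
  finally have eq: "sw ?W (\<lambda>a b. ?t a (coact b)) k = sw ?W (\<lambda>a b. ?t a (?s b (\<pi> \<one>\<^bsub>H\<^esub>))) k" .
  have l: "linear_map R HH ?W (tensor_lift ?W (\<lambda>a b. ?t a (defect b)))"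
    "linear_map R HH ?W (tensor_lift ?W (\<lambda>a b. ?t a (coact b)))"
    "linear_map R HH ?W (tensor_lift ?W (\<lambda>a b. ?t a (?s b (\<pi> \<one>\<^bsub>H\<^esub>))))"
    by (rule tensor_id_map_linear; (assumption | rule lin)+)+
  have "tensor_id_map R H HQ defect (\<Delta> k) =
      sw ?W (\<lambda>a b. ?t a (coact b)) k \<ominus>\<^bsub>?W\<^esub> sw ?W (\<lambda>a b. ?t a (?s b (\<pi> \<one>\<^bsub>H\<^esub>))) k"
  proof (rule tensor_ext[OF H_module H_module l(1) linear_map_diffI[OF HH_module W l(2,3)] _ comult_closed])
    fix a b assume [lin]: "a \<in> carrier H" "b \<in> carrier H"
    have "?t a (defect b) = ?t a (coact b) \<ominus>\<^bsub>?W\<^esub> ?t a (?s b (\<pi> \<one>\<^bsub>H\<^esub>))"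
      unfolding defect_def
      by (rule linear_map_diff[OF HQ_module W linear_tens_right[OF H_module HQ_module _ linear_map_id]]) (rule lin)+
    then show "tensor_id_map R H HQ defect (tens R H H a b) =
      tensor_lift ?W (\<lambda>a b. ?t a (coact b)) (tens R H H a b) \<ominus>\<^bsub>?W\<^esub>
      tensor_lift ?W (\<lambda>a b. ?t a (?s b (\<pi> \<one>\<^bsub>H\<^esub>))) (tens R H H a b)"
      by (subst (1 2 3) tensor_id_map_tens) (assumption | rule lin)+
  qed (rule lin)
  also have "\<dots> = \<zero>\<^bsub>?W\<^esub>"
    unfolding eq by (subst W.diff_eq_zero_iff) (assumption | rule lin refl)+
  finally show "tensor_id_map R H HQ defect (\<Delta> k) = \<zero>\<^bsub>?W\<^esub>" .
qed

end


section \<open>The cotensor product\<close>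

context right_ideal_quotient
begin

abbreviation "QH \<equiv> tensor R Q H"
abbreviation "HQH \<equiv> tensor R H QH"
abbreviation "tns3 x q y \<equiv> tens R H QH x (tens R Q H q y)"

text \<open>\<open>coactL\<close> and \<open>coactR\<close> are the two maps whose equaliser is the cotensor product. The shear
  carries them, up to the isomorphism \<open>twist\<close>, to \<open>coactL\<close> and \<open>trivL\<close>.\<close>

definition "coactL = tensor_lift HQH (\<lambda>h h'. sw HQH (\<lambda>a b. tns3 a (\<pi> b) h') h)"
definition "coactR = tensor_lift HQH (\<lambda>h h'. sw HQH (\<lambda>a b. tns3 h (\<pi> a) b) h')"
definition "trivL = tensor_lift HQH (\<lambda>h h'. tns3 h (\<pi> \<one>\<^bsub>H\<^esub>) h')"

lemma HQH_module: "module R HQH"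
  by (rule lin)+

lemma coact_bilinear:
  "bilinear_map R H H HQH (\<lambda>h h'. sw HQH (\<lambda>a b. tns3 a (\<pi> b) h') h)"
  "bilinear_map R H H HQH (\<lambda>h h'. sw HQH (\<lambda>a b. tns3 h (\<pi> a) b) h')"
  "bilinear_map R H H HQH (\<lambda>h h'. tns3 h (\<pi> \<one>\<^bsub>H\<^esub>) h')"
  by (assumption | rule lin)+

lemmas coactL_linear = lift_linear[OF H_module H_module HQH_module coact_bilinear(1), folded coactL_def]
lemmas coactR_linear = lift_linear[OF H_module H_module HQH_module coact_bilinear(2), folded coactR_def]
lemmas trivL_linear = lift_linear[OF H_module H_module HQH_module coact_bilinear(3), folded trivL_def]
lemmas coactL_tens = lift_tens[OF H_module H_module HQH_module coact_bilinear(1), folded coactL_def]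
lemmas coactR_tens = lift_tens[OF H_module H_module HQH_module coact_bilinear(2), folded coactR_def]
lemmas trivL_tens = lift_tens[OF H_module H_module HQH_module coact_bilinear(3), folded trivL_def]

lemma cotensor_eq: "cotensor R H \<Delta> Q = {A \<in> carrier HH. coactL A = coactR A}"
  by (simp add: cotensor_def Let_def proj_eq coactL_def coactR_def)

text \<open>\<open>x \<otimes> q \<otimes> y \<mapsto> xy\<^sub>1 \<otimes> q\<cdot>y\<^sub>2 \<otimes> y\<^sub>3\<close> and its inverse \<open>x \<otimes> q \<otimes> y \<mapsto> xS(y\<^sub>2) \<otimes> q\<cdot>S(y\<^sub>1) \<otimes> y\<^sub>3\<close>.\<close>

definition "twist = tensor_lift3 HQH (\<lambda>x q y. sw HQH (\<lambda>a b. sw HQH (\<lambda>c d. tns3 (x \<bullet> a) (act q c) d) b) y)"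
definition "untwist = tensor_lift3 HQH (\<lambda>x q y. sw HQH (\<lambda>a b. sw HQH (\<lambda>c d.
  tns3 (x \<bullet> S c) (act q (S a)) d) b) y)"

lemma twist_trilinear:
  "trilinear_map R H Q H HQH (\<lambda>x q y. sw HQH (\<lambda>a b. sw HQH (\<lambda>c d. tns3 (x \<bullet> a) (act q c) d) b) y)"
  "trilinear_map R H Q H HQH (\<lambda>x q y. sw HQH (\<lambda>a b. sw HQH (\<lambda>c d.
    tns3 (x \<bullet> S c) (act q (S a)) d) b) y)"
  by (assumption | rule lin)+

lemmas twist_linear = tensor_lift3_linear[OF H_module Q_module H_module HQH_module twist_trilinear(1), folded twist_def]
lemmas untwist_linear = tensor_lift3_linear[OF H_module Q_module H_module HQH_module twist_trilinear(2), folded untwist_def]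
lemmas twist_tens = tensor_lift3_tens(2)[OF H_module Q_module H_module HQH_module twist_trilinear(1), folded twist_def]
lemmas untwist_tens = tensor_lift3_tens(2)[OF H_module Q_module H_module HQH_module twist_trilinear(2), folded untwist_def]

text \<open>\<open>xy\<^sub>1S(y\<^sub>4) \<otimes> q\<cdot>y\<^sub>2S(y\<^sub>3) \<otimes> y\<^sub>5 = xy\<^sub>1S(y\<^sub>2) \<otimes> q \<otimes> y\<^sub>3 = x \<otimes> q \<otimes> y\<close>.\<close>

lemma untwist_twist: assumes "B \<in> carrier HQH" shows "untwist (twist B) = B"
proof (rule tensor3_ext[OF H_module Q_module H_module HQH_module
      linear_map_comp[OF untwist_linear twist_linear] linear_map_id _ assms])
  note [lin] = linear_map_comp[OF untwist_linear]
  fix x q y assume [lin]: "x \<in> carrier H" "q \<in> carrier Q" "y \<in> carrier H"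
  have "untwist (twist (tns3 x q y)) = untwist (sw HQH (\<lambda>a b. sw HQH (\<lambda>c d. tns3 (x \<bullet> a) (act q c) d) b) y)"
    by (simp add: twist_tens lin)
  also have "\<dots> = sw HQH (\<lambda>a b. untwist (sw HQH (\<lambda>c d. tns3 (x \<bullet> a) (act q c) d) b)) y"
    by (rule linear_sw[OF HQH_module HQH_module untwist_linear]) (assumption | rule lin)+
  also have "\<dots> = sw HQH (\<lambda>a b. sw HQH (\<lambda>c d. untwist (tns3 (x \<bullet> a) (act q c) d)) b) y"
    by (rule sw_cong) ((assumption | rule lin)+,
        rule linear_sw[OF HQH_module HQH_module untwist_linear], (assumption | rule lin)+)
  also have "\<dots> = sw HQH (\<lambda>a b. sw HQH (\<lambda>c d. sw HQH (\<lambda>e f. sw HQH (\<lambda>g h.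
      tns3 (x \<bullet> a \<bullet> S g) (act q (c \<bullet> S e)) h) f) d) b) y"
    by (rule sw_cong, (assumption | rule lin)+, rule sw_cong, (assumption | rule lin)+,
        rule trans[OF untwist_tens], (assumption | rule lin)+, rule sw_cong, (assumption | rule lin)+,
        rule sw_cong, (assumption | rule lin)+, simp add: act_act lin)
  also have "\<dots> = sw HQH (\<lambda>a b. sw HQH (\<lambda>g h. tns3 (x \<bullet> a \<bullet> S g) (act q \<one>\<^bsub>H\<^esub>) h) b) y"
    by (rule sw_cong, (assumption | rule lin)+,
        rule sw_cancel_right[where t = "\<lambda>u f. sw HQH (\<lambda>g h. tns3 (x \<bullet> _ \<bullet> S g) (act q u) h) f"],
        (assumption | rule lin)+)
  also have "\<dots> = sw HQH (\<lambda>a b. sw HQH (\<lambda>g h. tns3 (x \<bullet> (a \<bullet> S g)) q h) b) y"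
    by (rule sw_cong, (assumption | rule lin)+, rule sw_cong, (assumption | rule lin)+,
        simp add: act_one H.m_assoc lin)
  also have "\<dots> = tns3 (x \<bullet> \<one>\<^bsub>H\<^esub>) q y"
    by (rule sw_cancel_right[where t = "\<lambda>u h. tns3 (x \<bullet> u) q h"]) (assumption | rule lin)+
  finally show "untwist (twist (tns3 x q y)) = tns3 x q y" by (simp add: lin)
qed

text \<open>Both sides send \<open>h \<otimes> x\<close> to \<open>h\<^sub>1x\<^sub>1 \<otimes> \<pi>(h\<^sub>2x\<^sub>2) \<otimes> x\<^sub>3\<close>.\<close>

lemma coactL_shear: assumes "A \<in> carrier HH" shows "coactL (shear A) = twist (coactL A)"
proof (rule tensor_ext[OF H_module H_module linear_map_comp[OF coactL_linear shear_linear]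
      linear_map_comp[OF twist_linear coactL_linear] _ assms])
  note [lin] = linear_map_comp[OF coactL_linear] linear_map_comp[OF twist_linear]
  fix h x assume [lin]: "h \<in> carrier H" "x \<in> carrier H"
  have "coactL (shear (tens R H H h x)) = coactL (sw HH (\<lambda>a b. tens R H H (h \<bullet> a) b) x)"
    by (simp add: shear_tens lin)
  also have "\<dots> = sw HQH (\<lambda>a b. coactL (tens R H H (h \<bullet> a) b)) x"
    by (rule linear_sw[OF HH_module HQH_module coactL_linear]) (assumption | rule lin)+
  also have "\<dots> = sw HQH (\<lambda>a b. sw HQH (\<lambda>p q. sw HQH (\<lambda>c d. tns3 (p \<bullet> c) (\<pi> (q \<bullet> d)) b) a) h) x"
    by (rule sw_cong, (assumption | rule lin)+, rule trans[OF coactL_tens], (assumption | rule lin)+,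
        rule sw_mult, (assumption | rule lin)+)
  also have "\<dots> = sw HQH (\<lambda>p q. sw HQH (\<lambda>a b. sw HQH (\<lambda>c d. tns3 (p \<bullet> c) (\<pi> (q \<bullet> d)) b) a) x) h"
    by (rule sw_swap) (assumption | rule lin)+
  also have "\<dots> = sw HQH (\<lambda>p q. sw HQH (\<lambda>a b. sw HQH (\<lambda>c d. tns3 (p \<bullet> a) (\<pi> (q \<bullet> c)) d) b) x) h"
    by (rule sw_cong, (assumption | rule lin)+, rule sw_coassoc[symmetric], (assumption | rule lin)+)
  also have "\<dots> = sw HQH (\<lambda>p q. twist (tns3 p (\<pi> q) x)) h"
    by (rule sw_cong, (assumption | rule lin)+, rule trans[OF _ twist_tens[symmetric]],
        rule sw_cong, (assumption | rule lin)+, rule sw_cong, (assumption | rule lin)+,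
        simp add: act_pi, (assumption | rule lin)+)
  also have "\<dots> = twist (sw HQH (\<lambda>p q. tns3 p (\<pi> q) x) h)"
    by (rule linear_sw[OF HQH_module HQH_module twist_linear, symmetric]) (assumption | rule lin)+
  also have "\<dots> = twist (coactL (tens R H H h x))"
    by (simp add: coactL_tens lin)
  finally show "coactL (shear (tens R H H h x)) = twist (coactL (tens R H H h x))" .
qed

text \<open>Both sides send \<open>h \<otimes> x\<close> to \<open>hx\<^sub>1 \<otimes> \<pi>(x\<^sub>2) \<otimes> x\<^sub>3\<close>.\<close>

lemma coactR_shear: assumes "A \<in> carrier HH" shows "coactR (shear A) = twist (trivL A)"
proof (rule tensor_ext[OF H_module H_module linear_map_comp[OF coactR_linear shear_linear]
      linear_map_comp[OF twist_linear trivL_linear] _ assms])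
  note [lin] = linear_map_comp[OF coactR_linear]
  fix h x assume [lin]: "h \<in> carrier H" "x \<in> carrier H"
  have "coactR (shear (tens R H H h x)) = coactR (sw HH (\<lambda>a b. tens R H H (h \<bullet> a) b) x)"
    by (simp add: shear_tens lin)
  also have "\<dots> = sw HQH (\<lambda>a b. coactR (tens R H H (h \<bullet> a) b)) x"
    by (rule linear_sw[OF HH_module HQH_module coactR_linear]) (assumption | rule lin)+
  also have "\<dots> = sw HQH (\<lambda>a b. sw HQH (\<lambda>c d. tns3 (h \<bullet> a) (act (\<pi> \<one>\<^bsub>H\<^esub>) c) d) b) x"
    by (rule sw_cong, (assumption | rule lin)+, rule trans[OF coactR_tens], (assumption | rule lin)+,
        rule sw_cong, (assumption | rule lin)+, simp add: act_pi)
  also have "\<dots> = twist (trivL (tens R H H h x))"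
    by (simp add: trivL_tens twist_tens lin)
  finally show "coactR (shear (tens R H H h x)) = twist (trivL (tens R H H h x))" .
qed

lemma shear_mem_cotensor_iff:
  assumes "A \<in> carrier HH" shows "shear A \<in> cotensor R H \<Delta> Q \<longleftrightarrow> coactL A = trivL A"
proof -
  have c: "coactL A \<in> carrier HQH" "trivL A \<in> carrier HQH"
    using linear_map_closed[OF coactL_linear assms] linear_map_closed[OF trivL_linear assms] .
  have "shear A \<in> cotensor R H \<Delta> Q \<longleftrightarrow> twist (coactL A) = twist (trivL A)"
    using linear_map_closed[OF shear_linear assms]
    by (simp add: cotensor_eq coactL_shear coactR_shear assms)
  also have "\<dots> \<longleftrightarrow> coactL A = trivL A"
    using untwist_twist[OF c(1)] untwist_twist[OF c(2)] by metis
  finally show ?thesis .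
qed

end

context hopf_algebra
begin

text \<open>The map \<open>K \<otimes> H \<rightarrow> H \<otimes> H\<close> induced by the inclusion of a submodule \<open>K\<close>.\<close>

definition "incl_left = tensor_lift HH (\<lambda>k h. tens R H H k h)"

context
  fixes K :: "('a, 'c, 'w) module_scheme"
  assumes K: "module R K" and incl: "linear_map R K H (\<lambda>x. x)"
begin

lemma bilinear_shear_incl: "bilinear_map R K H HH (\<lambda>k h. sw HH (\<lambda>a b. tens R H H (k \<bullet> a) b) h)"
  by (rule bilinear_mapI, rule linear_map_comp[OF bilinear_map_left[OF bilinear_shear(1)] incl])
    (assumption | rule bilinear_map_right[OF bilinear_shear(1)] linear_map_closed[OF incl])+

lemma incl_left_linear: "linear_map R (tensor R K H) HH incl_left"
  unfolding incl_left_def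
  by (rule lift_linear[OF K H_module HH_module bilinear_tens_map[OF H_module H_module incl linear_map_id]])

lemma incl_left_tens: "k \<in> carrier K \<Longrightarrow> h \<in> carrier H \<Longrightarrow> incl_left (tens R K H k h) = tens R H H k h"
  unfolding incl_left_def
  by (rule lift_tens[OF K H_module HH_module bilinear_tens_map[OF H_module H_module incl linear_map_id]])

text \<open>Flatness of \<open>H\<close> concerns tensor products with \<open>H\<close> on the left; the flip transfers it to \<open>K \<otimes> H\<close>.\<close>

lemma incl_left_flip:
  assumes "A \<in> carrier (tensor R H K)"
  shows "incl_left (tensor_flip R H K A) = tensor_flip R H H (tensor_id_map R H H (\<lambda>x. x) A)"
proof (rule tensor_ext[OF H_module K _ _ _ assms])
  show "linear_map R (tensor R H K) HH (\<lambda>A. incl_left (tensor_flip R H K A))"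
    by (rule linear_map_comp[OF incl_left_linear tensor_flip_linear[OF H_module K]])
  show "linear_map R (tensor R H K) HH (\<lambda>A. tensor_flip R H H (tensor_id_map R H H (\<lambda>x. x) A))"
    by (rule linear_map_comp[OF tensor_flip_linear[OF H_module H_module] tensor_id_map_linear[OF H_module K H_module incl]])
  fix h k assume hk: "h \<in> carrier H" "k \<in> carrier K"
  then show "incl_left (tensor_flip R H K (tens R H K h k)) =
      tensor_flip R H H (tensor_id_map R H H (\<lambda>x. x) (tens R H K h k))"
    using linear_map_closed[OF incl hk(2)]
    by (simp add: tensor_flip_tens H_module K incl_left_tens tensor_id_map_tens incl)
qed

lemma incl_left_inj:
  fixes e :: "'c \<Rightarrow> 'u"
  assumes flat: "flat TYPE('u) R H" and e: "inj e"
  shows "inj_on incl_left (carrier (tensor R K H))"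
proof (rule inj_onI)
  fix A B assume A: "A \<in> carrier (tensor R K H)" and B: "B \<in> carrier (tensor R K H)"
    and eq: "incl_left A = incl_left B"
  let ?i = "tensor_id_map R H H (\<lambda>x. x)"
  have *: "X = tensor_flip R H K (tensor_flip R K H X)" "tensor_flip R K H X \<in> carrier (tensor R H K)"
    "?i (tensor_flip R K H X) = tensor_flip R H H (incl_left X)"
    if X: "X \<in> carrier (tensor R K H)" for X
  proof -
    show 1: "X = tensor_flip R H K (tensor_flip R K H X)"
      by (rule tensor_flip_flip[OF K H_module X, symmetric])
    show 2: "tensor_flip R K H X \<in> carrier (tensor R H K)"
      by (rule linear_map_closed[OF tensor_flip_linear[OF K H_module] X])
    have "tensor_flip R H H (incl_left X) =
        tensor_flip R H H (tensor_flip R H H (?i (tensor_flip R K H X)))"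
      using incl_left_flip[OF 2] 1 by simp
    then show "?i (tensor_flip R K H X) = tensor_flip R H H (incl_left X)"
      using tensor_flip_flip[OF H_module H_module linear_map_closed[OF tensor_id_map_linear[OF H_module K H_module incl] 2]]
      by simp
  qed
  have "tensor_flip R K H A = tensor_flip R K H B"
    by (rule inj_onD[OF flat_transport[OF flat e H_module K H_module incl] _ *(2)[OF A] *(2)[OF B]])
      (simp_all only: *(3)[OF A] *(3)[OF B] eq inj_on_id2)
  then show "A = B"
    using *(1)[OF A] *(1)[OF B] by metis
qed

end

end

context right_ideal_quotient
begin

lemma coactL_coinv:
  assumes k: "k \<in> coinv" and [lin]: "h \<in> carrier H"
  shows "coactL (tens R H H k h) = trivL (tens R H H k h)"
proof -
  note [lin] = coinv_closed[OF k]
  have "coactL (tens R H H k h) = sw HQH (\<lambda>a b. tns3 a (\<pi> b) h) k"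
    by (rule coactL_tens) (rule lin)+
  also have "\<dots> = tns3 k (\<pi> \<one>\<^bsub>H\<^esub>) h"
    by (rule sw_coinv[where f = "\<lambda>a q. tns3 a q h", OF HQH_module _ k]) (assumption | rule lin)+
  also have "\<dots> = trivL (tens R H H k h)"
    by (simp add: trivL_tens lin)
  finally show ?thesis .
qed

text \<open>After a flip and a reordering \<open>\<kappa>\<close> of the factors, the difference of \<open>coactL\<close> and \<open>trivL\<close> is
  \<open>id \<otimes> defect\<close>, whose kernel \<open>flat_exact\<close> identifies.\<close>

lemma coactL_eq_trivL_iff:
  fixes e :: "('h, 'h set) tens \<Rightarrow> 'u"
  assumes flat: "flat TYPE('u) R H" and e: "inj e" and A: "A \<in> carrier HH"
  shows "coactL A = trivL A \<longleftrightarrow> A \<in> incl_left ` carrier (tensor R KM H)"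
proof
  assume "A \<in> incl_left ` carrier (tensor R KM H)"
  then obtain B where B: "B \<in> carrier (tensor R KM H)" "A = incl_left B" by blast
  have "coactL (incl_left B) = trivL (incl_left B)"
  proof (rule tensor_ext[OF KM_module H_module
        linear_map_comp[OF coactL_linear incl_left_linear[OF KM_module KM_incl]]
        linear_map_comp[OF trivL_linear incl_left_linear[OF KM_module KM_incl]] _ B(1)])
    fix k h assume k: "k \<in> carrier KM" and [lin]: "h \<in> carrier H"
    have "k \<in> coinv" using k by (simp add: carrier_KM)
    from coactL_coinv[OF this \<open>h \<in> carrier H\<close>]
    show "coactL (incl_left (tens R KM H k h)) = trivL (incl_left (tens R KM H k h))"
      using k by (simp add: incl_left_tens[OF KM_module KM_incl] lin)
  qed
  then show "coactL A = trivL A" by (simp add: B)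
next
  assume eq: "coactL A = trivL A"
  let ?W = "tensor R H HQ" and ?t = "\<lambda>y x q. tens R H HQ y (tens R H Q x q)"
  have W: "module R ?W" by (rule lin)+
  interpret W: module R ?W by (rule W)
  define \<kappa> where "\<kappa> = tensor_lift3 ?W (\<lambda>x q y. ?t y x q)"
  have tri: "trilinear_map R H Q H ?W (\<lambda>x q y. ?t y x q)" by (assumption | rule lin)+
  note \<kappa>_lin = tensor_lift3_linear[OF H_module Q_module H_module W tri, folded \<kappa>_def]
  note \<kappa>_tens = tensor_lift3_tens(2)[OF H_module Q_module H_module W tri, folded \<kappa>_def]
  note fl = tensor_flip_linear[OF H_module H_module]
  note idl = tensor_id_map_linear[OF H_module H_module HQ_module linear_defect]
  have "tensor_id_map R H HQ defect (tensor_flip R H H A) = \<kappa> (coactL A) \<ominus>\<^bsub>?W\<^esub> \<kappa> (trivL A)"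
  proof (rule tensor_ext[OF H_module H_module linear_map_comp[OF idl fl]
        linear_map_diffI[OF HH_module W linear_map_comp[OF \<kappa>_lin coactL_linear] linear_map_comp[OF \<kappa>_lin trivL_linear]] _ A])
    fix x y assume [lin]: "x \<in> carrier H" "y \<in> carrier H"
    have "tensor_id_map R H HQ defect (tensor_flip R H H (tens R H H x y)) = tens R H HQ y (defect x)"
      by (simp add: tensor_flip_tens tensor_id_map_tens linear_defect lin)
    also have "\<dots> = tens R H HQ y (coact x) \<ominus>\<^bsub>?W\<^esub> ?t y x (\<pi> \<one>\<^bsub>H\<^esub>)"
      unfolding defect_def
      by (rule linear_map_diff[OF HQ_module W linear_tens_right[OF H_module HQ_module _ linear_map_id]]) (rule lin)+
    also have "tens R H HQ y (coact x) = sw ?W (\<lambda>a b. ?t y a (\<pi> b)) x"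
      unfolding coact_def
      by (rule linear_sw[OF HQ_module W linear_tens_right[OF H_module HQ_module _ linear_map_id]]) (assumption | rule lin)+
    also have "\<dots> = sw ?W (\<lambda>a b. \<kappa> (tns3 a (\<pi> b) y)) x"
      by (rule sw_cong) ((assumption | rule lin)+, simp add: \<kappa>_tens lin)
    also have "\<dots> = \<kappa> (coactL (tens R H H x y))"
      by (simp add: coactL_tens lin, rule linear_sw[OF HQH_module W \<kappa>_lin, symmetric]) (assumption | rule lin)+
    also have "?t y x (\<pi> \<one>\<^bsub>H\<^esub>) = \<kappa> (trivL (tens R H H x y))"
      by (simp add: trivL_tens \<kappa>_tens lin)
    finally show "tensor_id_map R H HQ defect (tensor_flip R H H (tens R H H x y)) =
        \<kappa> (coactL (tens R H H x y)) \<ominus>\<^bsub>?W\<^esub> \<kappa> (trivL (tens R H H x y))" .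
  qed
  also have "\<dots> = \<zero>\<^bsub>?W\<^esub>"
    unfolding eq
    by (subst W.diff_eq_zero_iff) (rule refl linear_map_closed[OF \<kappa>_lin] linear_map_closed[OF trivL_linear] A)+
  finally have z: "tensor_id_map R H HQ defect (tensor_flip R H H A) = \<zero>\<^bsub>?W\<^esub>" .
  have "tensor_flip R H H A \<in> tensor_id_map R H H (\<lambda>x. x) ` carrier (tensor R H KM)"
    by (rule flat_exact[OF flat e H_module H_module HQ_module KM_module linear_defect _ KM_incl _ z])
      (simp_all only: carrier_KM coinv_kernel linear_map_closed[OF fl A])
  then obtain B where B: "B \<in> carrier (tensor R H KM)"
    "tensor_flip R H H A = tensor_id_map R H H (\<lambda>x. x) B" by blast
  have "A = tensor_flip R H H (tensor_flip R H H A)"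
    by (rule tensor_flip_flip[OF H_module H_module A, symmetric])
  also have "\<dots> = incl_left (tensor_flip R H KM B)"
    unfolding B(2) by (rule incl_left_flip[OF KM_module KM_incl B(1), symmetric])
  finally show "A \<in> incl_left ` carrier (tensor R KM H)"
    using linear_map_closed[OF tensor_flip_linear[OF H_module KM_module] B(1)] by (rule image_eqI)
qed

text \<open>The coextension map is the inclusion of \<open>C \<otimes> H\<close> into \<open>H \<otimes> H\<close>, injective by flatness, followed by
  the shear.\<close>

theorem coinv_Galois_coextension:
  fixes e :: "('h, 'h set) tens \<Rightarrow> 'u" and e' :: "'h \<Rightarrow> 'u"
  assumes flat: "flat TYPE('u) R H" and e: "inj e" "inj e'"
  shows "bij_betw (tensor_lift HH (\<lambda>k h. sw HH (\<lambda>a b. tens R H H (k \<bullet> a) b) h))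
    (carrier (tensor R KM H)) (cotensor R H \<Delta> Q)"
proof -
  let ?f = "\<lambda>k h. sw HH (\<lambda>a b. tens R H H (k \<bullet> a) b) h"
  note il = incl_left_linear[OF KM_module KM_incl]
  note f = bilinear_shear_incl[OF KM_module KM_incl]
  have eq: "tensor_lift HH ?f A = shear (incl_left A)" if "A \<in> carrier (tensor R KM H)" for A
    by (rule tensor_ext[OF KM_module H_module lift_linear[OF KM_module H_module HH_module f]
          linear_map_comp[OF shear_linear il] _ that])
      (simp add: lift_tens[OF KM_module H_module HH_module f] incl_left_tens[OF KM_module KM_incl]
        shear_tens carrier_KM coinv_closed)
  have sh: "inj_on shear (carrier HH)"
    by (rule inj_on_inverseI[where g = unshear]) (rule unshear_shear)
  have "bij_betw (\<lambda>A. shear (incl_left A)) (carrier (tensor R KM H)) (cotensor R H \<Delta> Q)"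
  proof (rule bij_betw_imageI)
    show "inj_on (\<lambda>A. shear (incl_left A)) (carrier (tensor R KM H))"
      using comp_inj_on[OF incl_left_inj[OF KM_module KM_incl flat e(2)] inj_on_subset[OF sh], unfolded comp_def]
        linear_map_closed[OF il] by blast
    show "(\<lambda>A. shear (incl_left A)) ` carrier (tensor R KM H) = cotensor R H \<Delta> Q"
    proof (intro equalityI subsetI)
      fix C assume "C \<in> (\<lambda>A. shear (incl_left A)) ` carrier (tensor R KM H)"
      then obtain A where A: "A \<in> carrier (tensor R KM H)" "C = shear (incl_left A)" by blast
      have "coactL (incl_left A) = trivL (incl_left A)"
        using coactL_eq_trivL_iff[OF flat e(1) linear_map_closed[OF il A(1)]] A(1) by blast
      then show "C \<in> cotensor R H \<Delta> Q"
        unfolding A(2) using shear_mem_cotensor_iff[OF linear_map_closed[OF il A(1)]] by simp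
    next
      fix C assume C: "C \<in> cotensor R H \<Delta> Q"
      then have CH: "C \<in> carrier HH" by (simp add: cotensor_eq)
      have u: "unshear C \<in> carrier HH" by (rule linear_map_closed[OF unshear_linear CH])
      have "coactL (unshear C) = trivL (unshear C)"
        using shear_mem_cotensor_iff[OF u] C shear_unshear[OF CH] by simp
      then obtain A where A: "A \<in> carrier (tensor R KM H)" "unshear C = incl_left A"
        using coactL_eq_trivL_iff[OF flat e(1) u] by blast
      show "C \<in> (\<lambda>A. shear (incl_left A)) ` carrier (tensor R KM H)"
        by (rule image_eqI[OF _ A(1)]) (simp add: shear_unshear[OF CH] flip: A(2))
    qed
  qed
  then show ?thesis using bij_betw_cong[of "carrier (tensor R KM H)", OF eq] by simp
qed

end


section \<open>Tensor products over a subalgebra\<close>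

context hopf_algebra
begin

context
  fixes U assumes U: "U \<subseteq> carrier H" "\<forall>r\<in>carrier R. r \<odot>\<^bsub>H\<^esub> \<one>\<^bsub>H\<^esub> \<in> U"
begin

lemma balanced_pair_mult: "balanced_pair R H H U (monoid.mult H) (monoid.mult H)"
proof -
  interpret H': abelian_group H by (rule module_group[OF H_module])
  show ?thesis
    by unfold_locales (use U(1) in \<open>auto simp: smult_mult_left\<close>)
qed

interpretation B: balanced_pair R H H U "monoid.mult H" "monoid.mult H"
  by (rule balanced_pair_mult)

abbreviation "HSH \<equiv> tensor_over U (monoid.mult H) (monoid.mult H) H H"
abbreviation "tns \<equiv> tens_over U (monoid.mult H) (monoid.mult H) H H"

lemma HSH_module: "module R HSH"
  using B.T_module by (simp only: B.T_def)

lemma tns_balanced: "a \<in> carrier H \<Longrightarrow> k \<in> U \<Longrightarrow> b \<in> carrier H \<Longrightarrow> tns (a \<bullet> k) b = tns a (k \<bullet> b)"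
  by (rule B.tens_balanced)

text \<open>Scalars pass to the right factor as the elements \<open>r1\<close> of \<open>U\<close>.\<close>

lemma tns_bilinear: "bilinear_map R H H HSH tns"
  unfolding B.T_def[symmetric]
proof (rule bilinear_mapI; rule linear_mapI)
  fix r a b assume r: "r \<in> carrier R" and ab: "a \<in> carrier H" "b \<in> carrier H"
  have "tns a (r \<odot>\<^bsub>H\<^esub> b) = tns a ((r \<odot>\<^bsub>H\<^esub> \<one>\<^bsub>H\<^esub>) \<bullet> b)"
    using r ab by (simp add: smult_mult_left)
  also have "\<dots> = tns (a \<bullet> (r \<odot>\<^bsub>H\<^esub> \<one>\<^bsub>H\<^esub>)) b"
    using r ab U(2) by (simp add: B.tens_balanced)
  also have "\<dots> = r \<odot>\<^bsub>B.T\<^esub> tns a b"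
    using r ab by (simp add: smult_mult_right B.tens_smult_left)
  finally show "tns a (r \<odot>\<^bsub>H\<^esub> b) = r \<odot>\<^bsub>B.T\<^esub> tns a b" .
qed (auto simp: B.tens_closed B.tens_add_left B.tens_add_right B.tens_smult_left)

lemma HSH_lift:
  assumes "module R P" "bilinear_map R H H P f"
    and "\<And>a k b. a \<in> carrier H \<Longrightarrow> k \<in> U \<Longrightarrow> b \<in> carrier H \<Longrightarrow> f (a \<bullet> k) b = f a (k \<bullet> b)"
  shows "linear_map R HSH P (tensor_lift P f)"
    and "a \<in> carrier H \<Longrightarrow> b \<in> carrier H \<Longrightarrow> tensor_lift P f (tns a b) = f a b"
proof -
  have "B.balanced_map P f"
    unfolding B.balanced_map_def using assms(2,3) by (auto simp: bilinear_map_def linear_map_def)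
  from B.lift_linear[OF assms(1) this] B.lift_tens[OF assms(1) this]
  show "linear_map R HSH P (tensor_lift P f)"
    "a \<in> carrier H \<Longrightarrow> b \<in> carrier H \<Longrightarrow> tensor_lift P f (tns a b) = f a b"
    by (simp_all only: B.T_def)
qed

lemma HSH_ext:
  assumes "linear_map R HSH P g" "linear_map R HSH P g'"
    and "\<And>a b. a \<in> carrier H \<Longrightarrow> b \<in> carrier H \<Longrightarrow> g (tns a b) = g' (tns a b)" and "A \<in> carrier HSH"
  shows "g A = g' A"
  using B.linear_map_ext[unfolded B.T_def, OF assms] .

end

lemma smult_zero: "module R P \<Longrightarrow> x \<in> carrier P \<Longrightarrow> \<zero>\<^bsub>R\<^esub> \<odot>\<^bsub>P\<^esub> x = \<zero>\<^bsub>P\<^esub>"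
  by (rule module.smult_l_null)

end

context right_ideal_quotient
begin

lemma coinv_scalars: "coinv \<subseteq> carrier H" "\<forall>r\<in>carrier R. r \<odot>\<^bsub>H\<^esub> \<one>\<^bsub>H\<^esub> \<in> coinv"
  using coinv_closed submoduleE(4)[OF coinv_submodule] one_coinv by auto

definition "can h x = sw HQ (\<lambda>a b. tens R H Q (h \<bullet> a) (\<pi> b)) x"

lemma can_bilinear: "bilinear_map R H H HQ can"
  unfolding can_def by (assumption | rule lin)+

text \<open>\<open>h(kx)\<^sub>1 \<otimes> \<pi>((kx)\<^sub>2) = hk\<^sub>1x\<^sub>1 \<otimes> \<pi>(k\<^sub>2)\<cdot>x\<^sub>2\<close> depends on \<open>k\<close> only through \<open>k\<^sub>1 \<otimes> \<pi>(k\<^sub>2) = k \<otimes> \<pi>(1)\<close>.\<close>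

lemma can_balanced:
  assumes [lin]: "h \<in> carrier H" and k: "k \<in> coinv" and [lin]: "x \<in> carrier H"
  shows "can (h \<bullet> k) x = can h (k \<bullet> x)"
proof -
  note [lin] = coinv_closed[OF k]
  let ?t = "tens R H Q"
  let ?F = "\<lambda>a q. sw HQ (\<lambda>c d. ?t (h \<bullet> (a \<bullet> c)) (act q d)) x"
  have "can h (k \<bullet> x) = sw HQ (\<lambda>a b. sw HQ (\<lambda>c d. ?t (h \<bullet> (a \<bullet> c)) (\<pi> (b \<bullet> d))) x) k"
    unfolding can_def by (rule sw_mult) (assumption | rule lin)+
  also have "\<dots> = sw HQ (\<lambda>a b. ?F a (\<pi> b)) k"
    by (rule sw_cong, (assumption | rule lin)+, rule sw_cong, (assumption | rule lin)+, simp add: act_pi)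
  also have "\<dots> = ?F k (\<pi> \<one>\<^bsub>H\<^esub>)"
    by (rule sw_coinv[where f = ?F, OF HQ_module _ k]) (assumption | rule lin)+
  also have "\<dots> = can (h \<bullet> k) x"
    unfolding can_def by (rule sw_cong) ((assumption | rule lin)+, simp add: act_pi H.m_assoc lin)
  finally show ?thesis by simp
qed

text \<open>The element \<open>hS(x\<^sub>1) \<otimes> x\<^sub>2\<close> is the preimage of \<open>h \<otimes> \<pi>(x)\<close> under the Galois map.\<close>

lemma can_antipode:
  assumes [lin]: "h \<in> carrier H" "x \<in> carrier H"
  shows "sw HQ (\<lambda>a b. can (h \<bullet> S a) b) x = tens R H Q h (\<pi> x)"
proof -
  note [lin] = linear_map_comp[OF bilinear_map_left[OF can_bilinear]]
    linear_map_comp[OF bilinear_map_right[OF can_bilinear]]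
  have "sw HQ (\<lambda>a b. can (h \<bullet> S a) b) x =
      sw HQ (\<lambda>a b. sw HQ (\<lambda>c d. tens R H Q (h \<bullet> (S a \<bullet> c)) (\<pi> d)) b) x"
    by (rule sw_cong, (assumption | rule lin)+, unfold can_def, rule sw_cong, (assumption | rule lin)+,
        simp add: H.m_assoc lin)
  also have "\<dots> = tens R H Q (h \<bullet> \<one>\<^bsub>H\<^esub>) (\<pi> x)"
    by (rule sw_cancel_left[where t = "\<lambda>u d. tens R H Q (h \<bullet> u) (\<pi> d)"]) (assumption | rule lin)+
  finally show ?thesis by (simp add: lin)
qed

lemma Galois_extension_iff:
  "Galois_extension R H \<Delta> Q \<longleftrightarrow> bij_betw (tensor_lift HQ can) (carrier (HSH coinv)) (carrier HQ)"
proof -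
  have "can = (\<lambda>h x. sw HQ (\<lambda>a b. tens R H Q (h \<bullet> a) (\<pi> b)) x)"
    by (intro ext) (rule can_def)
  then show ?thesis by (simp only: Galois_extension_def proj_eq)
qed

end


section \<open>Left coideal subalgebras\<close>

locale coideal_subalgebra = hopf_algebra R H \<Delta> \<epsilon> antipode
  for R :: "('r, 'x) ring_scheme" (structure) and H :: "('r, 'h, 'y) module_scheme" (structure)
    and \<Delta> and \<epsilon> and antipode +
  fixes K
  assumes K_Sub: "K \<in> Sub_gen R H \<Delta>"
begin

lemma K_subring: "subring K H" and K_submodule: "submodule K R H"
  using K_Sub by (simp_all add: Sub_gen_def)

lemma K_one: "\<one>\<^bsub>H\<^esub> \<in> K" and K_closed: "k \<in> K \<Longrightarrow> k \<in> carrier H"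
  by (rule subringE(3)[OF K_subring], rule subsetD[OF subringE(1)[OF K_subring]])

lemma K_scalars: "K \<subseteq> carrier H" "\<forall>r\<in>carrier R. r \<odot>\<^bsub>H\<^esub> \<one>\<^bsub>H\<^esub> \<in> K"
  by (rule subringE(1)[OF K_subring]) (rule ballI, rule submoduleE(4)[OF K_submodule _ K_one])

definition "KK = H\<lparr>carrier := K\<rparr>"

lemma carrier_KK: "carrier KK = K"
  by (simp add: KK_def)

lemma KK_module: "module R KK"
  unfolding KK_def by (rule submodule.submodule_is_module[OF K_submodule H_module])

lemma KK_incl: "linear_map R KK H (\<lambda>x. x)"
  by (auto simp: linear_map_def KK_def K_closed)

text \<open>As \<open>\<Delta>(k)\<close> comes from \<open>H \<otimes> K\<close>, the second Sweedler component of \<open>k\<close> may be assumed to lie in \<open>K\<close>.\<close>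

lemma sw_cong_K:
  assumes P: "module R P" and f: "bilinear_map R H H P f" and g: "bilinear_map R H H P g"
    and k: "k \<in> K" and eq: "\<And>a b. a \<in> carrier H \<Longrightarrow> b \<in> K \<Longrightarrow> f a b = g a b"
  shows "sw P f k = sw P g k"
proof -
  have "\<Delta> ` K \<subseteq> tensor_id_map R H H (\<lambda>x. x) ` carrier (tensor R H KK)"
    using K_Sub unfolding Sub_gen_def KK_def by (elim CollectE conjE)
  from subsetD[OF this imageI[OF k]]
  obtain A where A: "A \<in> carrier (tensor R H KK)" "\<Delta> k = tensor_id_map R H H (\<lambda>x. x) A"
    by (elim imageE)
  have *: "sw P f k = tensor_lift P f A" "bilinear_map R H KK P f" if f: "bilinear_map R H H P f" for f
  proof -
    show bil: "bilinear_map R H KK P f"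
      using f KK_incl K_closed by (auto simp: bilinear_map_def linear_map_def KK_def)
    have "sw P f k = tensor_lift P (\<lambda>a b. tensor_lift P f (tens R H H a b)) A"
      unfolding A(2)
      by (rule linear_lift[OF H_module KK_module HH_module P lift_linear[OF H_module H_module P f]
            bilinear_tens_map[OF H_module H_module linear_map_id KK_incl] A(1)])
    also have "\<dots> = tensor_lift P f A"
      by (rule lift_cong[OF H_module KK_module P bil A(1), symmetric])
        (simp add: lift_tens[OF H_module H_module P f] carrier_KK K_closed)
    finally show "sw P f k = tensor_lift P f A" .
  qed
  have "tensor_lift P f A = tensor_lift P g A"
    by (rule lift_cong[OF H_module KK_module P *(2)[OF f] A(1)]) (simp add: carrier_KK eq)
  then show ?thesis using *(1)[OF f] *(1)[OF g] by simp
qed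

lemma sw_K_counit:
  assumes P: "module R P" and f: "bilinear_map R H H P f" and g: "linear_map R H P g"
    and k: "k \<in> K" and eq: "\<And>a b. a \<in> carrier H \<Longrightarrow> b \<in> K \<Longrightarrow> f a b = \<epsilon> b \<odot>\<^bsub>P\<^esub> g a"
  shows "sw P f k = g k"
proof -
  note [lin] = P linear_map_comp[OF g] linear_map_closed[OF g]
  have "sw P f k = sw P (\<lambda>a b. \<epsilon> b \<odot>\<^bsub>P\<^esub> g a) k"
    by (rule sw_cong_K[OF P f _ k eq]) (assumption | rule lin)+
  also have "\<dots> = g k"
    by (rule sw_counit_right[OF P g K_closed[OF k]])
  finally show ?thesis .
qed

abbreviation "Kplus \<equiv> {k \<in> K. \<epsilon> k = \<zero>\<^bsub>R\<^esub>}"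
abbreviation "KH \<equiv> ideal_prod H Kplus (carrier H)"

lemma KH_carrier: "x \<in> KH \<Longrightarrow> x \<in> carrier H"
  by (induction rule: ideal_prod.induct) (auto simp: K_closed)

lemma counit_zero: "\<epsilon> \<zero>\<^bsub>H\<^esub> = \<zero>\<^bsub>R\<^esub>"
  using linear_map_zero[OF H_module regular_module_module counit_linear] by (simp add: regular_module_def)

lemma KH_submodule: "submodule KH R H"
proof (rule submoduleI)
  show "KH \<subseteq> carrier H" using KH_carrier by blast
  have "\<zero>\<^bsub>H\<^esub> \<in> Kplus" using subringE(2)[OF K_subring] counit_zero by simp
  then have "\<zero>\<^bsub>H\<^esub> \<bullet> \<one>\<^bsub>H\<^esub> \<in> KH" by (rule ideal_prod.prod) simp
  then show "\<zero>\<^bsub>H\<^esub> \<in> KH" by simp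
  show "\<ominus>\<^bsub>H\<^esub> x \<in> KH" if "x \<in> KH" for x
    using that
  proof induction
    case (prod k h)
    then have "\<ominus>\<^bsub>H\<^esub> (k \<bullet> h) = k \<bullet> (\<ominus>\<^bsub>H\<^esub> h)" by (simp add: H.r_minus K_closed)
    then show ?case using prod by (simp only: ideal_prod.prod M.a_inv_closed)
  next
    case (sum a b)
    then show ?case by (simp add: M.minus_add KH_carrier ideal_prod.sum)
  qed
  show "x \<oplus>\<^bsub>H\<^esub> y \<in> KH" if "x \<in> KH" "y \<in> KH" for x y
    using that by (rule ideal_prod.sum)
  show "r \<odot>\<^bsub>H\<^esub> x \<in> KH" if r: "r \<in> carrier R" and x: "x \<in> KH" for r x
    using x
  proof induction
    case (prod k h)
    then have "r \<odot>\<^bsub>H\<^esub> (k \<bullet> h) = k \<bullet> (r \<odot>\<^bsub>H\<^esub> h)" using r by (simp add: smult_mult_right K_closed)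
    then show ?case using prod r by (simp only: ideal_prod.prod smult_closed)
  next
    case (sum a b)
    then show ?case using r by (simp add: smult_r_distr KH_carrier ideal_prod.sum)
  qed
qed

lemma KH_mult: assumes "x \<in> KH" "h \<in> carrier H" shows "x \<bullet> h \<in> KH"
  using assms(1)
proof induction
  case (prod k y)
  then show ?case using assms(2) by (simp add: H.m_assoc K_closed ideal_prod.prod)
next
  case (sum a b)
  then show ?case using assms(2) by (simp add: H.l_distr KH_carrier ideal_prod.sum)
qed

sublocale right_ideal_quotient R H \<Delta> \<epsilon> antipode KH
  by (intro right_ideal_quotient.intro right_ideal_quotient_axioms.intro hopf_algebra_axioms
      KH_submodule KH_mult)

lemma aug_quotient_eq: "aug_quotient R H \<epsilon> K = Q"
  by (simp add: aug_quotient_def)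

text \<open>\<open>k - \<epsilon>(k)1\<close> lies in \<open>K\<^sup>+\<close>.\<close>

lemma pi_K_mult: assumes k: "k \<in> K" and x: "x \<in> carrier H" shows "\<pi> (k \<bullet> x) = \<epsilon> k \<odot>\<^bsub>Q\<^esub> \<pi> x"
proof -
  note kH = K_closed[OF k] and ek = counit_closed[OF K_closed[OF k]]
  let ?k = "k \<ominus>\<^bsub>H\<^esub> \<epsilon> k \<odot>\<^bsub>H\<^esub> \<one>\<^bsub>H\<^esub>"
  have "?k \<in> K"
    using submoduleE(3,5)[OF K_submodule] k bspec[OF K_scalars(2) ek] by (simp add: a_minus_def)
  moreover have "\<epsilon> ?k = \<epsilon> k \<ominus>\<^bsub>regular_module R\<^esub> \<epsilon> (\<epsilon> k \<odot>\<^bsub>H\<^esub> \<one>\<^bsub>H\<^esub>)"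
    using kH ek by (intro linear_map_diff[OF H_module regular_module_module counit_linear]) auto
  moreover interpret RR: module R "regular_module R" by (rule regular_module_module)
  have "\<epsilon> k \<ominus>\<^bsub>regular_module R\<^esub> \<epsilon> (\<epsilon> k \<odot>\<^bsub>H\<^esub> \<one>\<^bsub>H\<^esub>) = \<zero>\<^bsub>regular_module R\<^esub>"
    using kH ek by (subst RR.diff_eq_zero_iff) (auto simp: counit_smult counit_one regular_module_def)
  ultimately have "?k \<in> Kplus" by (simp add: regular_module_def)
  then have "?k \<bullet> x \<in> KH" using x by (rule ideal_prod.prod)
  moreover have "?k \<bullet> x = k \<bullet> x \<ominus>\<^bsub>H\<^esub> \<epsilon> k \<odot>\<^bsub>H\<^esub> x"
    using kH ek x by (simp add: a_minus_def H.l_distr H.l_minus smult_mult_left)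
  ultimately show ?thesis
    using kH ek x by (simp add: smult_Q pi_eq_iff)
qed

lemma K_coinv: "k \<in> K \<Longrightarrow> k \<in> coinv"
proof -
  assume k: "k \<in> K"
  note [lin] = K_closed
  have "coact k = tens R H Q k (\<pi> \<one>\<^bsub>H\<^esub>)"
    unfolding coact_def
  proof (rule sw_K_counit[OF HQ_module _ _ k])
    fix a b assume a: "a \<in> carrier H" and b: "b \<in> K"
    have "\<pi> b = \<epsilon> b \<odot>\<^bsub>Q\<^esub> \<pi> \<one>\<^bsub>H\<^esub>"
      using pi_K_mult[OF b, of "\<one>\<^bsub>H\<^esub>"] K_closed[OF b] by simp
    then show "tens R H Q a (\<pi> b) = \<epsilon> b \<odot>\<^bsub>HQ\<^esub> tens R H Q a (\<pi> \<one>\<^bsub>H\<^esub>)"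
      using linear_map_smult[OF bilinear_map_right[OF tens_bilinear[OF H_module Q_module] a]]
        counit_closed[OF K_closed[OF b]] by (simp add: lin)
  qed (assumption | rule lin)+
  then show "k \<in> coinv" using k by (simp add: coinv_iff K_closed)
qed

abbreviation "QQ \<equiv> tensor R Q Q"

text \<open>For \<open>k \<in> K\<^sup>+\<close>: \<open>\<pi>(k\<^sub>1h\<^sub>1) \<otimes> \<pi>(k\<^sub>2h\<^sub>2) = \<pi>(k\<^sub>1h\<^sub>1) \<otimes> \<epsilon>(k\<^sub>2)\<pi>(h\<^sub>2) = \<pi>(kh\<^sub>1) \<otimes> \<pi>(h\<^sub>2) = 0\<close>.\<close>

lemma comult_KH:
  assumes "x \<in> KH" shows "sw QQ (\<lambda>a b. tens R Q Q (\<pi> a) (\<pi> b)) x = \<zero>\<^bsub>QQ\<^esub>"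
proof -
  let ?t = "tens R Q Q"
  have QQ: "module R QQ" by (rule lin)+
  interpret QQ: module R QQ by (rule QQ)
  have l: "linear_map R H QQ (sw QQ (\<lambda>a b. ?t (\<pi> a) (\<pi> b)))"
    by (assumption | rule lin)+
  show ?thesis
    using assms
  proof induction
    case (prod k h)
    then have k: "k \<in> K" "\<epsilon> k = \<zero>\<^bsub>R\<^esub>" and [lin]: "h \<in> carrier H" "k \<in> carrier H" by (auto simp: K_closed)
    have tr: "?t q (r \<odot>\<^bsub>Q\<^esub> q') = r \<odot>\<^bsub>QQ\<^esub> ?t q q'" "?t (r \<odot>\<^bsub>Q\<^esub> q) q' = r \<odot>\<^bsub>QQ\<^esub> ?t q q'"
      if "q \<in> carrier Q" "q' \<in> carrier Q" "r \<in> carrier R" for q q' r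
      using linear_map_smult[OF bilinear_map_right[OF tens_bilinear[OF Q_module Q_module]]]
        linear_map_smult[OF bilinear_map_left[OF tens_bilinear[OF Q_module Q_module]]] that by simp_all
    have "sw QQ (\<lambda>a b. ?t (\<pi> a) (\<pi> b)) (k \<bullet> h) =
        sw QQ (\<lambda>a b. sw QQ (\<lambda>c d. ?t (\<pi> (a \<bullet> c)) (\<pi> (b \<bullet> d))) h) k"
      by (rule sw_mult) (assumption | rule lin)+
    also have "\<dots> = sw QQ (\<lambda>c d. ?t (\<pi> (k \<bullet> c)) (\<pi> d)) h"
    proof (rule sw_K_counit[OF QQ _ _ k(1)])
      fix a b assume [lin]: "a \<in> carrier H" and b: "b \<in> K"
      note [lin] = K_closed[OF b]
      have "sw QQ (\<lambda>c d. ?t (\<pi> (a \<bullet> c)) (\<pi> (b \<bullet> d))) h =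
          sw QQ (\<lambda>c d. \<epsilon> b \<odot>\<^bsub>QQ\<^esub> ?t (\<pi> (a \<bullet> c)) (\<pi> d)) h"
        by (rule sw_cong) ((assumption | rule lin)+, simp add: pi_K_mult[OF b] tr lin)
      also have "\<dots> = \<epsilon> b \<odot>\<^bsub>QQ\<^esub> sw QQ (\<lambda>c d. ?t (\<pi> (a \<bullet> c)) (\<pi> d)) h"
        by (rule linear_sw[OF QQ QQ linear_smult[OF QQ linear_map_id], symmetric]) (assumption | rule lin)+
      finally show "sw QQ (\<lambda>c d. ?t (\<pi> (a \<bullet> c)) (\<pi> (b \<bullet> d))) h =
          \<epsilon> b \<odot>\<^bsub>QQ\<^esub> sw QQ (\<lambda>c d. ?t (\<pi> (a \<bullet> c)) (\<pi> d)) h" .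
    qed (assumption | rule lin)+
    also have "\<dots> = sw QQ (\<lambda>c d. \<epsilon> k \<odot>\<^bsub>QQ\<^esub> ?t (\<pi> c) (\<pi> d)) h"
      by (rule sw_cong) ((assumption | rule lin)+, simp add: pi_K_mult[OF k(1)] tr lin)
    also have "\<dots> = \<epsilon> k \<odot>\<^bsub>QQ\<^esub> sw QQ (\<lambda>c d. ?t (\<pi> c) (\<pi> d)) h"
      by (rule linear_sw[OF QQ QQ linear_smult[OF QQ linear_map_id], symmetric]) (assumption | rule lin)+
    also have "\<dots> = \<zero>\<^bsub>QQ\<^esub>"
      unfolding k(2) by (rule smult_zero[OF QQ]) (assumption | rule lin)+
    finally show ?case .
  next
    case (sum x y)
    then show ?case by (simp add: linear_map_add[OF l] KH_carrier)
  qed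
qed

lemma counit_KH: assumes "x \<in> KH" shows "\<epsilon> x = \<zero>\<^bsub>regular_module R\<^esub>"
  using assms
proof induction
  case (prod k h)
  then show ?case by (simp add: counit_mult K_closed counit_closed regular_module_def)
next
  case (sum x y)
  then show ?case by (simp add: counit_add KH_carrier regular_module_def)
qed

definition "qcomult = factor (sw QQ (\<lambda>a b. tens R Q Q (\<pi> a) (\<pi> b)))"
definition "qcounit = factor \<epsilon>"

lemma QQ_module: "module R QQ"
  by (rule lin)+

lemma sw_pi_linear: "linear_map R H QQ (sw QQ (\<lambda>a b. tens R Q Q (\<pi> a) (\<pi> b)))"
  by (assumption | rule lin)+

lemmas qcomult_linear = factor_linear[OF QQ_module sw_pi_linear comult_KH, folded qcomult_def]
lemmas qcomult_pi = factor_pi[OF QQ_module sw_pi_linear comult_KH, folded qcomult_def]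
lemmas qcounit_linear = factor_linear[OF regular_module_module counit_linear counit_KH, folded qcounit_def]
lemmas qcounit_pi = factor_pi[OF regular_module_module counit_linear counit_KH, folded qcounit_def]

text \<open>Sweedler expressions over \<open>Q\<close> are Sweedler expressions over \<open>H\<close>, so \<open>Q\<close> inherits the
  coalgebra axioms.\<close>

lemma lift_qcomult:
  assumes P: "module R P" and f: "bilinear_map R Q Q P f" and x: "x \<in> carrier H"
  shows "tensor_lift P f (qcomult (\<pi> x)) = sw P (\<lambda>a b. f (\<pi> a) (\<pi> b)) x"
proof -
  note [lin] = P x linear_map_comp[OF bilinear_map_left[OF f]] linear_map_comp[OF bilinear_map_right[OF f]]
  have "tensor_lift P f (qcomult (\<pi> x)) = tensor_lift P f (sw QQ (\<lambda>a b. tens R Q Q (\<pi> a) (\<pi> b)) x)"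
    by (simp only: qcomult_pi[OF _ x])
  also have "\<dots> = sw P (\<lambda>a b. tensor_lift P f (tens R Q Q (\<pi> a) (\<pi> b))) x"
    by (rule linear_sw[OF QQ_module P lift_linear[OF Q_module Q_module P f]]) (assumption | rule lin)+
  also have "\<dots> = sw P (\<lambda>a b. f (\<pi> a) (\<pi> b)) x"
    by (rule sw_cong[symmetric]) ((assumption | rule lin)+, simp add: lift_tens[OF Q_module Q_module P f] lin)
  finally show ?thesis .
qed

lemma Q_coalgebra: "coalgebra R Q qcomult qcounit"
proof (rule coalgebra.intro[OF Q_module], unfold_locales)
  show "linear_map R Q QQ qcomult" by (rule qcomult_linear)
  show "linear_map R Q (regular_module R) qcounit" by (rule qcounit_linear)
  note [lin] = linear_map_comp[OF qcomult_linear] linear_map_closed[OF qcomult_linear]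
  let ?P = "tensor R Q QQ" and ?t = "\<lambda>p q r. tens R Q QQ p (tens R Q Q q r)"
  have P: "module R ?P" by (rule lin)+
  fix q assume "q \<in> carrier Q"
  then obtain x where [lin]: "x \<in> carrier H" and q: "q = \<pi> x" by (rule Q_cases)
  have "tensor_lift ?P (\<lambda>a b. tens R Q QQ a (qcomult b)) (qcomult q) =
      sw ?P (\<lambda>a b. tens R Q QQ (\<pi> a) (qcomult (\<pi> b))) x"
    unfolding q by (rule lift_qcomult[OF P]) (assumption | rule lin)+
  also have "\<dots> = sw ?P (\<lambda>a b. sw ?P (\<lambda>c d. ?t (\<pi> a) (\<pi> c) (\<pi> d)) b) x"
  proof (rule sw_cong)
    fix a b assume [lin]: "a \<in> carrier H" "b \<in> carrier H"
    have "tens R Q QQ (\<pi> a) (qcomult (\<pi> b)) = tens R Q QQ (\<pi> a) (sw QQ (\<lambda>c d. tens R Q Q (\<pi> c) (\<pi> d)) b)"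
      by (simp only: qcomult_pi lin)
    also have "\<dots> = sw ?P (\<lambda>c d. ?t (\<pi> a) (\<pi> c) (\<pi> d)) b"
      by (rule linear_sw[OF QQ_module P linear_tens_right[OF Q_module QQ_module _ linear_map_id]])
        (assumption | rule lin)+
    finally show "tens R Q QQ (\<pi> a) (qcomult (\<pi> b)) = sw ?P (\<lambda>c d. ?t (\<pi> a) (\<pi> c) (\<pi> d)) b" .
  qed (assumption | rule lin)+
  also have "\<dots> = sw ?P (\<lambda>a b. sw ?P (\<lambda>c d. ?t (\<pi> c) (\<pi> d) (\<pi> b)) a) x"
    by (rule sw_coassoc) (assumption | rule lin)+
  also have "\<dots> = sw ?P (\<lambda>a b. tensor_lift ?P (\<lambda>c d. ?t c d (\<pi> b)) (qcomult (\<pi> a))) x"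
    by (rule sw_cong, (assumption | rule lin)+, rule lift_qcomult[symmetric], (assumption | rule lin)+)
  also have "\<dots> = tensor_lift ?P (\<lambda>a b. tensor_lift ?P (\<lambda>c d. ?t c d b) (qcomult a)) (qcomult q)"
    unfolding q
  proof (rule lift_qcomult[OF P, symmetric])
    show "bilinear_map R Q Q ?P (\<lambda>a b. tensor_lift ?P (\<lambda>c d. ?t c d b) (qcomult a))"
    proof (rule bilinear_mapI)
      show "linear_map R Q ?P (\<lambda>a. tensor_lift ?P (\<lambda>c d. ?t c d b) (qcomult a))"
        if [lin]: "b \<in> carrier Q" for b
        by (rule linear_map_comp[OF lift_linear qcomult_linear]) (assumption | rule lin)+
      show "linear_map R Q ?P (\<lambda>b. tensor_lift ?P (\<lambda>c d. ?t c d b) (qcomult a))"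
        if [lin]: "a \<in> carrier Q" for a
        by (rule lift_param_linear[OF Q_module Q_module Q_module P]) (assumption | rule lin)+
    qed
  qed (rule lin)
  finally show "tensor_lift ?P (\<lambda>a b. tens R Q QQ a (qcomult b)) (qcomult q) =
    tensor_lift ?P (\<lambda>a b. tensor_lift ?P (\<lambda>c d. ?t c d b) (qcomult a)) (qcomult q)" .
  have ec: "qcounit p \<in> carrier R" if "p \<in> carrier Q" for p
    using linear_map_closed[OF qcounit_linear that] by (simp add: regular_module_def)
  note [lin] = linear_scalar[OF _ linear_map_comp[OF qcounit_linear]] ec
  have "tensor_lift Q (\<lambda>a b. qcounit a \<odot>\<^bsub>Q\<^esub> b) (qcomult q) = sw Q (\<lambda>a b. qcounit (\<pi> a) \<odot>\<^bsub>Q\<^esub> \<pi> b) x"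
    unfolding q by (rule lift_qcomult[OF Q_module]) (assumption | rule lin)+
  also have "\<dots> = sw Q (\<lambda>a b. \<epsilon> a \<odot>\<^bsub>Q\<^esub> \<pi> b) x"
    by (rule sw_cong) ((assumption | rule lin)+, simp only: qcounit_pi)
  also have "\<dots> = q"
    unfolding q by (rule sw_counit_left[OF Q_module pi_linear]) (rule lin)
  finally show "tensor_lift Q (\<lambda>a b. qcounit a \<odot>\<^bsub>Q\<^esub> b) (qcomult q) = q" .
  have "tensor_lift Q (\<lambda>a b. qcounit b \<odot>\<^bsub>Q\<^esub> a) (qcomult q) = sw Q (\<lambda>a b. qcounit (\<pi> b) \<odot>\<^bsub>Q\<^esub> \<pi> a) x"
    unfolding q by (rule lift_qcomult[OF Q_module]) (assumption | rule lin)+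
  also have "\<dots> = sw Q (\<lambda>a b. \<epsilon> b \<odot>\<^bsub>Q\<^esub> \<pi> a) x"
    by (rule sw_cong) ((assumption | rule lin)+, simp only: qcounit_pi)
  also have "\<dots> = q"
    unfolding q by (rule sw_counit_right[OF Q_module pi_linear]) (rule lin)
  finally show "tensor_lift Q (\<lambda>a b. qcounit b \<odot>\<^bsub>Q\<^esub> a) (qcomult q) = q" .
qed

theorem Q_Quot_gen: "Q \<in> Quot_gen R H \<Delta> \<epsilon>"
proof -
  have "right_ideal KH H"
    unfolding right_ideal_def using KH_mult submodule.axioms(1)[OF KH_submodule]
    by (auto intro: additive_subgroupI)
  moreover have "coalgebra_map R H \<Delta> \<epsilon> Q qcomult qcounit \<pi>"
    unfolding coalgebra_map_def using pi_linear qcomult_pi qcounit_pi by simp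
  then have "coideal R H \<Delta> \<epsilon> KH"
    unfolding coideal_def using KH_submodule Q_coalgebra by blast
  ultimately show ?thesis unfolding Quot_gen_def by blast
qed

end


section \<open>Galois extensions\<close>

context coideal_subalgebra
begin

lemmas tnsK_bilinear = tns_bilinear[OF K_scalars]
lemmas HKH_module = HSH_module[OF K_scalars]
lemmas tnsK_lin = HKH_module linear_map_comp[OF bilinear_map_left[OF tnsK_bilinear]]
  linear_map_comp[OF bilinear_map_right[OF tnsK_bilinear]] bilinear_map_closed[OF tnsK_bilinear]
lemmas HKH_lift = HSH_lift[OF K_scalars]
lemmas HKH_ext = HSH_ext[OF K_scalars]

lemma can_lift:
  shows "linear_map R (HSH K) HQ (tensor_lift HQ can)"
    and "a \<in> carrier H \<Longrightarrow> b \<in> carrier H \<Longrightarrow> tensor_lift HQ can (tns K a b) = can a b"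
  by (rule HKH_lift[OF HQ_module can_bilinear can_balanced]; (assumption | rule K_coinv)+)+

text \<open>As a function of \<open>x\<close> modulo \<open>K\<^sup>+H\<close> this is the inverse of the Galois map.\<close>

definition "S_tns h x = sw (HSH K) (\<lambda>a b. tns K (h \<bullet> S a) b) x"

lemma S_tns_bilinear: "bilinear_map R H H (HSH K) S_tns"
proof -
  note [lin] = tnsK_lin
  show ?thesis unfolding S_tns_def by (assumption | rule lin)+
qed

text \<open>Here \<open>S(ky) = S(y)S(k)\<close> would suffice; it is quicker to check that the shear of the right side is
  \<open>h \<otimes> ky\<close>, by cancelling first \<open>S(k\<^sub>1)k\<^sub>2\<close> and then \<open>S(y\<^sub>1)y\<^sub>2\<close>.\<close>

lemma unshear_mult:
  assumes [lin]: "h \<in> carrier H" "k \<in> carrier H" "y \<in> carrier H"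
  shows "unshear (tens R H H h (k \<bullet> y)) =
    sw HH (\<lambda>a b. sw HH (\<lambda>c d. tens R H H (h \<bullet> S a \<bullet> S c) (d \<bullet> b)) k) y"
    (is "_ = ?z")
proof -
  let ?t = "tens R H H"
  note [lin] = linear_map_comp[OF shear_linear]
  have z: "?z \<in> carrier HH" by (assumption | rule lin)+
  have "shear ?z = sw HH (\<lambda>a b. shear (sw HH (\<lambda>c d. ?t (h \<bullet> S a \<bullet> S c) (d \<bullet> b)) k)) y"
    by (rule linear_sw[OF HH_module HH_module shear_linear]) (assumption | rule lin)+
  also have "\<dots> = sw HH (\<lambda>a b. sw HH (\<lambda>c d. shear (?t (h \<bullet> S a \<bullet> S c) (d \<bullet> b))) k) y"
    by (rule sw_cong, (assumption | rule lin)+, rule linear_sw[OF HH_module HH_module shear_linear],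
        (assumption | rule lin)+)
  also have "\<dots> = sw HH (\<lambda>a b. sw HH (\<lambda>c d. sw HH (\<lambda>e f. sw HH (\<lambda>p q.
      ?t (h \<bullet> S a \<bullet> (S c \<bullet> e \<bullet> p)) (f \<bullet> q)) b) d) k) y"
    by (rule sw_cong, (assumption | rule lin)+, rule sw_cong, (assumption | rule lin)+,
        rule trans[OF shear_tens], (assumption | rule lin)+, rule trans[OF sw_mult], (assumption | rule lin)+,
        rule sw_cong, (assumption | rule lin)+, rule sw_cong, (assumption | rule lin)+,
        simp add: H.m_assoc lin)
  also have "\<dots> = sw HH (\<lambda>a b. sw HH (\<lambda>p q.
      ?t (h \<bullet> S a \<bullet> (\<one>\<^bsub>H\<^esub> \<bullet> p)) (k \<bullet> q)) b) y"
    by (rule sw_cong, (assumption | rule lin)+,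
        rule sw_cancel_left[where t = "\<lambda>u f. sw HH (\<lambda>p q. ?t (h \<bullet> antipode _ \<bullet> (u \<bullet> p)) (f \<bullet> q)) _"],
        (assumption | rule lin)+)
  also have "\<dots> = sw HH (\<lambda>a b. sw HH (\<lambda>p q. ?t (h \<bullet> (S a \<bullet> p)) (k \<bullet> q)) b) y"
    by (rule sw_cong, (assumption | rule lin)+, rule sw_cong, (assumption | rule lin)+,
        simp add: H.m_assoc lin)
  also have "\<dots> = ?t (h \<bullet> \<one>\<^bsub>H\<^esub>) (k \<bullet> y)"
    by (rule sw_cancel_left[where t = "\<lambda>u q. ?t (h \<bullet> u) (k \<bullet> q)"]) (assumption | rule lin)+
  finally have "shear ?z = ?t h (k \<bullet> y)" by (simp add: lin)
  then show ?thesis using unshear_shear[OF z] by simp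
qed

text \<open>For \<open>k \<in> K\<^sup>+\<close> the element is \<open>hS(y\<^sub>1)S(k\<^sub>1) \<otimes> k\<^sub>2y\<^sub>2\<close>. Moving \<open>k\<^sub>2 \<in> K\<close> across the tensor sign over
  \<open>K\<close> produces the factor \<open>S(k\<^sub>1)k\<^sub>2 = \<epsilon>(k) = 0\<close>.\<close>

lemma S_tns_KH:
  assumes [lin]: "h \<in> carrier H" and x: "x \<in> KH"
  shows "S_tns h x = \<zero>\<^bsub>HSH K\<^esub>"
proof -
  let ?P = "HSH K"
  interpret P: module R ?P by (rule HKH_module)
  note [lin] = tnsK_lin
  define V where "V = tensor_lift ?P (tns K)"
  note V_lin = lift_linear[OF H_module H_module HKH_module tnsK_bilinear, folded V_def]
    and V_tens = lift_tens[OF H_module H_module HKH_module tnsK_bilinear, folded V_def]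
  have V: "S_tns h x = V (unshear (tens R H H h x))" if [lin]: "x \<in> carrier H" for x
  proof -
    have "V (unshear (tens R H H h x)) = V (sw HH (\<lambda>a b. tens R H H (h \<bullet> S a) b) x)"
      by (simp add: unshear_tens lin)
    also have "\<dots> = sw ?P (\<lambda>a b. V (tens R H H (h \<bullet> S a) b)) x"
      by (rule linear_sw[OF HH_module HKH_module V_lin]) (assumption | rule lin)+
    also have "\<dots> = S_tns h x"
      unfolding S_tns_def
      by (rule sw_cong[symmetric]) ((assumption | rule lin)+, simp add: V_tens lin)
    finally show ?thesis by simp
  qed
  show ?thesis
    using x
  proof induction
    case (prod k y)
    then have k: "k \<in> K" "\<epsilon> k = \<zero>\<^bsub>R\<^esub>" and [lin]: "y \<in> carrier H" "k \<in> carrier H" by (auto simp: K_closed)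
    have "S_tns h (k \<bullet> y) = V (sw HH (\<lambda>a b. sw HH (\<lambda>c d.
        tens R H H (h \<bullet> S a \<bullet> S c) (d \<bullet> b)) k) y)"
      by (simp add: V unshear_mult lin)
    also have "\<dots> = sw ?P (\<lambda>a b. V (sw HH (\<lambda>c d.
        tens R H H (h \<bullet> S a \<bullet> S c) (d \<bullet> b)) k)) y"
      by (rule linear_sw[OF HH_module HKH_module V_lin]) (assumption | rule lin)+
    also have "\<dots> = sw ?P (\<lambda>a b. \<epsilon> k \<odot>\<^bsub>?P\<^esub> tns K (h \<bullet> S a \<bullet> \<one>\<^bsub>H\<^esub>) b) y"
    proof (rule sw_cong)
      show "bilinear_map R H H ?P (\<lambda>a b. V (sw HH (\<lambda>c d.
          tens R H H (h \<bullet> S a \<bullet> S c) (d \<bullet> b)) k))"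
        by (rule bilinear_map_comp[OF V_lin]) (assumption | rule lin)+
      fix a b assume [lin]: "a \<in> carrier H" "b \<in> carrier H"
      have "V (sw HH (\<lambda>c d. tens R H H (h \<bullet> S a \<bullet> S c) (d \<bullet> b)) k) =
          sw ?P (\<lambda>c d. V (tens R H H (h \<bullet> S a \<bullet> S c) (d \<bullet> b))) k"
        by (rule linear_sw[OF HH_module HKH_module V_lin]) (assumption | rule lin)+
      also have "\<dots> = sw ?P (\<lambda>c d. tns K (h \<bullet> S a \<bullet> S c) (d \<bullet> b)) k"
        by (rule sw_cong[symmetric]) ((assumption | rule lin)+, simp add: V_tens lin)
      also have "\<dots> = sw ?P (\<lambda>c d. tns K (h \<bullet> S a \<bullet> (S c \<bullet> d)) b) k"
      proof (rule sw_cong_K[OF HKH_module _ _ k(1)])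
        fix c d assume [lin]: "c \<in> carrier H" and d: "d \<in> K"
        note [lin] = K_closed[OF d]
        have "tns K (h \<bullet> S a \<bullet> S c \<bullet> d) b =
            tns K (h \<bullet> S a \<bullet> S c) (d \<bullet> b)"
          by (rule tns_balanced[OF K_scalars _ d]) (rule lin)+
        then show "tns K (h \<bullet> S a \<bullet> S c) (d \<bullet> b) =
            tns K (h \<bullet> S a \<bullet> (S c \<bullet> d)) b"
          by (simp add: H.m_assoc lin)
      qed (assumption | rule lin)+
      also have "\<dots> = \<epsilon> k \<odot>\<^bsub>?P\<^esub> tns K (h \<bullet> S a \<bullet> \<one>\<^bsub>H\<^esub>) b"
        by (rule sw_antipode_left[where g = "\<lambda>u. tns K (h \<bullet> S a \<bullet> u) b"])
          (assumption | rule lin)+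
      finally show "V (sw HH (\<lambda>c d. tens R H H (h \<bullet> S a \<bullet> S c) (d \<bullet> b)) k) =
          \<epsilon> k \<odot>\<^bsub>?P\<^esub> tns K (h \<bullet> S a \<bullet> \<one>\<^bsub>H\<^esub>) b" .
    qed (rule lin)+
    also have "\<dots> = \<epsilon> k \<odot>\<^bsub>?P\<^esub> sw ?P (\<lambda>a b. tns K (h \<bullet> S a \<bullet> \<one>\<^bsub>H\<^esub>) b) y"
      by (rule linear_sw[OF HKH_module HKH_module linear_smult[OF HKH_module linear_map_id], symmetric])
        (assumption | rule lin)+
    also have "\<dots> = \<zero>\<^bsub>?P\<^esub>"
      unfolding k(2) by (rule smult_zero[OF HKH_module]) (assumption | rule lin)+
    finally show ?case .
  next
    case (sum x y)
    then show ?case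
      using linear_map_add[OF bilinear_map_right[OF S_tns_bilinear \<open>h \<in> carrier H\<close>]]
      by (simp add: KH_carrier)
  qed
qed

theorem can_bij: "bij_betw (tensor_lift HQ can) (carrier (HSH K)) (carrier HQ)"
proof -
  let ?P = "HSH K"
  note [lin] = tnsK_lin
    linear_map_comp[OF bilinear_map_left[OF S_tns_bilinear]]
    linear_map_comp[OF bilinear_map_right[OF S_tns_bilinear]] bilinear_map_closed[OF S_tns_bilinear]
  note fp = factor_pi[OF HKH_module bilinear_map_right[OF S_tns_bilinear] S_tns_KH]
  note fl = factor_linear[OF HKH_module bilinear_map_right[OF S_tns_bilinear] S_tns_KH]
  have bil: "bilinear_map R H Q ?P (\<lambda>h q. factor (S_tns h) q)"
  proof (rule bilinear_mapI)
    show "linear_map R H ?P (\<lambda>h. factor (S_tns h) q)" if qQ: "q \<in> carrier Q" for q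
    proof -
      obtain x where [lin]: "x \<in> carrier H" and q: "q = \<pi> x" using qQ by (rule Q_cases)
      show ?thesis
        by (rule linear_map_cong[where f = "\<lambda>h. S_tns h x"])
          ((assumption | rule lin)+, simp add: q fp lin)
    qed
    show "linear_map R Q ?P (\<lambda>q. factor (S_tns h) q)" if "h \<in> carrier H" for h
      by (rule fl[OF that that])
  qed
  define G where "G = tensor_lift ?P (\<lambda>h q. factor (S_tns h) q)"
  note G_lin = lift_linear[OF H_module Q_module HKH_module bil, folded G_def]
    and G_tens = lift_tens[OF H_module Q_module HKH_module bil, folded G_def]
  have G_pi: "G (tens R H Q h (\<pi> x)) = S_tns h x" if "h \<in> carrier H" "x \<in> carrier H" for h x
    using that by (simp add: G_tens pi_closed fp)
  have can_G: "tensor_lift HQ can (G C) = C" if C: "C \<in> carrier HQ" for C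
  proof (rule tensor_ext[OF H_module Q_module linear_map_comp[OF can_lift(1) G_lin] linear_map_id _ C])
    fix h q assume [lin]: "h \<in> carrier H" and "q \<in> carrier Q"
    from \<open>q \<in> carrier Q\<close> obtain x where [lin]: "x \<in> carrier H" and q: "q = \<pi> x" by (rule Q_cases)
    have "tensor_lift HQ can (G (tens R H Q h q)) = tensor_lift HQ can (S_tns h x)"
      by (simp add: q G_pi lin)
    also have "\<dots> = sw HQ (\<lambda>a b. tensor_lift HQ can (tns K (h \<bullet> S a) b)) x"
      unfolding S_tns_def by (rule linear_sw[OF HKH_module HQ_module can_lift(1)]) (assumption | rule lin)+
    also have "\<dots> = sw HQ (\<lambda>a b. can (h \<bullet> S a) b) x"
      by (rule sw_cong[OF HQ_module bilinear_map_comp[OF can_lift(1)]])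
        ((assumption | rule lin)+, simp add: can_lift(2) lin)
    also have "\<dots> = tens R H Q h q"
      unfolding q by (rule can_antipode) (rule lin)+
    finally show "tensor_lift HQ can (G (tens R H Q h q)) = tens R H Q h q" .
  qed
  have G_can: "G (tensor_lift HQ can A) = A" if A: "A \<in> carrier ?P" for A
  proof (rule HKH_ext[OF linear_map_comp[OF G_lin can_lift(1)] linear_map_id _ A])
    fix h x assume [lin]: "h \<in> carrier H" "x \<in> carrier H"
    have "G (tensor_lift HQ can (tns K h x)) = G (sw HQ (\<lambda>a b. tens R H Q (h \<bullet> a) (\<pi> b)) x)"
      by (simp add: can_lift(2) can_def lin)
    also have "\<dots> = sw ?P (\<lambda>a b. G (tens R H Q (h \<bullet> a) (\<pi> b))) x"
      by (rule linear_sw[OF HQ_module HKH_module G_lin]) (assumption | rule lin)+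
    also have "\<dots> = sw ?P (\<lambda>a b. sw ?P (\<lambda>c d. tns K (h \<bullet> (a \<bullet> S c)) d) b) x"
      by (rule sw_cong[OF HKH_module bilinear_map_comp[OF G_lin]], (assumption | rule lin)+,
          rule trans[OF G_pi], (assumption | rule lin)+, unfold S_tns_def, rule sw_cong,
          (assumption | rule lin)+, simp add: H.m_assoc lin)
    also have "\<dots> = tns K (h \<bullet> \<one>\<^bsub>H\<^esub>) x"
      by (rule sw_cancel_right[where t = "\<lambda>u d. tns K (h \<bullet> u) d"]) (assumption | rule lin)+
    finally show "G (tensor_lift HQ can (tns K h x)) = tns K h x" by (simp add: lin)
  qed
  show ?thesis
    by (rule bij_betwI[where g = G])
      (auto simp: can_G G_can intro: linear_map_closed[OF can_lift(1)] linear_map_closed[OF G_lin])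
qed

text \<open>For coinvariant \<open>x\<close> the element \<open>x \<otimes> 1\<close> is fixed by the shear and lies in the cotensor product,
  so it is \<open>kh\<^sub>1 \<otimes> h\<^sub>2\<close> summed over some element of \<open>K \<otimes> H\<close>. The map \<open>a \<otimes> b \<mapsto> aS(b)\<close> sends
  \<open>x \<otimes> 1\<close> to \<open>x\<close> and \<open>kh\<^sub>1 \<otimes> h\<^sub>2\<close> to \<open>k\<epsilon>(h) \<in> K\<close>.\<close>

theorem coinv_subset_K:
  assumes "Galois_coextension R H \<Delta> \<epsilon> K"
  shows "coinv \<subseteq> K"
proof
  fix x assume x: "x \<in> coinv"
  note [lin] = coinv_closed[OF x]
  let ?f = "\<lambda>k h. sw HH (\<lambda>a b. tens R H H (k \<bullet> a) b) h"
  let ?B = "tensor_lift HH ?f"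
  note f = bilinear_shear_incl[OF KK_module KK_incl]
  note B_lin = lift_linear[OF KK_module H_module HH_module f]
    and B_tens = lift_tens[OF KK_module H_module HH_module f]
  have bij: "bij_betw ?B (carrier (tensor R KK H)) (cotensor R H \<Delta> Q)"
    using assms unfolding Galois_coextension_def aug_quotient_eq KK_def[symmetric] .
  have "shear (tens R H H x \<one>\<^bsub>H\<^esub>) = ?f x \<one>\<^bsub>H\<^esub>"
    by (rule shear_tens) (rule lin)+
  also have "\<dots> = tens R H H (x \<bullet> \<one>\<^bsub>H\<^esub>) \<one>\<^bsub>H\<^esub>"
    by (rule sw_one) (assumption | rule lin)+
  finally have "tens R H H x \<one>\<^bsub>H\<^esub> = shear (tens R H H x \<one>\<^bsub>H\<^esub>)" by (simp add: lin)
  moreover have "shear (tens R H H x \<one>\<^bsub>H\<^esub>) \<in> cotensor R H \<Delta> Q"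
    by (rule shear_mem_cotensor_iff[THEN iffD2], (rule lin)+, rule coactL_coinv[OF x], rule lin)
  ultimately have "tens R H H x \<one>\<^bsub>H\<^esub> \<in> ?B ` carrier (tensor R KK H)"
    using bij_betw_imp_surj_on[OF bij] by simp
  then obtain A where A: "A \<in> carrier (tensor R KK H)" "tens R H H x \<one>\<^bsub>H\<^esub> = ?B A" by (elim imageE)
  let ?m = "\<lambda>a b. a \<bullet> S b"
  have m: "bilinear_map R H H H ?m" by (assumption | rule lin)+
  note m_lin = lift_linear[OF H_module H_module H_module m] and m_tens = lift_tens[OF H_module H_module H_module m]
  have "tensor_lift H ?m (?B A) \<in> K"
    using KK_module H_module A(1)
  proof (induction rule: tensor_induct)
    case (tens k h)
    then have k: "k \<in> K" and [lin]: "k \<in> carrier H" "h \<in> carrier H" by (simp_all add: carrier_KK K_closed)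
    have "tensor_lift H ?m (?B (tens R KK H k h)) = tensor_lift H ?m (?f k h)"
      using tens by (simp only: B_tens)
    also have "\<dots> = sw H (\<lambda>a b. tensor_lift H ?m (tens R H H (k \<bullet> a) b)) h"
      by (rule linear_sw[OF HH_module H_module m_lin]) (assumption | rule lin)+
    also have "\<dots> = sw H (\<lambda>a b. k \<bullet> (a \<bullet> S b)) h"
      by (rule sw_cong[OF H_module bilinear_map_comp[OF m_lin]])
        ((assumption | rule lin)+, simp add: m_tens H.m_assoc lin)
    also have "\<dots> = \<epsilon> h \<odot>\<^bsub>H\<^esub> (k \<bullet> \<one>\<^bsub>H\<^esub>)"
      by (rule sw_antipode_right[where g = "\<lambda>u. k \<bullet> u"]) (assumption | rule lin)+
    also have "\<dots> \<in> K"
      using submoduleE(4)[OF K_submodule counit_closed k] by (simp add: lin)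
    finally show ?case .
  next
    case (add A B)
    then show ?case
      using subringE(7)[OF K_subring]
      by (simp add: linear_map_add[OF B_lin] linear_map_add[OF m_lin] linear_map_closed[OF B_lin])
  qed
  moreover have "tensor_lift H ?m (tens R H H x \<one>\<^bsub>H\<^esub>) = x"
    by (simp add: m_tens lin antipode_one)
  ultimately show "x \<in> K" using A(2) by simp
qed

end

context right_ideal_quotient
begin

lemma coinv_Sub_gen:
  fixes e :: "('h, 'h set) tens \<Rightarrow> 'u"
  assumes flat: "flat TYPE('u) R H" and e: "inj e"
  shows "coinv \<in> Sub_gen R H \<Delta>"
proof -
  have "\<Delta> ` coinv \<subseteq> tensor_id_map R H H (\<lambda>x. x) ` carrier (tensor R H KM)"
    using coinv_coideal[OF flat e] by blast
  then show ?thesis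
    unfolding Sub_gen_def KM_def using coinv_subring coinv_submodule by blast
qed

text \<open>Apply \<open>\<epsilon> \<otimes> id\<close> to \<open>k\<^sub>1 \<otimes> \<pi>(k\<^sub>2) = k \<otimes> \<pi>(1)\<close>.\<close>

lemma coinv_counit_zero:
  assumes k: "k \<in> coinv" and "\<epsilon> k = \<zero>\<^bsub>R\<^esub>" shows "k \<in> I"
proof -
  note [lin] = coinv_closed[OF k]
  have "\<pi> k = sw Q (\<lambda>a b. \<epsilon> a \<odot>\<^bsub>Q\<^esub> \<pi> b) k"
    by (rule sw_counit_left[OF Q_module pi_linear, symmetric]) (rule lin)
  also have "\<dots> = \<epsilon> k \<odot>\<^bsub>Q\<^esub> \<pi> \<one>\<^bsub>H\<^esub>"
    by (rule sw_coinv[where f = "\<lambda>a q. \<epsilon> a \<odot>\<^bsub>Q\<^esub> q", OF Q_module _ k]) (assumption | rule lin)+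
  also have "\<dots> = \<zero>\<^bsub>Q\<^esub>"
    unfolding assms(2) by (rule smult_zero[OF Q_module]) (rule lin)+
  finally show ?thesis
    using pi_eq_zero_iff[OF coinv_closed[OF k]] by simp
qed

text \<open>For \<open>x \<in> I\<close> the Galois map sends \<open>S(x\<^sub>1) \<otimes> x\<^sub>2\<close> to \<open>1 \<otimes> \<pi>(x) = 0\<close>, so this element of \<open>H \<otimes>\<^sub>C H\<close>
  vanishes. Over \<open>C\<close> the map \<open>a \<otimes> b \<mapsto> \<epsilon>(a)b + C\<^sup>+H\<close> is well defined and sends it to the class of \<open>x\<close>,
  since \<open>\<epsilon>(S(x\<^sub>1))x\<^sub>2 = x\<close>.\<close>

theorem Galois_extension_imp_ideal:
  assumes Sub: "coinv \<in> Sub_gen R H \<Delta>" and Gal: "Galois_extension R H \<Delta> Q"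
  shows "ideal_prod H {k \<in> coinv. \<epsilon> k = \<zero>\<^bsub>R\<^esub>} (carrier H) = I"
proof (intro equalityI subsetI)
  fix x assume "x \<in> ideal_prod H {k \<in> coinv. \<epsilon> k = \<zero>\<^bsub>R\<^esub>} (carrier H)"
  then show "x \<in> I"
  proof induction
    case (prod k h)
    then show ?case using coinv_counit_zero I_mult by blast
  next
    case (sum x y)
    then show ?case using submoduleE(5)[OF submod] by blast
  qed
next
  fix x assume x: "x \<in> I"
  interpret C: coideal_subalgebra R H \<Delta> \<epsilon> antipode coinv
    by (intro coideal_subalgebra.intro coideal_subalgebra_axioms.intro hopf_algebra_axioms Sub)
  let ?P = "HSH coinv" and ?t = "tns coinv"
  note P = HSH_module[OF coinv_scalars] and t = tns_bilinear[OF coinv_scalars]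
  have [lin]: "x \<in> carrier H" using x I_carrier by blast
  note [lin] = P linear_map_comp[OF bilinear_map_left[OF t]]
    linear_map_comp[OF bilinear_map_right[OF t]] bilinear_map_closed[OF t]
  interpret HQ: module R HQ by (rule HQ_module)
  interpret P: module R ?P by (rule P)
  note can_lift = HSH_lift[OF coinv_scalars HQ_module can_bilinear can_balanced]
  \<comment> \<open>The preimage of \<open>1 \<otimes> \<pi>(x)\<close> from \<open>can_antipode\<close>, with its factor \<open>h = 1\<close> kept.\<close>
  let ?z = "sw ?P (\<lambda>a b. ?t (\<one>\<^bsub>H\<^esub> \<bullet> S a) b) x"
  have "tensor_lift HQ can ?z = sw HQ (\<lambda>a b. tensor_lift HQ can (?t (\<one>\<^bsub>H\<^esub> \<bullet> S a) b)) x"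
    by (rule linear_sw[OF P HQ_module can_lift(1)]) (assumption | rule lin)+
  also have "\<dots> = sw HQ (\<lambda>a b. can (\<one>\<^bsub>H\<^esub> \<bullet> S a) b) x"
    by (rule sw_cong[OF HQ_module bilinear_map_comp[OF can_lift(1)]])
      ((assumption | rule lin)+, rule can_lift(2), (assumption | rule lin)+)
  also have "\<dots> = tens R H Q \<one>\<^bsub>H\<^esub> (\<pi> x)"
    by (rule can_antipode) (rule lin)+
  also have "\<pi> x = \<zero>\<^bsub>Q\<^esub>"
    using pi_eq_zero_iff[of x] x I_carrier by blast
  also have "tens R H Q \<one>\<^bsub>H\<^esub> \<dots> = \<zero>\<^bsub>HQ\<^esub>"
    by (rule linear_map_zero[OF Q_module HQ_module linear_tens_right[OF H_module Q_module _ linear_map_id]]) (rule lin)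
  also have "\<dots> = tensor_lift HQ can \<zero>\<^bsub>?P\<^esub>"
    by (rule linear_map_zero[OF P HQ_module can_lift(1), symmetric])
  finally have can_z: "tensor_lift HQ can ?z = tensor_lift HQ can \<zero>\<^bsub>?P\<^esub>" .
  have "?z = \<zero>\<^bsub>?P\<^esub>"
    by (rule inj_onD[OF bij_betw_imp_inj_on[OF Gal[unfolded Galois_extension_iff]] can_z])
      ((assumption | rule lin P.zero_closed)+)
  let ?W = "\<lambda>a b. \<epsilon> a \<odot>\<^bsub>C.Q\<^esub> C.\<pi> b"
  note [lin] = C.Q_module C.linear_pi C.pi_closed
  have W: "bilinear_map R H H C.Q ?W" by (assumption | rule lin)+
  have bal: "?W (a \<bullet> k) b = ?W a (k \<bullet> b)" if "a \<in> carrier H" "k \<in> coinv" "b \<in> carrier H" for a k b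
  proof -
    interpret CQ: module R C.Q by (rule C.Q_module)
    show ?thesis using that coinv_closed[OF that(2)]
      by (simp add: counit_mult C.pi_K_mult CQ.smult_assoc1 counit_closed C.pi_closed)
  qed
  note W_lift = HSH_lift[OF coinv_scalars C.Q_module W bal]
  have "C.\<pi> x = sw C.Q (\<lambda>a b. \<epsilon> a \<odot>\<^bsub>C.Q\<^esub> C.\<pi> b) x"
    by (rule sw_counit_left[OF C.Q_module C.pi_linear, symmetric]) (rule lin)
  also have "\<dots> = sw C.Q (\<lambda>a b. tensor_lift C.Q ?W (?t (\<one>\<^bsub>H\<^esub> \<bullet> S a) b)) x"
    by (rule sw_cong, (assumption | rule lin)+, rule trans[OF _ W_lift(2)[symmetric]],
      simp add: counit_antipode lin, (assumption | rule lin)+)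
  also have "\<dots> = tensor_lift C.Q ?W ?z"
    by (rule linear_sw[OF P C.Q_module W_lift(1), symmetric]) (assumption | rule lin)+
  also have "\<dots> = \<zero>\<^bsub>C.Q\<^esub>"
    unfolding \<open>?z = \<zero>\<^bsub>?P\<^esub>\<close> by (rule linear_map_zero[OF P C.Q_module W_lift(1)])
  finally show "x \<in> ideal_prod H {k \<in> coinv. \<epsilon> k = \<zero>\<^bsub>R\<^esub>} (carrier H)"
    using C.pi_eq_zero_iff[of x] x I_carrier by blast
qed

end


section \<open>The bijection criterion\<close>

theorem corollary4p6p3:
  fixes R :: "('r, 'x) ring_scheme" and H :: "('r, 'h, 'y) module_scheme"
    and \<Delta> :: "'h \<Rightarrow> ('h, 'h) tens" and \<epsilon> :: "'h \<Rightarrow> 'r" and antipode :: "'h \<Rightarrow> 'h"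
  assumes "hopf_algebra R H \<Delta> \<epsilon> antipode"
    and "flat TYPE('r + ('h, 'h set) tens) R H"
  shows "aug_quotient R H \<epsilon> \<in> Sub_gen R H \<Delta> \<rightarrow> Quot_gen R H \<Delta> \<epsilon> \<and>
    coinvariants R H \<Delta> \<in> Quot_gen R H \<Delta> \<epsilon> \<rightarrow> Sub_gen R H \<Delta> \<and>
    (inverse_bijections (aug_quotient R H \<epsilon>) (coinvariants R H \<Delta>)
       (Sub_gen R H \<Delta>) (Quot_gen R H \<Delta> \<epsilon>) \<longleftrightarrow>
      (\<forall>Q \<in> Quot_gen R H \<Delta> \<epsilon>. Galois_extension R H \<Delta> Q) \<and>
      (\<forall>K \<in> Sub_gen R H \<Delta>. Galois_coextension R H \<Delta> \<epsilon> K))"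
proof -
  let ?\<psi> = "aug_quotient R H \<epsilon>" and ?\<phi> = "coinvariants R H \<Delta>"
  let ?S = "Sub_gen R H \<Delta>" and ?Q = "Quot_gen R H \<Delta> \<epsilon>"
  have e: "inj (Inr :: ('h, 'h set) tens \<Rightarrow> 'r + ('h, 'h set) tens)" by simp
  \<comment> \<open>The test type also contains a copy of the type of \<open>H\<close>: any fixed second component, here the
    empty set, turns an element into a one-term formal sum.\<close>
  have e': "inj (\<lambda>h. Inr {frag_of (h, {})} :: 'r + ('h, 'h set) tens)"
    by (auto intro!: injI simp: frag_of_eq)
  have sub: "coideal_subalgebra R H \<Delta> \<epsilon> antipode K" if "K \<in> ?S" for K
    by (intro coideal_subalgebra.intro coideal_subalgebra_axioms.intro assms(1) that)
  have quot: "\<exists>I. right_ideal_quotient R H \<Delta> \<epsilon> antipode I \<and> Q = quot_module H I" if Q: "Q \<in> ?Q" for Q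
  proof -
    obtain I where I: "Q = quot_module H I" "right_ideal I H" "coideal R H \<Delta> \<epsilon> I"
      using Q by (auto simp: Quot_gen_def)
    have "right_ideal_quotient R H \<Delta> \<epsilon> antipode I"
      using I(2,3)
      by (intro right_ideal_quotient.intro right_ideal_quotient_axioms.intro assms(1))
        (auto simp: right_ideal_def coideal_def)
    then show ?thesis using I(1) by blast
  qed
  have \<psi>: "?\<psi> K \<in> ?Q" if "K \<in> ?S" for K
    using coideal_subalgebra.Q_Quot_gen[OF sub[OF that]] by (simp add: aug_quotient_def)
  have \<phi>: "?\<phi> Q \<in> ?S" if "Q \<in> ?Q" for Q
    using quot[OF that] right_ideal_quotient.coinv_Sub_gen[OF _ assms(2) e] by blast
  have ext: "Galois_extension R H \<Delta> (?\<psi> K)" if "K \<in> ?S" "?\<phi> (?\<psi> K) = K" for K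
  proof -
    interpret C: coideal_subalgebra R H \<Delta> \<epsilon> antipode K by (rule sub[OF that(1)])
    show ?thesis
      using C.can_bij that(2) unfolding C.aug_quotient_eq C.Galois_extension_iff by simp
  qed
  have coext: "Galois_coextension R H \<Delta> \<epsilon> K" if "K \<in> ?S" "?\<phi> (?\<psi> K) = K" for K
  proof -
    interpret C: coideal_subalgebra R H \<Delta> \<epsilon> antipode K by (rule sub[OF that(1)])
    have "C.KM = H\<lparr>carrier := K\<rparr>"
      using that(2) by (simp add: C.KM_def C.aug_quotient_eq)
    with C.coinv_Galois_coextension[OF assms(2) e e'] show ?thesis
      unfolding Galois_coextension_def C.aug_quotient_eq by (simp only:)
  qed
  have \<phi>\<psi>: "?\<phi> (?\<psi> K) = K" if "K \<in> ?S" "Galois_coextension R H \<Delta> \<epsilon> K" for K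
  proof -
    interpret C: coideal_subalgebra R H \<Delta> \<epsilon> antipode K by (rule sub[OF that(1)])
    show ?thesis
      using C.coinv_subset_K[OF that(2)] C.K_coinv by (auto simp: C.aug_quotient_eq)
  qed
  have \<psi>\<phi>: "?\<psi> (?\<phi> Q) = Q" if Q: "Q \<in> ?Q" and Gal: "Galois_extension R H \<Delta> Q" for Q
  proof -
    obtain I where "right_ideal_quotient R H \<Delta> \<epsilon> antipode I" and QI: "Q = quot_module H I"
      using quot[OF Q] by blast
    then interpret C: right_ideal_quotient R H \<Delta> \<epsilon> antipode I by simp
    show ?thesis
      using C.Galois_extension_imp_ideal \<phi>[OF Q] Gal by (simp add: QI aug_quotient_def)
  qed
  have "inverse_bijections ?\<psi> ?\<phi> ?S ?Q \<longleftrightarrow>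
      (\<forall>Q\<in>?Q. Galois_extension R H \<Delta> Q) \<and> (\<forall>K\<in>?S. Galois_coextension R H \<Delta> \<epsilon> K)"
  proof
    assume inv: "inverse_bijections ?\<psi> ?\<phi> ?S ?Q"
    show "(\<forall>Q\<in>?Q. Galois_extension R H \<Delta> Q) \<and> (\<forall>K\<in>?S. Galois_coextension R H \<Delta> \<epsilon> K)"
    proof (intro conjI ballI)
      fix Q assume Q: "Q \<in> ?Q"
      have "?\<psi> (?\<phi> Q) = Q" using inv Q by (simp add: inverse_bijections_def)
      then show "Galois_extension R H \<Delta> Q" using ext[OF \<phi>[OF Q]] by simp
    next
      fix K assume K: "K \<in> ?S"
      show "Galois_coextension R H \<Delta> \<epsilon> K"
        using inv K by (intro coext) (simp_all add: inverse_bijections_def)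
    qed
  qed (use \<psi> \<phi> \<phi>\<psi> \<psi>\<phi> in \<open>simp add: inverse_bijections_def\<close>)
  then show ?thesis using \<psi> \<phi> by simp
qed

end
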